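(* Let $d>1$ and $Q\ge 1$ be real constants, let $q_0,q_1,q_2,\dots$ be positive integers with $q_j=Qj^{d-1}+o(j^{d-1})$ as $j\to\infty$, and let $\chi:[0,\infty)\to(0,\infty)$ be any function with $\chi(x)\to\infty$ as $x\to\infty$ (arbitrarily slowly). For a positive integer $M$, let $b=b(M)>0$ be the unique positive root of $\sum_{j=1}^\infty \frac{jq_j}{e^{bj}-1}=M$, and set $\overline{N}=\overline{N}(M)=\sum_{j=1}^\infty\frac{q_j}{e^{bj}-1}$ and $$\Delta=\begin{cases}(\overline{N}\ln\overline{N})^{1/2}\chi(\overline{N}) & \text{if } d>2,\\ \overline{N}^{1/d}\,\ln\overline{N}\,\chi(\overline{N}) & \text{if } 1<d\le 2.\end{cases}$$ Then there exist constants $C_m$, $m=1,2,\dots$, independent of $M$ and $N$, such that for all positive integers $M,N$ with $N>\overline{N}(M)$, $$\mathsf{P}_{M,N}\bigl(|N_0-(N-\overline{N})|>\Delta\bigr)\le C_m\overline{N}^{-m},\qquad m=1,2,\dots.$$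
   Context: For positive integers $M,N$, let $\Omega_{M,N}$ be the (finite) set of all sequences $\{N_j\}_{j=0}^\infty$ of nonnegative integers with $\sum_{j=0}^\infty N_j=N$ and $\sum_{j=0}^\infty jN_j\le M$. Each such sequence is given the weight $W(\{N_j\})=\prod_{j=0}^\infty\binom{N_j+q_j-1}{N_j}$ (only finitely many factors differ from $1$), and $\mathsf{P}_{M,N}$ is the probability measure on $\Omega_{M,N}$ under which the probability of a sequence is its weight divided by the sum of the weights of all elements of $\Omega_{M,N}$. A condition written inside $\mathsf{P}_{M,N}(\cdot)$ denotes the set of sequences in $\Omega_{M,N}$ satisfying it. Convention: for the finitely many $M$ with $\overline{N}(M)<1$, when $d>2$, the expression $(\overline{N}\ln\overline{N})^{1/2}$ is read as $0$. *)

theory Defs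
  imports "HOL-Analysis.Analysis" "HOL-Library.Landau_Symbols"
begin

(* A sequence of nonnegative integers with a finite total has finite support, so the
   infinite sums are taken over the support. *)
definition Omega :: "nat \<Rightarrow> nat \<Rightarrow> (nat \<Rightarrow> nat) set" where
  "Omega M N = {n. finite {j. n j \<noteq> 0} \<and>
     (\<Sum>j | n j \<noteq> 0. n j) = N \<and> (\<Sum>j | n j \<noteq> 0. j * n j) \<le> M}"

(* The factors with n j = 0 are equal to 1.  The truncated subtraction is harmless,
   since q is assumed positive. *)
definition weight :: "(nat \<Rightarrow> nat) \<Rightarrow> (nat \<Rightarrow> nat) \<Rightarrow> nat" where
  "weight q n = (\<Prod>j | n j \<noteq> 0. (n j + q j - 1) choose (n j))"

definition P_meas :: "(nat \<Rightarrow> nat) \<Rightarrow> nat \<Rightarrow> nat \<Rightarrow> (nat \<Rightarrow> nat) measure" where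
  "P_meas q M N = point_measure (Omega M N)
     (\<lambda>n. ennreal (real (weight q n) / real (\<Sum>n'\<in>Omega M N. weight q n')))"

(* If every q j is positive and q grows polynomially, the series converges for every
   b > 0 and its sum decreases strictly from infinity to 0 as b runs through the positive
   reals; hence the root exists and is unique for every positive M. *)
definition b_root :: "(nat \<Rightarrow> nat) \<Rightarrow> nat \<Rightarrow> real" where
  "b_root q M = (THE b. b > 0 \<and>
     ((\<lambda>j. real j * real (q j) / (exp (b * real j) - 1)) has_sum real M) {1..})"

definition Nbar :: "(nat \<Rightarrow> nat) \<Rightarrow> nat \<Rightarrow> real" where
  "Nbar q M = (\<Sum>\<^sub>\<infinity>j\<in>{1..}. real (q j) / (exp (b_root q M * real j) - 1))"

(* To be applied to x = Nbar q M.  For d > 2 and x < 1 the square root of x * ln x is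
   read as 0.  For d \<le> 2 and x < 1 the value is negative. *)
definition Delta :: "real \<Rightarrow> (real \<Rightarrow> real) \<Rightarrow> real \<Rightarrow> real" where
  "Delta d chi x =
     (if d > 2 then (if x < 1 then 0 else sqrt (x * ln x)) * chi x
      else x powr (1 / d) * ln x * chi x)"

end

(* Write K for the sum of the n_j and E for the sum of the j n_j over j >= 1, so n_0 = N - K.
   With weights multiplied by exp (- b E), the n_j become independent negative binomial variables
   with E and K of mean M and Nbar.  Chernoff's inequality for K bounds the weight of the bad
   configurations by exp (S + b M) Nbar^(-m), S being the logarithm of the grand canonical
   partition function.  It remains to show that the configurations with E = M and K <= Nbar weigh
   at least exp (S + b M) M^(-k) for some k; as the binomial coefficient of n_0 varies by at
   most a power of 1 + Nbar, nothing else is lost.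

   For the lower bound, let w(x) be the sum of weight * exp (- tau K) over E = x.  Then
   x w(x) = sum_k sigma(k) w(x - k) with sigma(k) = sum_{j | k} j q_j exp (- tau k / j), which is
   of order k^d.  Induction on x, as in Erdos's elementary treatment of the partition function,
   shows that w(x) is at least x^(-kappa) times its saddle point upper bound, uniformly in tau.
   The tilt tau > 0 is chosen such that the sum of weight * exp (tau (Nbar - K)) over E = M is at
   least 3 exp (S + b M), while the same sum with 2 tau exceeds exp (S + b M) at most by a power
   of M.  By the first property the configurations with K > Nbar do not dominate the sum; the second
   one bounds exp (tau (Nbar - K)) by a power of M on the configurations that matter. *)
theory Submission
  imports Defs "HOL-Real_Asymp.Real_Asymp"
begin

section \<open>Power sums with exponential weights\<close>


text \<open>Of \<open>q\<close> only two-sided bounds by multiples of j^(d - 1) enter. They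
  determine an exponent such as S + b M only up to constant factors, far too little for comparing
  probabilities. The logarithms of the partition functions are therefore never approximated: upper
  and lower bounds contain the same exact expression, which cancels, and only differences of it, on
  the scale of ln M, are estimated up to constants. A loss of a power of M is harmless, as
  \<open>Delta\<close> contains the unbounded factor \<open>chi\<close> and the Chernoff exponent is
  at least of order chi (Nbar) ln Nbar; so no local limit theorem is required. The restriction to E
  = M lets the lower bound reach the full factor exp (b M); the restriction K <= Nbar makes a
  configuration fit into N particles for every N > Nbar. The saddle point of the tilted sum at
  energy M depends on \<tau> in an unknown way. Hence the gain of the tilt has to be bounded below
  uniformly in s, and all growth constants have to be uniform in \<tau>.\<close>

lemma powr_le_exp_half:
  assumes "p \<ge> 0"
  shows "\<exists>C>0. \<forall>y\<ge>0. (y::real) powr p \<le> C * exp (y / 2)"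
proof (cases "p = 0")
  case True
  have "y powr p \<le> 1 * exp (y / 2)" if "y \<ge> 0" for y :: real
    using that True one_le_exp_iff[of "y/2"] by (cases "y = 0") (auto simp del: one_le_exp_iff)
  then show ?thesis by (intro exI[of _ 1]) auto
next
  case False
  with assms have p: "p > 0" by simp
  \<comment> \<open>The function y^p exp (- y / 2) is largest at y = 2 p; the constant is its value
    there without the factor exp (- p).\<close>
  have "y powr p \<le> (2 * p) powr p * exp (y / 2)" if "y \<ge> 0" for y :: real
  proof (cases "y = 0")
    case False
    with that have y: "y > 0" by simp
    have "ln (y / (2 * p)) \<le> y / (2 * p) - 1" using y p by (intro ln_le_minus_one) auto
    then have "p * ln (y / (2 * p)) \<le> p * (y / (2 * p) - 1)" using p by (intro mult_left_mono) auto
    also have "\<dots> \<le> y / 2" using p by (simp add: field_simps)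
    finally have "p * ln y \<le> p * ln (2 * p) + y / 2"
      using y p by (simp add: ln_div algebra_simps)
    then have "exp (p * ln y) \<le> exp (p * ln (2 * p) + y / 2)" by simp
    then show ?thesis using y p by (simp add: powr_def exp_add)
  qed (use p in auto)
  then show ?thesis using p by (intro exI[of _ "(2 * p) powr p"]) auto
qed

lemma exp_sums:
  assumes "(u::real) > 0"
  shows "(\<lambda>n. exp (- u * real n)) sums (1 / (1 - exp (- u)))"
proof -
  have "(\<lambda>n. exp (- u) ^ n) sums (1 / (1 - exp (- u)))"
    using assms by (intro geometric_sums) auto
  then show ?thesis by (simp add: exp_of_nat_mult[symmetric] mult.commute)
qed

lemma exp_tail_sums:
  assumes "(u::real) > 0"
  shows "(\<lambda>n. exp (- u * real (Suc n))) sums (1 / (exp u - 1))"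
proof -
  have "(\<lambda>n. exp (- u) * exp (- u * real n)) sums (exp (- u) * (1 / (1 - exp (- u))))"
    by (intro sums_mult exp_sums assms)
  moreover have "exp (- u) * (1 / (1 - exp (- u))) = 1 / (exp u - 1)"
    using assms by (simp add: exp_minus field_simps)
  ultimately show ?thesis by (simp add: exp_add[symmetric] algebra_simps)
qed

text \<open>Half of the exponential absorbs the power at the price of u^(- p), by the previous bound
  at y = u n; the other half leaves a geometric series of sum at most 2 / u.\<close>

lemma powr_exp_sum_nonneg:
  assumes "p \<ge> 0"
  shows "\<exists>C>0. \<forall>u>0. summable (\<lambda>n. real n powr p * exp (- u * real n)) \<and>
    (\<Sum>n. real n powr p * exp (- u * real n)) \<le> C * u powr (- p - 1)"
proof -
  obtain C where C: "C > 0" "\<And>y. y \<ge> 0 \<Longrightarrow> (y::real) powr p \<le> C * exp (y / 2)"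
    using powr_le_exp_half[OF assms] by blast
  have "summable (\<lambda>n. real n powr p * exp (- u * real n)) \<and>
    (\<Sum>n. real n powr p * exp (- u * real n)) \<le> (2 * C) * u powr (- p - 1)" if u: "u > 0" for u
  proof -
    define g where "g = (\<lambda>n. C * u powr (- p) * exp (- (u / 2) * real (Suc n)))"
    have gs: "g sums (C * u powr (- p) * (1 / (exp (u / 2) - 1)))"
      unfolding g_def using u by (intro sums_mult exp_tail_sums) auto
    have le: "real (Suc n) powr p * exp (- u * real (Suc n)) \<le> g n" for n
    proof -
      have "(u * real (Suc n)) powr p \<le> C * exp (u * real (Suc n) / 2)" using C(2) u by simp
      then have "u powr p * real (Suc n) powr p \<le> C * exp (u * real (Suc n) / 2)"
        using u by (simp add: powr_mult)
      then have "real (Suc n) powr p \<le> C * u powr (- p) * exp (u * real (Suc n) / 2)"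
        using u by (simp add: powr_minus field_simps)
      then have "real (Suc n) powr p * exp (- u * real (Suc n)) \<le>
          C * u powr (- p) * exp (u * real (Suc n) / 2) * exp (- u * real (Suc n))"
        by (intro mult_right_mono) auto
      also have "\<dots> = g n" 
        unfolding g_def by (simp add: mult.assoc exp_add[symmetric] add_divide_distrib)
      finally show ?thesis .
    qed
    have s: "summable (\<lambda>n. real (Suc n) powr p * exp (- u * real (Suc n)))"
    proof (rule summable_comparison_test'[OF sums_summable[OF gs], of 0])
      show "norm (real (Suc n) powr p * exp (- u * real (Suc n))) \<le> g n" for n
        using le[of n] by (subst real_norm_def, subst abs_of_nonneg) (intro mult_nonneg_nonneg, auto)
    qed
    then have s': "summable (\<lambda>n. real n powr p * exp (- u * real n))"
      using summable_Suc_iff[of "\<lambda>n. real n powr p * exp (- u * real n)"] by simp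
    have "(\<Sum>n. real n powr p * exp (- u * real n)) =
        (\<Sum>n. real (Suc n) powr p * exp (- u * real (Suc n)))"
      using suminf_split_head[OF s'] by simp
    also have "\<dots> \<le> suminf g" by (rule suminf_le[OF le s sums_summable[OF gs]])
    also have "\<dots> = C * u powr (- p) * (1 / (exp (u / 2) - 1))" using gs by (simp add: sums_iff)
    also have "\<dots> \<le> C * u powr (- p) * (2 / u)"
    proof (rule mult_left_mono)
      have "exp (u / 2) \<ge> 1 + u / 2" by (rule exp_ge_add_one_self)
      then show "1 / (exp (u / 2) - 1) \<le> 2 / u" using u by (simp add: field_simps)
    qed (use C in auto)
    also have "\<dots> = (2 * C) * u powr (- p - 1)" using u by (simp add: powr_diff)
    finally show ?thesis using s' by blast
  qed
  then show ?thesis using C(1) by (intro exI[of _ "2 * C"]) auto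
qed

text \<open>Bernoulli's inequality for the concave power p + 1, obtained from the weighted
  inequality of arithmetic and geometric means with weights p + 1 and - p.\<close>

lemma powr_diff_ge:
  assumes "-1 < p" "p < 0" "n \<ge> 1"
  shows "(p + 1) * real n powr p \<le> real n powr (p + 1) - (real n - 1) powr (p + 1)"
proof (cases "n = 1")
  case False
  with assms have n: "real n > 1" by simp
  have "(1 - 1 / real n) powr (p + 1) * 1 powr (- p) \<le> (p + 1) * (1 - 1 / real n) + (- p) * 1"
    using assms n by (intro Youngs_inequality_0) (auto simp: field_simps)
  then have *: "(1 - 1 / real n) powr (p + 1) \<le> 1 - (p + 1) / real n"
    by (simp add: algebra_simps add_divide_distrib)
  have "real n - 1 = real n * (1 - 1 / real n)" using n by (simp add: field_simps)
  then have "(real n - 1) powr (p + 1) = (real n * (1 - 1 / real n)) powr (p + 1)"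
    by (rule arg_cong)
  also have "\<dots> = real n powr (p + 1) * (1 - 1 / real n) powr (p + 1)"
    using n by (simp add: powr_mult)
  also have "\<dots> \<le> real n powr (p + 1) * (1 - (p + 1) / real n)"
    by (intro mult_left_mono *) auto
  also have "\<dots> = real n powr (p + 1) - (p + 1) * real n powr p"
    using n by (simp add: powr_add field_simps)
  finally show ?thesis by simp
qed (use assms in auto)

text \<open>For p < 0 the power is dominated by a difference of (p + 1)-th powers, and summation by
  parts reduces the sum to the nonnegative exponent p + 1. Negative exponents occur as d - 3 with 2
  < d < 3 in \<open>rho_sum\<close>.\<close>

lemma powr_exp_sum:
  assumes "p > -1"
  shows "\<exists>C>0. \<forall>u>0. summable (\<lambda>n. real n powr p * exp (- u * real n)) \<and>
    (\<Sum>n. real n powr p * exp (- u * real n)) \<le> C * u powr (- p - 1)"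
proof (cases "p \<ge> 0")
  case False
  then have p: "p < 0" by simp
  obtain C where C: "C > 0" "\<And>u. u > 0 \<Longrightarrow> summable (\<lambda>n. real n powr (p + 1) * exp (- u * real n))"
    "\<And>u. u > 0 \<Longrightarrow> (\<Sum>n. real n powr (p + 1) * exp (- u * real n)) \<le> C * u powr (- (p + 1) - 1)"
    using powr_exp_sum_nonneg[of "p + 1"] assms by auto
  have "summable (\<lambda>n. real n powr p * exp (- u * real n)) \<and>
    (\<Sum>n. real n powr p * exp (- u * real n)) \<le> (C / (p + 1)) * u powr (- p - 1)" if u: "u > 0" for u
  proof -
    define h where "h = (\<lambda>n. real n powr (p + 1) * exp (- u * real n))"
    have hs: "summable h" unfolding h_def using C(2) u by blast
    then have h0: "h \<longlonglongrightarrow> 0" by (rule summable_LIMSEQ_zero)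
    \<comment> \<open>The bound exp (- u) >= 1 - u produces a telescoping part and the multiple u of
      \<open>h\<close>. Only the latter contributes to the sum, as \<open>h\<close> vanishes at 0
      and at infinity.\<close>
    define g where "g = (\<lambda>n. ((h (Suc n) - h n) + u * h n) / (p + 1))"
    have "g sums (((0 - h 0) + u * suminf h) / (p + 1))"
      unfolding g_def using hs
      by (intro sums_divide sums_add telescope_sums h0 sums_mult summable_sums)
    then have gs: "g sums (u * suminf h / (p + 1))" by (simp add: h_def)
    have le: "real (Suc n) powr p * exp (- u * real (Suc n)) \<le> g n" for n
    proof -
      have "(p + 1) * real (Suc n) powr p \<le> real (Suc n) powr (p + 1) - real n powr (p + 1)"
        using powr_diff_ge[of p "Suc n"] assms p by simp
      then have "(p + 1) * real (Suc n) powr p * exp (- u * real (Suc n)) \<le>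
          (real (Suc n) powr (p + 1) - real n powr (p + 1)) * exp (- u * real (Suc n))"
        by (intro mult_right_mono) auto
      also have "\<dots> = h (Suc n) - h n * exp (- u)"
      proof -
        have "exp (- u * real (Suc n)) = exp (- u * real n) * exp (- u)"
          by (simp add: exp_add[symmetric] algebra_simps)
        then show ?thesis by (simp add: h_def algebra_simps)
      qed
      also have "\<dots> \<le> h (Suc n) - h n * (1 - u)"
        using exp_ge_add_one_self[of "- u"] by (intro diff_left_mono mult_left_mono) (auto simp: h_def)
      also have "\<dots> = (h (Suc n) - h n) + u * h n" by (simp add: algebra_simps)
      finally show ?thesis using assms
        by (simp add: g_def pos_le_divide_eq del: of_nat_Suc) (simp only: mult_ac)
    qed
    have s: "summable (\<lambda>n. real (Suc n) powr p * exp (- u * real (Suc n)))"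
    proof (rule summable_comparison_test'[OF sums_summable[OF gs], of 0])
      show "norm (real (Suc n) powr p * exp (- u * real (Suc n))) \<le> g n" for n
        using le[of n] by (subst real_norm_def, subst abs_of_nonneg) (intro mult_nonneg_nonneg, auto)
    qed
    then have s': "summable (\<lambda>n. real n powr p * exp (- u * real n))"
      using summable_Suc_iff[of "\<lambda>n. real n powr p * exp (- u * real n)"] by simp
    have "(\<Sum>n. real n powr p * exp (- u * real n)) =
        (\<Sum>n. real (Suc n) powr p * exp (- u * real (Suc n)))"
      using suminf_split_head[OF s'] by simp
    also have "\<dots> \<le> suminf g" by (rule suminf_le[OF le s sums_summable[OF gs]])
    also have "\<dots> = u * suminf h / (p + 1)" using gs by (simp add: sums_iff)
    also have "\<dots> \<le> u * (C * u powr (- (p + 1) - 1)) / (p + 1)"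
      using C(3)[OF u] u assms by (intro divide_right_mono mult_left_mono) (auto simp: h_def)
    also have "\<dots> = (C / (p + 1)) * u powr (- p - 1)"
    proof -
      have "u powr (- (p + 1) - 1) = u powr (- p - 1) / u"
        using u powr_diff[of u "- p - 1" 1] by (simp add: algebra_simps)
      then show ?thesis using u by simp
    qed
    finally show ?thesis using s' by blast
  qed
  then show ?thesis using C(1) assms by (intro exI[of _ "C / (p + 1)"]) auto
qed (rule powr_exp_sum_nonneg)

text \<open>The block from about 1 / u to 2 / u already has the right order: it contains more than 1
  / u indices n, each with n >= 1 / (2 u) and u n <= 2.\<close>

lemma powr_exp_sum_ge:
  assumes "p \<ge> 0" "0 < u" "u \<le> 1" and s: "summable (\<lambda>n. real n powr p * exp (- u * real n))"
  shows "exp (- 2) / 2 powr p * u powr (- p - 1) \<le> (\<Sum>n. real n powr p * exp (- u * real n))"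
proof -
  define N where "N = nat \<lfloor>1 / u\<rfloor>"
  have iu: "1 / u \<ge> 1" using assms by simp
  then have N1: "real N \<le> 1 / u" "1 / u < real N + 1"
    unfolding N_def using floor_correct[of "1/u"] assms by (simp_all add: of_nat_nat)
  have N2: "real N \<ge> 1 / (2 * u)"
  proof -
    have "N \<ge> 1" unfolding N_def using iu by linarith
    then have "2 * real N \<ge> real N + 1" by simp
    with N1(2) have "1 / u \<le> 2 * real N" by linarith
    then show ?thesis by simp
  qed
  have "exp (- 2) / 2 powr p * u powr (- p - 1) = (1 / u) * ((1 / (2 * u)) powr p * exp (- 2))"
    using assms by (simp add: powr_diff powr_minus powr_divide powr_mult field_simps)
  also have "\<dots> \<le> (real N + 1) * ((1 / (2 * u)) powr p * exp (- 2))"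
    using N1 by (intro mult_right_mono) auto
  also have "\<dots> = (\<Sum>n\<in>{N..2*N}. (1 / (2 * u)) powr p * exp (- 2))" by simp
  also have "\<dots> \<le> (\<Sum>n\<in>{N..2*N}. real n powr p * exp (- u * real n))"
  proof (intro sum_mono mult_mono)
    fix n assume n: "n \<in> {N..2*N}"
    have "1 / (2 * u) \<le> real n" using N2 n by simp
    then show "(1 / (2 * u)) powr p \<le> real n powr p" using assms by (intro powr_mono2) auto
    have "u * real n \<le> u * (2 * real N)" using n assms by (intro mult_left_mono) auto
    also have "\<dots> \<le> 2" using N1(1) assms by (simp add: field_simps)
    finally show "exp (- 2) \<le> exp (- u * real n)" by simp
  qed auto
  also have "\<dots> \<le> (\<Sum>n. real n powr p * exp (- u * real n))"
    by (intro sum_le_suminf s) auto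
  finally show ?thesis .
qed

lemma inverse_exp_sums:
  assumes "(u::real) > 0"
  shows "(\<lambda>n. exp (- u * real n) / real n) sums (- ln (1 - exp (- u)))"
proof -
  have "(\<lambda>n. - ((- (- exp (- u))) ^ n) / real n) sums ln (1 + - exp (- u))"
    using assms by (intro Multiseries_Expansion.ln_series') auto
  then have "(\<lambda>n. - (- ((- (- exp (- u))) ^ n) / real n)) sums (- ln (1 - exp (- u)))"
    by (intro sums_minus) simp
  then show ?thesis by (simp add: exp_of_nat_mult[symmetric] mult.commute)
qed

section \<open>Exponential moments of a sequence of polynomial growth\<close>


text \<open>At n = 0 both bounds vanish because \<open>0 powr d\<close> is 0, so the condition
  includes \<sigma> 0 = 0. Explicit constants make the later estimates uniform over the whole class
  of sequences.\<close>

definition pgrowth :: "real \<Rightarrow> real \<Rightarrow> real \<Rightarrow> (nat \<Rightarrow> real) \<Rightarrow> bool" where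
  "pgrowth c C d \<sigma> \<longleftrightarrow> (\<forall>n. c * real n powr d \<le> \<sigma> n \<and> \<sigma> n \<le> C * real n powr d)"

text \<open>Up to sign the i-th derivative of \<open>mom \<sigma> 0\<close>, which is itself minus
  the derivative of \<open>logZ \<sigma>\<close>. Thus \<open>logZ \<sigma> s + s * x\<close> is
  stationary where \<open>mom \<sigma> 0 s = x\<close>: this is the saddle point for x.\<close>

definition mom :: "(nat \<Rightarrow> real) \<Rightarrow> nat \<Rightarrow> real \<Rightarrow> real" where
  "mom \<sigma> i s = (\<Sum>n. real n ^ i * \<sigma> n * exp (- s * real n))"

text \<open>The logarithm, at z = exp (- s), of the generating function of the sequence w with w (0)
  = 1 and x w (x) = sum_k \<sigma> (k) w (x - k).\<close>

definition logZ :: "(nat \<Rightarrow> real) \<Rightarrow> real \<Rightarrow> real" where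
  "logZ \<sigma> s = (\<Sum>n. \<sigma> n / real n * exp (- s * real n))"

lemma pgrowth_nonneg: "pgrowth c C d \<sigma> \<Longrightarrow> c \<ge> 0 \<Longrightarrow> \<sigma> n \<ge> 0"
  unfolding pgrowth_def by (meson mult_nonneg_nonneg order_trans powr_ge_zero)

lemma pgrowth_0: "pgrowth c C d \<sigma> \<Longrightarrow> \<sigma> 0 = 0"
  unfolding pgrowth_def by (metis mult_zero_right of_nat_0 order_antisym powr_0)

lemma power_mult_powr: "real n ^ i * real n powr d = real n powr (d + real i)"
  by (cases "n = 0") (auto simp: powr_add powr_realpow mult.commute)

lemma mom_term_le:
  assumes "pgrowth c C d \<sigma>"
  shows "real n ^ i * \<sigma> n * exp (- s * real n) \<le> C * (real n powr (d + real i) * exp (- s * real n))"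
proof -
  have "real n ^ i * \<sigma> n * exp (- s * real n) \<le> real n ^ i * (C * real n powr d) * exp (- s * real n)"
    using assms by (intro mult_right_mono mult_left_mono) (auto simp: pgrowth_def)
  also have "\<dots> = C * (real n powr (d + real i) * exp (- s * real n))"
    by (simp add: power_mult_powr[symmetric])
  finally show ?thesis .
qed

lemma mom_term_ge:
  assumes "pgrowth c C d \<sigma>"
  shows "c * (real n powr (d + real i) * exp (- s * real n)) \<le> real n ^ i * \<sigma> n * exp (- s * real n)"
proof -
  have "c * (real n powr (d + real i) * exp (- s * real n)) = real n ^ i * (c * real n powr d) * exp (- s * real n)"
    by (simp add: power_mult_powr[symmetric])
  also have "\<dots> \<le> real n ^ i * \<sigma> n * exp (- s * real n)"
    using assms by (intro mult_right_mono mult_left_mono) (auto simp: pgrowth_def)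
  finally show ?thesis .
qed

lemma mom_summable:
  assumes "pgrowth c C d \<sigma>" "c \<ge> 0" "d \<ge> 0" "s > 0"
  shows "summable (\<lambda>n. real n ^ i * \<sigma> n * exp (- s * real n))"
proof (rule summable_comparison_test'[of _ 0])
  show "summable (\<lambda>n. C * (real n powr (d + real i) * exp (- s * real n)))"
    using powr_exp_sum[of "d + real i"] assms by (intro summable_mult) auto
  show "norm (real n ^ i * \<sigma> n * exp (- s * real n)) \<le> C * (real n powr (d + real i) * exp (- s * real n))" for n
    using mom_term_le[OF assms(1)] pgrowth_nonneg[OF assms(1,2)] by simp
qed

lemma mom_sums:
  assumes "pgrowth c C d \<sigma>" "c \<ge> 0" "d \<ge> 0" "s > 0"
  shows "(\<lambda>n. real n ^ i * \<sigma> n * exp (- s * real n)) sums mom \<sigma> i s"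
  unfolding mom_def using mom_summable[OF assms] by (rule summable_sums)

text \<open>The order of the quantifiers matters: the constants are chosen before \<sigma>, so they
  will serve all tilts \<tau> at once.\<close>

lemma mom_bounds:
  assumes "d \<ge> 0" "c > 0" "C > 0"
  shows "\<exists>l>0. \<exists>U>0. \<forall>\<sigma>. pgrowth c C d \<sigma> \<longrightarrow>
    (\<forall>s>0. mom \<sigma> i s \<le> U * s powr (- (d + real i) - 1) \<and>
       (s \<le> 1 \<longrightarrow> l * s powr (- (d + real i) - 1) \<le> mom \<sigma> i s))"
proof -
  obtain K where K: "K > 0" "\<And>u. u > 0 \<Longrightarrow> summable (\<lambda>n. real n powr (d + real i) * exp (- u * real n))"
    "\<And>u. u > 0 \<Longrightarrow> (\<Sum>n. real n powr (d + real i) * exp (- u * real n)) \<le> K * u powr (- (d + real i) - 1)"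
    using powr_exp_sum[of "d + real i"] assms by auto
  define l where "l = c * (exp (- 2) / 2 powr (d + real i))"
  have up: "mom \<sigma> i s \<le> C * K * s powr (- (d + real i) - 1)" if \<sigma>: "pgrowth c C d \<sigma>" and s: "s > 0" for \<sigma> s
  proof -
    have "mom \<sigma> i s \<le> (\<Sum>n. C * (real n powr (d + real i) * exp (- s * real n)))"
      unfolding mom_def using assms
      by (intro suminf_le mom_term_le[OF \<sigma>] mom_summable[OF \<sigma>] summable_mult K s) auto
    also have "\<dots> = C * (\<Sum>n. real n powr (d + real i) * exp (- s * real n))"
      by (intro suminf_mult K s)
    also have "\<dots> \<le> C * (K * s powr (- (d + real i) - 1))"
      using assms by (intro mult_left_mono K s) auto
    finally show ?thesis by simp
  qed
  have lo: "l * s powr (- (d + real i) - 1) \<le> mom \<sigma> i s"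
    if \<sigma>: "pgrowth c C d \<sigma>" and s: "s > 0" "s \<le> 1" for \<sigma> s
  proof -
    have "l * s powr (- (d + real i) - 1) = c * (exp (- 2) / 2 powr (d + real i) * s powr (- (d + real i) - 1))"
      by (simp add: l_def)
    also have "\<dots> \<le> c * (\<Sum>n. real n powr (d + real i) * exp (- s * real n))"
      using assms s by (intro mult_left_mono powr_exp_sum_ge K) auto
    also have "\<dots> = (\<Sum>n. c * (real n powr (d + real i) * exp (- s * real n)))"
      by (intro suminf_mult[symmetric] K s)
    also have "\<dots> \<le> mom \<sigma> i s"
      unfolding mom_def using assms s
      by (intro suminf_le mom_term_ge[OF \<sigma>] mom_summable[OF \<sigma>] summable_mult K) auto
    finally show ?thesis .
  qed
  show ?thesis using up lo K(1) assms
    by (intro exI[of _ l] conjI exI[of _ "C * K"] allI impI) (auto simp: l_def)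
qed

text \<open>The convex function \<open>mom \<sigma> 0\<close> lies above its tangent at u. Later
  this bounds the displacement u - s of a saddle point by the change of the energy.\<close>

lemma mom0_diff:
  assumes \<sigma>: "pgrowth c C d \<sigma>" "c \<ge> 0" "d \<ge> 0" and s: "0 < s" "s \<le> u"
  shows "mom \<sigma> 0 u + (u - s) * mom \<sigma> 1 u \<le> mom \<sigma> 0 s"
proof (rule sums_le)
  have u: "u > 0" using s by simp
  show "(\<lambda>n. real n ^ 0 * \<sigma> n * exp (- u * real n) + (u - s) * (real n ^ 1 * \<sigma> n * exp (- u * real n)))
      sums (mom \<sigma> 0 u + (u - s) * mom \<sigma> 1 u)"
    by (intro sums_add sums_mult mom_sums[OF \<sigma>] u)
  show "(\<lambda>n. real n ^ 0 * \<sigma> n * exp (- s * real n)) sums mom \<sigma> 0 s"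
    by (intro mom_sums[OF \<sigma>] s)
  fix n
  have "1 + (u - s) * real n \<le> exp ((u - s) * real n)" by (rule exp_ge_add_one_self)
  then have "\<sigma> n * exp (- u * real n) * (1 + (u - s) * real n) \<le>
      \<sigma> n * exp (- u * real n) * exp ((u - s) * real n)"
    using pgrowth_nonneg[OF \<sigma>(1,2)] by (intro mult_left_mono) auto
  also have "\<dots> = \<sigma> n * exp (- s * real n)"
    by (simp add: mult.assoc exp_add[symmetric]) (simp add: algebra_simps)
  finally show "real n ^ 0 * \<sigma> n * exp (- u * real n) + (u - s) * (real n ^ 1 * \<sigma> n * exp (- u * real n))
      \<le> real n ^ 0 * \<sigma> n * exp (- s * real n)"
    by (simp add: algebra_simps)
qed

lemma logZ_term_le:
  assumes "pgrowth c C d \<sigma>" "c \<ge> 0"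
  shows "\<sigma> n / real n * exp (- s * real n) \<le> \<sigma> n * exp (- s * real n)"
proof (cases "n = 0")
  case False
  then have "\<sigma> n * 1 \<le> \<sigma> n * real n"
    using pgrowth_nonneg[OF assms, of n] by (intro mult_left_mono) auto
  then have "\<sigma> n / real n \<le> \<sigma> n"
    using False pos_divide_le_eq[of "real n" "\<sigma> n" "\<sigma> n"] by linarith
  then show ?thesis by (rule mult_right_mono) simp
qed (use pgrowth_nonneg[OF assms, of n] in simp)

lemma logZ_sums:
  assumes "pgrowth c C d \<sigma>" "c \<ge> 0" "d \<ge> 0" "s > 0"
  shows "(\<lambda>n. \<sigma> n / real n * exp (- s * real n)) sums logZ \<sigma> s"
  unfolding logZ_def
proof (rule summable_sums, rule summable_comparison_test'[of _ 0])
  show "summable (\<lambda>n. real n ^ 0 * \<sigma> n * exp (- s * real n))" by (rule mom_summable[OF assms])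
  show "norm (\<sigma> n / real n * exp (- s * real n)) \<le> real n ^ 0 * \<sigma> n * exp (- s * real n)" for n
    using logZ_term_le[OF assms(1,2), of n s] pgrowth_nonneg[OF assms(1,2), of n] by simp
qed

lemma logZ_le_mom0:
  assumes "pgrowth c C d \<sigma>" "c \<ge> 0" "d \<ge> 0" "s > 0"
  shows "logZ \<sigma> s \<le> mom \<sigma> 0 s"
  by (rule sums_le[OF _ logZ_sums[OF assms] mom_sums[OF assms]])
    (use logZ_term_le[OF assms(1,2)] in simp)

text \<open>The convex function \<open>logZ \<sigma>\<close> lies above its tangent at s. With x =
  \<open>mom \<sigma> 0 s\<close>, the exponent \<open>logZ \<sigma> u + u * x\<close> of the saddle
  point bound is therefore least at u = s.\<close>

lemma logZ_minimum:
  assumes \<sigma>: "pgrowth c C d \<sigma>" "c \<ge> 0" "d \<ge> 0" and s: "s > 0" "u > 0"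
  shows "logZ \<sigma> s + s * mom \<sigma> 0 s \<le> logZ \<sigma> u + u * mom \<sigma> 0 s"
proof -
  have "logZ \<sigma> s - (u - s) * mom \<sigma> 0 s \<le> logZ \<sigma> u"
  proof (rule sums_le)
    show "(\<lambda>n. \<sigma> n / real n * exp (- s * real n) - (u - s) * (real n ^ 0 * \<sigma> n * exp (- s * real n)))
       sums (logZ \<sigma> s - (u - s) * mom \<sigma> 0 s)"
      by (intro sums_diff sums_mult logZ_sums[OF \<sigma>] mom_sums[OF \<sigma>] s)
    show "(\<lambda>n. \<sigma> n / real n * exp (- u * real n)) sums logZ \<sigma> u" by (intro logZ_sums[OF \<sigma>] s)
    fix n
    show "\<sigma> n / real n * exp (- s * real n) - (u - s) * (real n ^ 0 * \<sigma> n * exp (- s * real n))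
       \<le> \<sigma> n / real n * exp (- u * real n)"
    proof (cases "n = 0")
      case False
      have "1 + (- ((u - s) * real n)) \<le> exp (- ((u - s) * real n))" by (rule exp_ge_add_one_self)
      then have "\<sigma> n / real n * exp (- s * real n) * (1 + (- ((u - s) * real n))) \<le>
         \<sigma> n / real n * exp (- s * real n) * exp (- ((u - s) * real n))"
        using pgrowth_nonneg[OF \<sigma>(1,2)] by (intro mult_left_mono) auto
      also have "\<dots> = \<sigma> n / real n * exp (- u * real n)"
        by (simp only: mult.assoc exp_add[symmetric]) (simp add: algebra_simps)
      finally have "\<sigma> n / real n * exp (- s * real n) * (1 + (- ((u - s) * real n)))
        \<le> \<sigma> n / real n * exp (- u * real n)" .
      moreover have "\<sigma> n / real n * exp (- s * real n) * (1 + (- ((u - s) * real n)))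
        = \<sigma> n / real n * exp (- s * real n) - (u - s) * (real n ^ 0 * \<sigma> n * exp (- s * real n))"
        using False by (simp add: field_simps)
      ultimately show ?thesis by simp
    qed (simp add: pgrowth_0[OF \<sigma>(1)])
  qed
  then show ?thesis by (simp add: algebra_simps)
qed

lemma mom0_continuous:
  assumes \<sigma>: "pgrowth c C d \<sigma>" "c \<ge> 0" "d \<ge> 0" and s: "s > 0"
  shows "isCont (mom \<sigma> 0) s"
proof -
  have eq: "mom \<sigma> 0 = (\<lambda>s. \<Sum>n. \<sigma> n * exp (- s) ^ n)"
    by (rule ext) (simp add: mom_def exp_of_nat_mult[symmetric] mult.commute)
  have "summable (\<lambda>n. \<sigma> n * exp (- (s / 2)) ^ n)"
    using mom_summable[OF \<sigma>, of "s/2" 0] s by (simp add: exp_of_nat_mult[symmetric] mult.commute)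
  then have "isCont (\<lambda>z. \<Sum>n. \<sigma> n * z ^ n) (exp (- s))"
    by (rule isCont_powser) (use s in auto)
  then show ?thesis unfolding eq by (rule isCont_o2[rotated]) (intro continuous_intros)
qed

lemma mom0_root:
  assumes \<sigma>: "pgrowth c C d \<sigma>" and cd: "c > 0" "C > 0" "d \<ge> 0" and x: "x > 0"
  shows "\<exists>!s. s > 0 \<and> mom \<sigma> 0 s = x"
proof (rule ex_ex1I)
  have c0: "c \<ge> 0" using cd by simp
  obtain l U where lU: "l > 0" "U > 0" "\<And>s. s > 0 \<Longrightarrow> mom \<sigma> 0 s \<le> U * s powr (- d - 1)"
    "\<And>s. s > 0 \<Longrightarrow> s \<le> 1 \<Longrightarrow> l * s powr (- d - 1) \<le> mom \<sigma> 0 s"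
    using mom_bounds[OF cd(3,1,2), of 0] \<sigma> by auto
  define r where "r = (\<lambda>y::real. y powr (- 1 / (d + 1)))"
  have r: "r y > 0" "r y powr (- d - 1) = y" if "y > 0" for y
  proof -
    have "(- 1 / (d + 1)) * (- d - 1) = 1" using cd by (simp add: field_simps)
    then show "r y > 0" "r y powr (- d - 1) = y" using that by (auto simp: r_def powr_powr)
  qed
  \<comment> \<open>The lower bound for the moment holds only up to s = 1, hence the cap of
    \<open>s1\<close>; with \<open>s2\<close> at least 1, the two points are in the right
    order.\<close>
  define s1 where "s1 = min 1 (r (x / l))"
  have "r (x / l) powr (- d - 1) \<le> s1 powr (- d - 1)"
    using r(1)[of "x / l"] x lU cd by (intro powr_mono2') (auto simp: s1_def)
  then have s1: "l * s1 powr (- d - 1) \<ge> x" "0 < s1" "s1 \<le> 1"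
    using r[of "x / l"] x lU by (auto simp: s1_def field_simps)
  define s2 where "s2 = max 1 (r (x / U))"
  have "s2 powr (- d - 1) \<le> r (x / U) powr (- d - 1)"
    using r(1)[of "x / U"] x lU cd by (intro powr_mono2') (auto simp: s2_def)
  then have s2: "U * s2 powr (- d - 1) \<le> x" "s2 \<ge> 1"
    using r[of "x / U"] x lU by (auto simp: s2_def field_simps)
  have "\<exists>s. s1 \<le> s \<and> s \<le> s2 \<and> mom \<sigma> 0 s = x"
  proof (rule IVT2)
    show "mom \<sigma> 0 s2 \<le> x" using lU(3)[of s2] s2 by simp
    show "x \<le> mom \<sigma> 0 s1" using lU(4)[of s1] s1 by simp
    show "\<forall>s. s1 \<le> s \<and> s \<le> s2 \<longrightarrow> isCont (mom \<sigma> 0) s"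
      using s1 by (auto intro!: mom0_continuous[OF \<sigma> c0 cd(3)])
  qed (use s1 s2 in auto)
  then obtain s where "s1 \<le> s" "mom \<sigma> 0 s = x" by blast
  then show "\<exists>s. s > 0 \<and> mom \<sigma> 0 s = x" using s1(2) by (intro exI[of _ s]) auto
  have lt: False if su: "0 < s" "s < u" "mom \<sigma> 0 s = x" "mom \<sigma> 0 u = x" for s u
  proof -
    have "mom \<sigma> 1 u > 0" unfolding mom_def
    proof (rule suminf_pos2[of _ 1])
      show "summable (\<lambda>n. real n ^ 1 * \<sigma> n * exp (- u * real n))"
        by (rule mom_summable[OF \<sigma> c0 cd(3)]) (use su in auto)
      have "\<sigma> 1 \<ge> c * real 1 powr d" using \<sigma> unfolding pgrowth_def by blast
      then show "0 < real 1 ^ 1 * \<sigma> 1 * exp (- u * real 1)" using cd by simp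
    qed (use pgrowth_nonneg[OF \<sigma> c0] in auto)
    then have "(u - s) * mom \<sigma> 1 u > 0" using su by simp
    then show False using mom0_diff[OF \<sigma> c0 cd(3) su(1), of u] su by simp
  qed
  fix s u assume "s > 0 \<and> mom \<sigma> 0 s = x" "u > 0 \<and> mom \<sigma> 0 u = x"
  then show "s = u" using lt[of s u] lt[of u s] by (cases s u rule: linorder_cases) auto
qed

section \<open>A lower bound from the recursion for partition numbers\<close>


lemma inverse_powr_ge:
  assumes "\<kappa> \<ge> 0" "0 \<le> y" "y < (1::real)"
  shows "1 + \<kappa> * y \<le> (1 - y) powr (- \<kappa>)"
proof -
  have "ln (1 - y) \<le> - y" using ln_add_one_self_le_self2[of "- y"] assms by simp
  then have "\<kappa> * y \<le> - \<kappa> * ln (1 - y)" using mult_left_mono[of "ln (1 - y)" "- y" \<kappa>] assms by simp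
  then have "exp (\<kappa> * y) \<le> (1 - y) powr (- \<kappa>)" using assms by (simp add: powr_def)
  then show ?thesis using exp_ge_add_one_self[of "\<kappa> * y"] by linarith
qed

text \<open>It is applied with h = H k^2, where 1 - h is negative for large k and inequalities
  cannot be multiplied; the claim is trivial there.\<close>

lemma prod_lower_bound:
  assumes "\<theta> \<le> h" "0 \<le> a" "1 + a \<le> (b::real)"
  shows "(1 - h) * (1 + a) \<le> exp (- \<theta>) * b"
proof (cases "h \<le> 1")
  case True
  have "1 - h \<le> exp (- \<theta>)" using exp_ge_add_one_self[of "- \<theta>"] assms by linarith
  then show ?thesis using True assms by (intro mult_mono) auto
next
  case False
  then have "(1 - h) * (1 + a) \<le> 0" using assms by (intro mult_nonpos_nonneg) auto
  also have "0 \<le> exp (- \<theta>) * b" using assms by simp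
  finally show ?thesis .
qed

text \<open>The sum is cut off at x / 2, where 1 is at most 4 (k / x)^2 and k / x is at most 2 (k / x)^2;
  this is the origin of the terms with denominator x^2.\<close>

lemma moment_sum_ge:
  assumes \<sigma>: "pgrowth c C d \<sigma>" "c \<ge> 0" "d \<ge> 0" and s: "s > 0" and x: "x > 0"
    and "\<kappa> \<ge> 0" "H \<ge> 0"
  shows "mom \<sigma> 0 s + \<kappa> / real x * mom \<sigma> 1 s - (H + (4 / real x ^ 2 + 2 * \<kappa> / real x ^ 2)) * mom \<sigma> 2 s
      - H * \<kappa> / real x * mom \<sigma> 3 s
    \<le> (\<Sum>k\<in>{1..x div 2}. \<sigma> k * exp (- s * real k) * ((1 - H * real k ^ 2) * (1 + \<kappa> * (real k / real x))))"
proof (rule sums_le)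
  let ?e = "\<lambda>n. \<sigma> n * exp (- s * real n)"
  let ?g = "\<lambda>n. \<sigma> n * exp (- s * real n) * ((1 - H * real n ^ 2) * (1 + \<kappa> * (real n / real x)))"
  show "(\<lambda>n. real n ^ 0 * \<sigma> n * exp (- s * real n) + \<kappa> / real x * (real n ^ 1 * \<sigma> n * exp (- s * real n))
      - (H + (4 / real x ^ 2 + 2 * \<kappa> / real x ^ 2)) * (real n ^ 2 * \<sigma> n * exp (- s * real n))
      - H * \<kappa> / real x * (real n ^ 3 * \<sigma> n * exp (- s * real n))) sums
    (mom \<sigma> 0 s + \<kappa> / real x * mom \<sigma> 1 s - (H + (4 / real x ^ 2 + 2 * \<kappa> / real x ^ 2)) * mom \<sigma> 2 s
      - H * \<kappa> / real x * mom \<sigma> 3 s)"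
    by (intro sums_add sums_diff sums_mult mom_sums[OF \<sigma> s])
  show "(\<lambda>n. if n \<in> {1..x div 2} then ?g n else 0) sums (\<Sum>k\<in>{1..x div 2}. ?g k)"
    by (rule sums_If_finite_set) simp
  fix n
  have e: "?e n \<ge> 0" using pgrowth_nonneg[OF \<sigma>(1,2)] by simp
  have lhs: "real n ^ 0 * \<sigma> n * exp (- s * real n) + \<kappa> / real x * (real n ^ 1 * \<sigma> n * exp (- s * real n))
      - (H + (4 / real x ^ 2 + 2 * \<kappa> / real x ^ 2)) * (real n ^ 2 * \<sigma> n * exp (- s * real n))
      - H * \<kappa> / real x * (real n ^ 3 * \<sigma> n * exp (- s * real n))
    = ?e n * ((1 - H * real n ^ 2) * (1 + \<kappa> * (real n / real x)) - (4 + 2 * \<kappa>) * (real n / real x) ^ 2)"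
    using x by (simp add: field_simps power2_eq_square power3_eq_cube)
  show "real n ^ 0 * \<sigma> n * exp (- s * real n) + \<kappa> / real x * (real n ^ 1 * \<sigma> n * exp (- s * real n))
      - (H + (4 / real x ^ 2 + 2 * \<kappa> / real x ^ 2)) * (real n ^ 2 * \<sigma> n * exp (- s * real n))
      - H * \<kappa> / real x * (real n ^ 3 * \<sigma> n * exp (- s * real n)) \<le> (if n \<in> {1..x div 2} then ?g n else 0)"
  proof (cases "n \<in> {1..x div 2}")
    case True
    then show ?thesis unfolding lhs using e assms by (auto intro!: mult_left_mono)
  next
    case False
    show ?thesis
    proof (cases "n = 0")
      case True
      then show ?thesis unfolding lhs by (simp add: pgrowth_0[OF \<sigma>(1)])
    next
      case n0: False
      define y where "y = real n / real x"
      from False n0 have "n \<ge> x div 2 + 1" by auto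
      then have "2 * n \<ge> x" by linarith
      then have y: "2 * y \<ge> 1" using x by (simp add: y_def field_simps)
      have "(1 - H * real n ^ 2) * (1 + \<kappa> * y) \<le> 1 * (1 + \<kappa> * y)"
        using assms y by (intro mult_right_mono) auto
      also have "\<dots> \<le> (4 + 2 * \<kappa>) * y ^ 2"
      proof -
        have "1 * 1 \<le> (2 * y) * (2 * y)" using y by (intro mult_mono) auto
        moreover have "\<kappa> * y * 1 \<le> \<kappa> * y * (2 * y)" using y assms by (intro mult_left_mono) auto
        ultimately show ?thesis by (simp add: power2_eq_square algebra_simps)
      qed
      finally have "(1 - H * real n ^ 2) * (1 + \<kappa> * y) - (4 + 2 * \<kappa>) * y ^ 2 \<le> 0" by simp
      then show ?thesis unfolding lhs if_not_P[OF False] y_def[symmetric]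
        by (intro mult_nonneg_nonpos e)
    qed
  qed
qed

text \<open>In the induction step let s and u be the saddle points for x and x - k.  Replacing u by s in the
  bound for w (x - k) costs a factor exp (- H k^2), H being of order s^(d + 2), whereas the
  polynomial factor gains 1 + \<kappa> k / x.  After summation over k both effects are of relative order s^d
  and the gain wins for large \<kappa>.  The constants do not depend on \<open>\<sigma>\<close>.\<close>

lemma recursion_lower_bound:
  assumes "d > 0" "c > 0" "C > 0"
  shows "\<exists>A>0. \<exists>\<kappa>\<ge>0. \<forall>\<sigma> w. pgrowth c C d \<sigma> \<longrightarrow> w 0 = 1 \<longrightarrow> (\<forall>x. w x \<ge> 0) \<longrightarrow>
    (\<forall>x\<ge>1. real x * w x = (\<Sum>k=1..x. \<sigma> k * w (x - k))) \<longrightarrow>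
    (\<forall>x\<ge>1. \<exists>s>0. A * real x powr (- \<kappa>) * exp (logZ \<sigma> s + s * real x) \<le> w x)"
proof -
  define a where "a = d + 1"
  have d0: "d \<ge> 0" using assms by simp
  have ex: "- (d + real i) - 1 = - a - real i" for i by (simp add: a_def)
  note mb = mom_bounds[OF d0 assms(2,3)]
  obtain l0 U0 where b0: "l0 > 0" "U0 > 0"
    "\<And>\<sigma> s. pgrowth c C d \<sigma> \<Longrightarrow> s > 0 \<Longrightarrow> mom \<sigma> 0 s \<le> U0 * s powr (- a)"
    "\<And>\<sigma> s. pgrowth c C d \<sigma> \<Longrightarrow> s > 0 \<Longrightarrow> s \<le> 1 \<Longrightarrow> l0 * s powr (- a) \<le> mom \<sigma> 0 s"
    using mb[of 0] unfolding ex by auto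
  obtain l1 where b1: "l1 > 0"
    "\<And>\<sigma> s. pgrowth c C d \<sigma> \<Longrightarrow> s > 0 \<Longrightarrow> s \<le> 1 \<Longrightarrow> l1 * s powr (- a - 1) \<le> mom \<sigma> 1 s"
    using mb[of 1] unfolding ex by auto
  obtain U2 where b2: "U2 > 0"
    "\<And>\<sigma> s. pgrowth c C d \<sigma> \<Longrightarrow> s > 0 \<Longrightarrow> mom \<sigma> 2 s \<le> U2 * s powr (- a - 2)"
    using mb[of 2] unfolding ex by auto
  obtain U3 where b3: "U3 > 0"
    "\<And>\<sigma> s. pgrowth c C d \<sigma> \<Longrightarrow> s > 0 \<Longrightarrow> mom \<sigma> 3 s \<le> U3 * s powr (- a - 3)"
    using mb[of 3] unfolding ex by auto
  \<comment> \<open>\<open>R\<close> bounds the ratio u / s of the saddle points for x - k and x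
    when k <= x / 2. \<open>H0\<close> turns the resulting lower bound for
    \<open>mom \<sigma> 1 u\<close> into u - s <= H0 s^(a + 1) k.\<close>
  define R where "R = (2 * U0 / l0) powr (1 / a)"
  define H0 where "H0 = R powr (a + 1) / l1"
  have R0: "R > 0" using b0 by (simp add: R_def)
  have H0: "H0 > 0" using R0 b1 by (simp add: H0_def)
  \<comment> \<open>The gain \<kappa> l1 s^(- a - 1) has to cover the second-moment loss H0 U0 U2
    s^(- a - 1) and leave at least s^(- a - 1) for the errors collected in \<open>B\<close>.\<close>
  define \<kappa> where "\<kappa> = (2 * H0 * U0 * U2 + 2) / l1"
  have \<kappa>0: "\<kappa> \<ge> 0" using H0 b0 b1 b2 by (simp add: \<kappa>_def)
  \<comment> \<open>The cutoff errors and the third-moment term are at most B / s^2, that is, B s^d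
    times s^(- a - 1). They are small in comparison once s is below \<epsilon>.\<close>
  define B where "B = (4 + 2 * \<kappa>) * U2 / l0 + \<kappa> * H0 * U3"
  have B0: "B > 0" using \<kappa>0 H0 b0 b2 b3 by (simp add: B_def add_pos_nonneg)
  define \<epsilon> where "\<epsilon> = min 1 ((1 / B) powr (1 / d))"
  have \<epsilon>0: "\<epsilon> > 0" "\<epsilon> \<le> 1" using B0 by (auto simp: \<epsilon>_def)
  \<comment> \<open>For x >= \<open>x0\<close> the first summand forces s <= \<epsilon> and the
    second one u <= 1, so the lower moment bounds apply at both saddle points.\<close>
  define x0 where "x0 = U0 * \<epsilon> powr (- a) + 2 * U0 + 2"
  have x00: "x0 > 0" using b0 by (simp add: x0_def add_nonneg_pos)
  define A where "A = c / x0 * exp (- (U0 + x0))"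
  have A0: "A > 0" using assms x00 by (simp add: A_def)
  have main: "A * real x powr (- \<kappa>) * exp (logZ \<sigma> s + s * real x) \<le> w x"
    if \<sigma>: "pgrowth c C d \<sigma>" and w0: "w 0 = 1" "\<And>x. w x \<ge> 0"
      and rec: "\<And>x. x \<ge> 1 \<Longrightarrow> real x * w x = (\<Sum>k=1..x. \<sigma> k * w (x - k))"
      and x1: "x \<ge> 1" and s: "s > 0" "mom \<sigma> 0 s = real x" for \<sigma> w x s
    using x1 s
  proof (induction x arbitrary: s rule: less_induct)
    case (less x)
    note s = less.prems(2) and sx = less.prems(3)
    have c0: "c \<ge> 0" using assms by simp
    have \<sigma>n: "\<sigma> k \<ge> 0" for k by (rule pgrowth_nonneg[OF \<sigma> c0])
    have x: "real x \<ge> 1" using less.prems by simp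
    show ?case
    proof (cases "real x < x0")
      case True
      \<comment> \<open>Below \<open>x0\<close> the term k = x of the recursion alone gives w (x) >=
        c / x0. Minimality of the saddle point exponent permits replacing s by 1 in the quantity to
        be bounded.\<close>
      have "\<sigma> x * w (x - x) \<le> (\<Sum>k=1..x. \<sigma> k * w (x - k))"
        using less.prems w0 \<sigma>n by (intro member_le_sum) auto
      then have "\<sigma> x \<le> real x * w x" using rec[of x] less.prems w0 by simp
      moreover have "c * real x powr d \<le> \<sigma> x" using \<sigma> unfolding pgrowth_def by blast
      moreover have "c * 1 \<le> c * real x powr d"
        using x assms by (intro mult_left_mono ge_one_powr_ge_zero) auto
      ultimately have "c \<le> real x * w x" by linarith
      also have "\<dots> \<le> x0 * w x" using True w0 by (intro mult_right_mono) auto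
      finally have wx: "c / x0 \<le> w x" using x00 by (simp add: field_simps)
      have "logZ \<sigma> s + s * real x \<le> logZ \<sigma> 1 + 1 * real x"
        using logZ_minimum[OF \<sigma> c0 d0 s, of 1] sx by simp
      also have "logZ \<sigma> 1 \<le> mom \<sigma> 0 1" by (rule logZ_le_mom0[OF \<sigma> c0 d0]) simp
      also have "mom \<sigma> 0 1 \<le> U0" using b0(3)[OF \<sigma>, of 1] by simp
      finally have "logZ \<sigma> s + s * real x \<le> U0 + x0" using True by simp
      then have "exp (logZ \<sigma> s + s * real x) \<le> exp (U0 + x0)" by simp
      moreover have "real x powr (- \<kappa>) \<le> 1" using x \<kappa>0 powr_mono[of "- \<kappa>" 0 "real x"] by simp
      ultimately have "A * real x powr (- \<kappa>) * exp (logZ \<sigma> s + s * real x) \<le> A * 1 * exp (U0 + x0)"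
        using A0 by (intro mult_mono) auto
      also have "\<dots> = c / x0" by (simp add: A_def mult.assoc exp_add[symmetric])
      finally show ?thesis using wx by simp
    next
      case False
      then have xx0: "real x \<ge> x0" by simp
      have xU: "real x \<le> U0 * s powr (- a)" using b0(3)[OF \<sigma> s] sx by simp
      have a0: "a > 0" using assms by (simp add: a_def)
      have s\<epsilon>: "s \<le> \<epsilon>"
      proof (rule ccontr)
        assume "\<not> s \<le> \<epsilon>"
        then have "s powr (- a) \<le> \<epsilon> powr (- a)" using \<epsilon>0 a0 by (intro powr_mono2') auto
        then have "U0 * s powr (- a) \<le> U0 * \<epsilon> powr (- a)" using b0 by (intro mult_left_mono) auto
        then show False using xU xx0 b0(2) unfolding x0_def by linarith
      qed
      then have s1: "s \<le> 1" using \<epsilon>0 by simp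
      define P where "P = s powr (- a - 1)"
      have P0: "P > 0" using s by (simp add: P_def)
      have Pa: "s powr (- a) = P * s"
        using s by (simp add: P_def powr_diff)
      have P2: "s powr (- a - 2) = P / s"
        using s by (simp add: P_def powr_diff power2_eq_square)
      have P3: "s powr (- a - 3) = P / s ^ 2"
        using s by (simp add: P_def powr_diff power2_eq_square power3_eq_cube)
      have Pd: "1 / s ^ 2 = P * s powr d"
      proof -
        have "P * s powr d = s powr (- 2)"
          unfolding P_def by (simp add: powr_add[symmetric] a_def)
        then show ?thesis using s by (simp add: powr_minus field_simps)
      qed
      define H where "H = H0 / P"
      have H: "H \<ge> 0" using H0 P0 by (simp add: H_def)
      have xl: "l0 * (P * s) \<le> real x" using b0(4)[OF \<sigma> s s1] sx Pa by simp
      have xu: "real x \<le> U0 * (P * s)" using xU Pa by simp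
      define E where "E = A * real x powr (- \<kappa>) * exp (logZ \<sigma> s + s * real x)"
      have E0: "E \<ge> 0" using A0 by (simp add: E_def)
      have step: "E * (exp (- s * real k) * ((1 - H * real k ^ 2) * (1 + \<kappa> * (real k / real x)))) \<le> w (x - k)"
        if k: "k \<in> {1..x div 2}" for k
      proof -
        have k1: "k \<ge> 1" "2 * k \<le> x" "k < x" using k less.prems by auto
        then have xk: "real (x - k) = real x - real k" "real x - real k \<ge> real x / 2" by auto
        obtain u where u: "u > 0" "mom \<sigma> 0 u = real x - real k"
          using mom0_root[OF \<sigma> assms(2,3) d0, of "real x - real k"] xk x by auto
        have su: "s \<le> u"
        proof (rule ccontr)
          assume "\<not> s \<le> u"
          then have us: "u \<le> s" by simp
          have "mom \<sigma> 1 s \<ge> 0" unfolding mom_def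
            by (rule suminf_nonneg[OF mom_summable[OF \<sigma> c0 d0 s]]) (use \<sigma>n in auto)
          then have "0 \<le> (s - u) * mom \<sigma> 1 s" using us by simp
          then show False using mom0_diff[OF \<sigma> c0 d0 u(1) us] u sx k1 by simp
        qed
        have uU: "real x / 2 \<le> U0 * u powr (- a)" using b0(3)[OF \<sigma> u(1)] u xk by simp
        then have ua: "u powr a \<le> 2 * U0 / real x"
          using u x by (simp add: powr_minus field_simps)
        also have "2 * U0 / real x \<le> 1"
        proof -
          have "0 \<le> U0 * \<epsilon> powr (- a)" using b0(2) by simp
          then have "2 * U0 \<le> real x" using xx0 unfolding x0_def by linarith
          then show ?thesis using x by simp
        qed
        finally have ua1: "u powr a \<le> 1" .
        have u1: "u \<le> 1"
        proof (rule ccontr)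
          assume "\<not> u \<le> 1"
          then have "1 powr a < u powr a" using a0 by (intro powr_less_mono2) auto
          then show False using ua1 by simp
        qed
        have "u powr a \<le> 2 * U0 / (l0 * (P * s))"
          using ua by (rule order_trans) (use xl b0 P0 s x in \<open>intro divide_left_mono; simp\<close>)
        also have "\<dots> = 2 * U0 / l0 * s powr a"
          unfolding Pa[symmetric] by (simp add: powr_minus divide_inverse)
        finally have "(u powr a) powr (1 / a) \<le> (2 * U0 / l0 * s powr a) powr (1 / a)"
          using a0 by (intro powr_mono2) auto
        moreover have "(2 * U0 / l0 * s powr a) powr (1 / a) = R * s"
          unfolding R_def using b0 s a0 by (subst powr_mult) (auto simp: powr_powr)
        ultimately have "u \<le> R * s" using a0 u by (simp add: powr_powr)
        then have "(R * s) powr (- a - 1) \<le> u powr (- a - 1)"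
          using u a0 by (intro powr_mono2') auto
        then have "l1 * (R * s) powr (- a - 1) \<le> mom \<sigma> 1 u"
          using b1(2)[OF \<sigma> u(1) u1] b1(1) by (smt (verit) mult_left_mono)
        moreover have "l1 * (R * s) powr (- a - 1) = P / H0"
        proof -
          have "R powr (- a - 1) = 1 / R powr (a + 1)"
            using R0 by (simp add: powr_diff powr_add powr_minus field_simps)
          then show ?thesis using R0 s b1 by (simp add: powr_mult P_def H0_def)
        qed
        ultimately have m1: "P / H0 \<le> mom \<sigma> 1 u" by simp
        have "(u - s) * (P / H0) \<le> (u - s) * mom \<sigma> 1 u" using m1 su by (intro mult_left_mono) auto
        also have "\<dots> \<le> real k" using mom0_diff[OF \<sigma> c0 d0 s su] u sx by simp
        finally have "u - s \<le> H * real k" using P0 H0 by (simp add: H_def field_simps)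
        then have th: "(u - s) * real k \<le> H * real k ^ 2"
          using mult_right_mono[of "u - s" "H * real k" "real k"] by (simp add: power2_eq_square)
        have "(1 - real k / real x) powr (- \<kappa>) \<ge> 1 + \<kappa> * (real k / real x)"
          using k1 x \<kappa>0 by (intro inverse_powr_ge) auto
        then have "(1 - H * real k ^ 2) * (1 + \<kappa> * (real k / real x))
            \<le> exp (- ((u - s) * real k)) * (1 - real k / real x) powr (- \<kappa>)"
          using \<kappa>0 x by (intro prod_lower_bound th) auto
        then have "E * (exp (- s * real k) * ((1 - H * real k ^ 2) * (1 + \<kappa> * (real k / real x)))) \<le>
            E * (exp (- s * real k) * (exp (- ((u - s) * real k)) * (1 - real k / real x) powr (- \<kappa>)))"
          using E0 by (intro mult_left_mono) auto
        also have "\<dots> = A * (real x * (1 - real k / real x)) powr (- \<kappa>) *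
            exp (logZ \<sigma> s + s * real x + (- s * real k) + (- ((u - s) * real k)))"
        proof -
          have pm: "(real x * (1 - real k / real x)) powr (- \<kappa>) = real x powr (- \<kappa>) * (1 - real k / real x) powr (- \<kappa>)"
            by (rule powr_mult)
          have "exp (logZ \<sigma> s + s * real x + (- s * real k) + (- ((u - s) * real k)))
            = exp (logZ \<sigma> s + s * real x) * exp (- s * real k) * exp (- ((u - s) * real k))"
            by (simp only: exp_add)
          then show ?thesis unfolding E_def pm by (simp only: mult_ac)
        qed
        also have "\<dots> = A * (real (x - k)) powr (- \<kappa>) * exp (logZ \<sigma> s + s * real x - u * real k)"
        proof -
          have "real x * (1 - real k / real x) = real (x - k)" using x xk by (simp add: field_simps)
          moreover have "logZ \<sigma> s + s * real x + (- s * real k) + (- ((u - s) * real k)) = logZ \<sigma> s + s * real x - u * real k"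
            by (simp add: algebra_simps)
          ultimately show ?thesis by simp
        qed
        also have "\<dots> \<le> A * (real (x - k)) powr (- \<kappa>) * exp (logZ \<sigma> u + u * real (x - k))"
        proof -
          have "logZ \<sigma> s + s * real x \<le> logZ \<sigma> u + u * real x"
            using logZ_minimum[OF \<sigma> c0 d0 s u(1)] sx by simp
          then have "logZ \<sigma> s + s * real x - u * real k \<le> logZ \<sigma> u + u * real (x - k)"
            using xk by (simp add: algebra_simps)
          then show ?thesis using A0 by (intro mult_left_mono) auto
        qed
        also have "\<dots> \<le> w (x - k)"
          using k1 u xk by (intro less.IH) auto
        finally show ?thesis .
      qed
      have m2: "mom \<sigma> 2 s \<le> U2 * (P / s)" using b2(2)[OF \<sigma> s] P2 by simp
      have m3: "mom \<sigma> 3 s \<le> U3 * (P / s ^ 2)" using b3(2)[OF \<sigma> s] P3 by simp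
      have n2: "0 \<le> mom \<sigma> 2 s" unfolding mom_def
        by (rule suminf_nonneg[OF mom_summable[OF \<sigma> c0 d0 s]]) (use \<sigma>n in auto)
      \<comment> \<open>After multiplication by x, the gain and the second-moment loss caused by
        \<open>H\<close> are of order P, everything else is of order 1 / s^2.\<close>
      have fin: "(H + (4 / real x ^ 2 + 2 * \<kappa> / real x ^ 2)) * mom \<sigma> 2 s + H * \<kappa> / real x * mom \<sigma> 3 s
         \<le> \<kappa> / real x * mom \<sigma> 1 s"
      proof -
        have t1: "H * real x * mom \<sigma> 2 s \<le> (H0 / P) * (U0 * (P * s)) * (U2 * (P / s))"
          using xu H0 P0 b0 b2 H s m2 n2 unfolding H_def by (intro mult_mono) auto
        have t2: "(4 + 2 * \<kappa>) / real x * mom \<sigma> 2 s \<le> (4 + 2 * \<kappa>) / (l0 * (P * s)) * (U2 * (P / s))"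
          using xl x \<kappa>0 b0 P0 s m2 n2 by (intro mult_mono divide_left_mono) auto
        have t3: "H * \<kappa> * mom \<sigma> 3 s \<le> H * \<kappa> * (U3 * (P / s ^ 2))"
          using H \<kappa>0 m3 by (intro mult_left_mono) auto
        have e1: "(H0 / P) * (U0 * (P * s)) * (U2 * (P / s)) = H0 * U0 * U2 * P"
          using P0 s by (simp add: field_simps)
        have e2: "(4 + 2 * \<kappa>) / (l0 * (P * s)) * (U2 * (P / s)) = (4 + 2 * \<kappa>) * U2 / l0 * (1 / s ^ 2)"
          using P0 s b0 by (simp add: field_simps power2_eq_square)
        have e3: "H * \<kappa> * (U3 * (P / s ^ 2)) = \<kappa> * H0 * U3 * (1 / s ^ 2)"
          using P0 s by (simp add: H_def field_simps)
        have "B * (1 / s ^ 2) = P * (B * s powr d)" by (simp add: Pd)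
        also have "\<dots> \<le> P * 1"
        proof -
          have "s powr d \<le> ((1 / B) powr (1 / d)) powr d"
            using s\<epsilon> s assms by (intro powr_mono2) (auto simp: \<epsilon>_def)
          also have "\<dots> = 1 / B" using assms B0 by (simp add: powr_powr)
          finally have "B * s powr d \<le> 1" using B0 by (simp add: field_simps)
          then show ?thesis using P0 by (intro mult_left_mono) auto
        qed
        finally have "B * (1 / s ^ 2) \<le> P" by simp
        moreover have "B * (1 / s ^ 2) = (4 + 2 * \<kappa>) * U2 / l0 * (1 / s ^ 2) + \<kappa> * H0 * U3 * (1 / s ^ 2)"
          unfolding B_def by (rule distrib_right)
        moreover have "\<kappa> * (l1 * P) = 2 * (H0 * U0 * U2 * P) + 2 * P"
          using b1 by (simp add: \<kappa>_def field_simps)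
        moreover have "\<kappa> * (l1 * P) \<le> \<kappa> * mom \<sigma> 1 s"
          using b1(2)[OF \<sigma> s s1] \<kappa>0 by (intro mult_left_mono) (auto simp: P_def)
        moreover have "0 \<le> H0 * U0 * U2 * P" using H0 b0 b2 P0 by simp
        ultimately have "H * real x * mom \<sigma> 2 s + (4 + 2 * \<kappa>) / real x * mom \<sigma> 2 s + H * \<kappa> * mom \<sigma> 3 s \<le> \<kappa> * mom \<sigma> 1 s"
          using t1[unfolded e1] t2[unfolded e2] t3[unfolded e3] P0 by linarith
        then have "(H * real x * mom \<sigma> 2 s + (4 + 2 * \<kappa>) / real x * mom \<sigma> 2 s + H * \<kappa> * mom \<sigma> 3 s) / real x
          \<le> \<kappa> * mom \<sigma> 1 s / real x" by (rule divide_right_mono) simp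
        moreover have "(H * real x * mom \<sigma> 2 s + (4 + 2 * \<kappa>) / real x * mom \<sigma> 2 s + H * \<kappa> * mom \<sigma> 3 s) / real x
          = (H + (4 / real x ^ 2 + 2 * \<kappa> / real x ^ 2)) * mom \<sigma> 2 s + H * \<kappa> / real x * mom \<sigma> 3 s"
          using x by (simp add: field_simps power2_eq_square)
        ultimately show ?thesis by simp
      qed
      have "real x * E \<le> E * (mom \<sigma> 0 s + \<kappa> / real x * mom \<sigma> 1 s - (H + (4 / real x ^ 2 + 2 * \<kappa> / real x ^ 2)) * mom \<sigma> 2 s
        - H * \<kappa> / real x * mom \<sigma> 3 s)"
        using fin sx E0 mult_left_mono[of "real x" "mom \<sigma> 0 s + \<kappa> / real x * mom \<sigma> 1 s - (H + (4 / real x ^ 2 + 2 * \<kappa> / real x ^ 2)) * mom \<sigma> 2 s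
        - H * \<kappa> / real x * mom \<sigma> 3 s" E] by (simp add: mult.commute)
      also have "\<dots> \<le> E * (\<Sum>k\<in>{1..x div 2}. \<sigma> k * exp (- s * real k) * ((1 - H * real k ^ 2) * (1 + \<kappa> * (real k / real x))))"
        using x by (intro mult_left_mono moment_sum_ge[OF \<sigma> c0 d0 s _ \<kappa>0 H] E0) auto
      also have "\<dots> = (\<Sum>k\<in>{1..x div 2}. \<sigma> k * (E * (exp (- s * real k) * ((1 - H * real k ^ 2) * (1 + \<kappa> * (real k / real x))))))"
        by (simp add: sum_distrib_left mult_ac)
      also have "\<dots> \<le> (\<Sum>k\<in>{1..x div 2}. \<sigma> k * w (x - k))"
        by (intro sum_mono mult_left_mono step \<sigma>n)
      also have "\<dots> \<le> (\<Sum>k=1..x. \<sigma> k * w (x - k))"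
        using w0 \<sigma>n by (intro sum_mono2) auto
      also have "\<dots> = real x * w x" using rec[of x] less.prems by simp
      finally show ?thesis using x by (simp add: E_def)
    qed
  qed
  have "\<exists>s>0. A * real x powr (- \<kappa>) * exp (logZ \<sigma> s + s * real x) \<le> w x"
    if h: "pgrowth c C d \<sigma>" "w 0 = 1" "\<And>x. w x \<ge> 0"
      "\<And>x. x \<ge> 1 \<Longrightarrow> real x * w x = (\<Sum>k=1..x. \<sigma> k * w (x - k))" "x \<ge> 1" for \<sigma> w x
  proof -
    obtain s where "s > 0" "mom \<sigma> 0 s = real x"
      using mom0_root[OF h(1) assms(2,3) d0, of "real x"] \<open>x \<ge> 1\<close> by auto
    then show ?thesis using main[OF h] by blast
  qed
  note bound = this
  show ?thesis
    by (rule exI[of _ A], rule conjI[OF A0], rule exI[of _ \<kappa>], rule conjI[OF \<kappa>0])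
      (intro allI impI, rule bound, auto)
qed

section \<open>Occupation numbers and their weights\<close>


text \<open>Occupations of the excited levels only; the ground state is restored by
  \<open>with_ground\<close>.\<close>

definition conf :: "(nat \<Rightarrow> nat) set" where
  "conf = {n. n 0 = 0 \<and> finite {j. n j \<noteq> 0}}"

definition cnt :: "(nat \<Rightarrow> nat) \<Rightarrow> nat" where
  "cnt n = (\<Sum>j | n j \<noteq> 0. n j)"

definition energy :: "(nat \<Rightarrow> nat) \<Rightarrow> nat" where
  "energy n = (\<Sum>j | n j \<noteq> 0. j * n j)"

definition level :: "nat \<Rightarrow> (nat \<Rightarrow> nat) set" where
  "level x = {n \<in> conf. energy n = x}"

definition wlev :: "(nat \<Rightarrow> nat) \<Rightarrow> real \<Rightarrow> nat \<Rightarrow> real" where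
  "wlev q \<tau> x = (\<Sum>n\<in>level x. real (weight q n) * exp (- \<tau> * real (cnt n)))"

text \<open>The coefficient of z^k in the logarithmic derivative, times z, of the product over j of
  (1 - exp (- \<tau>) z^j)^(- q j).\<close>

definition dsum :: "(nat \<Rightarrow> nat) \<Rightarrow> real \<Rightarrow> nat \<Rightarrow> real" where
  "dsum q \<tau> k = (\<Sum>j | j \<in> {1..k} \<and> j dvd k. real j * real (q j) * exp (- \<tau> * real (k div j)))"

text \<open>The logarithm of 1 + exp (- y) + exp (- 2 y) + ..., the partition function of a single
  bosonic mode.\<close>

definition phi :: "real \<Rightarrow> real" where
  "phi y = - ln (1 - exp (- y))"

lemma conf_sums:
  assumes "finite A" "\<And>j. n j \<noteq> 0 \<Longrightarrow> j \<in> A"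
  shows "cnt n = (\<Sum>j\<in>A. n j)" "energy n = (\<Sum>j\<in>A. j * n j)"
    "weight q n = (\<Prod>j\<in>A. (n j + q j - 1) choose n j)"
  unfolding cnt_def energy_def weight_def
  by (rule sum.mono_neutral_left prod.mono_neutral_left; use assms in auto)+

lemma conf_energy_bounds:
  assumes "n \<in> conf" "energy n \<le> M" "n j \<noteq> 0"
  shows "1 \<le> j" "j \<le> M" "n j \<le> M"
proof -
  have f: "finite {j. n j \<noteq> 0}" and "n 0 = 0" using assms by (auto simp: conf_def)
  then show j: "1 \<le> j" using assms(3) by (cases j) auto
  have "j * n j \<le> energy n" unfolding energy_def using f assms by (intro member_le_sum) auto
  then have *: "j * n j \<le> M" using assms by simp
  have "j * 1 \<le> j * n j" using assms by (intro mult_le_mono2) auto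
  with * show "j \<le> M" by linarith
  have "1 * n j \<le> j * n j" using j by (intro mult_le_mono1) auto
  with * show "n j \<le> M" by linarith
qed

lemma finite_conf_energy: "finite {n \<in> conf. energy n \<le> M}"
proof (rule finite_subset)
  show "{n \<in> conf. energy n \<le> M} \<subseteq> {f. \<forall>j. (j \<in> {1..M} \<longrightarrow> f j \<in> {0..M}) \<and> (j \<notin> {1..M} \<longrightarrow> f j = 0)}"
  proof (intro subsetI CollectI allI conjI impI)
    fix n j assume n: "n \<in> {n \<in> conf. energy n \<le> M}"
    show "n j \<in> {0..M}"
      using n conf_energy_bounds(3)[of n M j] by (cases "n j = 0") auto
    show "n j = 0" if "j \<notin> {1..M}"
      using n conf_energy_bounds(1,2)[of n M j] that by auto
  qed
qed (rule finite_set_of_finite_funs; simp)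

lemma finite_level: "finite (level x)"
  by (rule finite_subset[OF _ finite_conf_energy[of x]]) (auto simp: level_def)

lemma level_0: "level 0 = {\<lambda>_. 0}"
  using conf_energy_bounds[of _ 0] by (auto simp: level_def conf_def energy_def fun_eq_iff)

lemma wlev_0: "wlev q \<tau> 0 = 1"
  by (simp add: wlev_def level_0 weight_def cnt_def)

lemma wlev_nonneg: "wlev q \<tau> x \<ge> 0"
  unfolding wlev_def by (intro sum_nonneg) auto

text \<open>Comparison of coefficients in z f' = (q z / (1 - z)) f for f = (1 - z)^(- q).\<close>

lemma binomial_weight_sum:
  assumes "q \<ge> (1::nat)"
  shows "m * ((m + q - 1) choose m) = q * (\<Sum>i<m. (i + q - 1) choose i)"
proof (induction m)
  case (Suc m)
  have e: "Suc m + q - 1 = Suc (m + q - 1)" using assms by simp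
  have "Suc m * ((Suc m + q - 1) choose Suc m) = Suc (m + q - 1) * ((m + q - 1) choose m)"
    unfolding e by (rule Suc_times_binomial)
  also have "\<dots> = m * ((m + q - 1) choose m) + q * ((m + q - 1) choose m)"
  proof -
    have "Suc (m + q - 1) = m + q" using assms by simp
    then show ?thesis by (simp only: add_mult_distrib)
  qed
  finally show ?case using Suc by (simp add: algebra_simps)
qed simp

lemma conf_fun_upd: "n \<in> conf \<Longrightarrow> j \<ge> 1 \<Longrightarrow> n(j := k) \<in> conf"
  unfolding conf_def by (auto intro: finite_subset[of _ "insert j {j. n j \<noteq> 0}"])

lemma fun_upd_sums:
  assumes "n \<in> conf" "l \<le> n j"
  shows "cnt n = cnt (n(j := n j - l)) + l" "energy n = energy (n(j := n j - l)) + j * l"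
proof -
  define A where "A = insert j {j. n j \<noteq> 0}"
  have A: "finite A" "j \<in> A" using assms by (auto simp: A_def conf_def)
  have s: "cnt n = (\<Sum>i\<in>A. n i)" "energy n = (\<Sum>i\<in>A. i * n i)"
     "cnt (n(j := n j - l)) = (\<Sum>i\<in>A. (n(j := n j - l)) i)"
     "energy (n(j := n j - l)) = (\<Sum>i\<in>A. i * (n(j := n j - l)) i)"
    by (rule conf_sums; use A in \<open>auto simp: A_def split: if_splits\<close>)+
  have c: "(\<Sum>i\<in>A - {j}. (n(j := n j - l)) i) = (\<Sum>i\<in>A - {j}. n i)"
    "(\<Sum>i\<in>A - {j}. i * (n(j := n j - l)) i) = (\<Sum>i\<in>A - {j}. i * n i)"
    by (rule sum.cong; simp)+
  show "cnt n = cnt (n(j := n j - l)) + l"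
    unfolding s sum.remove[OF A] c using assms by simp
  show "energy n = energy (n(j := n j - l)) + j * l"
    unfolding s sum.remove[OF A] c using mult_le_mono2[OF assms(2), of j]
    by (simp only: fun_upd_same diff_mult_distrib2)
qed

lemma occupation_weight:
  assumes "n \<in> conf" "q j \<ge> 1"
  shows "n j * weight q n = q j * (\<Sum>l\<in>{1..n j}. weight q (n(j := n j - l)))"
proof -
  define A where "A = insert j {j. n j \<noteq> 0}"
  have A: "finite A" "j \<in> A" using assms by (auto simp: A_def conf_def)
  define R where "R = (\<Prod>i\<in>A - {j}. (n i + q i - 1) choose n i)"
  have w: "weight q (n(j := k)) = ((k + q j - 1) choose k) * R" for k
  proof -
    have "weight q (n(j := k)) = (\<Prod>i\<in>A. ((n(j := k)) i + q i - 1) choose (n(j := k)) i)"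
      by (rule conf_sums) (use A in \<open>auto simp: A_def split: if_splits\<close>)
    also have "\<dots> = ((k + q j - 1) choose k) * R"
      unfolding prod.remove[OF A] R_def by (intro arg_cong2[where f = "(*)"] prod.cong) auto
    finally show ?thesis .
  qed
  have "(\<Sum>l\<in>{1..n j}. weight q (n(j := n j - l))) = (\<Sum>i<n j. weight q (n(j := i)))"
    by (rule sum.reindex_bij_witness[of _ "\<lambda>i. n j - i" "\<lambda>l. n j - l"]) auto
  also have "q j * \<dots> = (q j * (\<Sum>i<n j. (i + q j - 1) choose i)) * R"
    by (simp add: w sum_distrib_right mult.assoc)
  also have "\<dots> = n j * weight q n"
    using w[of "n j"] binomial_weight_sum[OF assms(2), of "n j"] by simp
  finally show ?thesis by simp
qed

text \<open>Double counting: in the sum of j (n j) weight over j and over all n of energy x, the factor n j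
  is resolved by the previous lemma into the ways of removing l particles from level j.\<close>

lemma wlev_recursion:
  assumes q: "\<And>j. q j > 0" and x: "x \<ge> 1"
  shows "real x * wlev q \<tau> x = (\<Sum>k=1..x. dsum q \<tau> k * wlev q \<tau> (x - k))"
proof -
  let ?W = "\<lambda>n. real (weight q n) * exp (- \<tau> * real (cnt n))"
  have en: "energy n = (\<Sum>j\<in>{1..x}. j * n j)" if "n \<in> level x" for n
    by (rule conf_sums) (use that conf_energy_bounds[of n x] in \<open>auto simp: level_def\<close>)
  have "real x * wlev q \<tau> x = (\<Sum>n\<in>level x. real (energy n) * ?W n)"
    unfolding wlev_def sum_distrib_left by (rule sum.cong) (auto simp: level_def)
  also have "\<dots> = (\<Sum>n\<in>level x. \<Sum>j\<in>{1..x}. real j * (real (n j) * ?W n))"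
    by (rule sum.cong) (auto simp: en sum_distrib_right mult.assoc)
  also have "\<dots> = (\<Sum>j\<in>{1..x}. \<Sum>n\<in>level x. real j * (real (n j) * ?W n))"
    by (rule sum.swap)
  also have "\<dots> = (\<Sum>j\<in>{1..x}. \<Sum>l | l \<in> {1..x} \<and> j * l \<le> x.
      real j * real (q j) * exp (- \<tau> * real l) * wlev q \<tau> (x - j * l))"
  proof (rule sum.cong[OF refl])
    fix j assume "j \<in> {1..x}"
    then have j: "j \<ge> 1" "j \<le> x" by auto
    let ?g = "\<lambda>l m. real j * real (q j) * exp (- \<tau> * real l) * ?W m"
    have "(\<Sum>n\<in>level x. real j * (real (n j) * ?W n)) =
        (\<Sum>n\<in>level x. \<Sum>l\<in>{1..n j}. ?g l (n(j := n j - l)))"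
    proof (rule sum.cong[OF refl])
      fix n assume n: "n \<in> level x"
      then have nc: "n \<in> conf" by (simp add: level_def)
      have "real (n j) * real (weight q n) = real (q j) * (\<Sum>l\<in>{1..n j}. real (weight q (n(j := n j - l))))"
        using occupation_weight[OF nc, of q j] q[of j]
        by (simp del: of_nat_mult of_nat_sum add: of_nat_mult[symmetric] of_nat_sum[symmetric] Suc_le_eq)
      then have "real j * (real (n j) * ?W n) = real j * (real (q j) * (\<Sum>l\<in>{1..n j}. real (weight q (n(j := n j - l)))) * exp (- \<tau> * real (cnt n)))"
        by (simp add: mult.assoc[symmetric])
      also have "\<dots> = (\<Sum>l\<in>{1..n j}. real j * real (q j) * (real (weight q (n(j := n j - l))) * exp (- \<tau> * real (cnt n))))"
        by (simp add: sum_distrib_left sum_distrib_right mult.assoc)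
      also have "\<dots> = (\<Sum>l\<in>{1..n j}. ?g l (n(j := n j - l)))"
      proof (rule sum.cong[OF refl])
        fix l assume "l \<in> {1..n j}"
        then have "cnt n = cnt (n(j := n j - l)) + l" using fun_upd_sums[OF nc, of l j] by simp
        then have "exp (- \<tau> * real (cnt n)) = exp (- \<tau> * real l) * exp (- \<tau> * real (cnt (n(j := n j - l))))"
          by (simp add: exp_add[symmetric] algebra_simps)
        then show "real j * real (q j) * (real (weight q (n(j := n j - l))) * exp (- \<tau> * real (cnt n))) = ?g l (n(j := n j - l))"
          by simp
      qed
      finally show "real j * (real (n j) * ?W n) = (\<Sum>l\<in>{1..n j}. ?g l (n(j := n j - l)))" .
    qed
    also have "\<dots> = (\<Sum>(n, l)\<in>Sigma (level x) (\<lambda>n. {1..n j}). ?g l (n(j := n j - l)))"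
      by (rule sum.Sigma) (auto simp: finite_level)
    also have "\<dots> = (\<Sum>(l, m)\<in>Sigma {l. l \<in> {1..x} \<and> j * l \<le> x} (\<lambda>l. level (x - j * l)). ?g l m)"
    proof (rule sum.reindex_bij_witness[of _ "\<lambda>(l, m). (m(j := m j + l), l)" "\<lambda>(n, l). (l, n(j := n j - l))"], goal_cases)
      case (2 a)
      then obtain n l where a: "a = (n, l)" "n \<in> level x" "1 \<le> l" "l \<le> n j" by auto
      then have nc: "n \<in> conf" "energy n = x" by (auto simp: level_def)
      have e: "x = energy (n(j := n j - l)) + j * l" using fun_upd_sums(2)[OF nc(1), of l j] a nc by simp
      have "1 * l \<le> j * l" using j by (intro mult_le_mono1) auto
      then have "l \<le> x" "j * l \<le> x" "energy (n(j := n j - l)) = x - j * l" using e by linarith+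
      then show ?case using a conf_fun_upd[OF nc(1) j(1)] by (auto simp: level_def)
    next
      case (4 b)
      then obtain l m where b: "b = (l, m)" "m \<in> level (x - j * l)" "1 \<le> l" "j * l \<le> x" by auto
      then have mc: "m \<in> conf" "energy m = x - j * l" by (auto simp: level_def)
      have c: "m(j := m j + l) \<in> conf" by (rule conf_fun_upd[OF mc(1) j(1)])
      have "energy (m(j := m j + l)) = energy m + j * l"
        using fun_upd_sums(2)[OF c, of l j] by simp
      then show ?case using b c mc by (auto simp: level_def)
    qed auto
    also have "\<dots> = (\<Sum>l | l \<in> {1..x} \<and> j * l \<le> x. \<Sum>m\<in>level (x - j * l). ?g l m)"
      by (rule sum.Sigma[symmetric]) (auto simp: finite_level)
    also have "\<dots> = (\<Sum>l | l \<in> {1..x} \<and> j * l \<le> x.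
      real j * real (q j) * exp (- \<tau> * real l) * wlev q \<tau> (x - j * l))"
      by (simp add: wlev_def sum_distrib_left)
    finally show "(\<Sum>n\<in>level x. real j * (real (n j) * ?W n)) = \<dots>" .
  qed
  also have "\<dots> = (\<Sum>(j, l)\<in>Sigma {1..x} (\<lambda>j. {l. l \<in> {1..x} \<and> j * l \<le> x}).
      real j * real (q j) * exp (- \<tau> * real l) * wlev q \<tau> (x - j * l))"
    by (rule sum.Sigma) auto
  \<comment> \<open>The pairs (j, l) are sorted by their product k = j l: j runs through the
    divisors of k and l is k / j, which produces \<open>dsum\<close>.\<close>
  also have "\<dots> = (\<Sum>(k, j)\<in>Sigma {1..x} (\<lambda>k. {j. j \<in> {1..k} \<and> j dvd k}).
      real j * real (q j) * exp (- \<tau> * real (k div j)) * wlev q \<tau> (x - k))"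
  proof (rule sum.reindex_bij_witness[of _ "\<lambda>(k, j). (j, k div j)" "\<lambda>(j, l). (j * l, j)"], goal_cases)
    case (4 b)
    then obtain k j where b: "b = (k, j)" "1 \<le> k" "k \<le> x" "1 \<le> j" "j \<le> k" "j dvd k" by auto
    then have "1 \<le> k div j" "k div j \<le> x"
      using div_le_dividend[of k j] by (auto simp: div_greater_zero_iff Suc_le_eq simp del: div_le_dividend)
    then show ?case using b by auto
  qed (auto simp: Suc_le_eq)
  also have "\<dots> = (\<Sum>k=1..x. \<Sum>j | j \<in> {1..k} \<and> j dvd k.
      real j * real (q j) * exp (- \<tau> * real (k div j)) * wlev q \<tau> (x - k))"
    by (rule sum.Sigma[symmetric]) auto
  also have "\<dots> = (\<Sum>k=1..x. dsum q \<tau> k * wlev q \<tau> (x - k))"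
    by (simp add: dsum_def sum_distrib_right)
  finally show ?thesis .
qed

text \<open>Induction on q: one more mode multiplies the series by a geometric one, and all terms
  being nonnegative, a truncated product is at most the product of truncations. The hockey-stick
  identity recognises the coefficients.\<close>

lemma negative_binomial_partial_sum:
  assumes "0 \<le> y" "y < (1::real)" "q \<ge> 1"
  shows "(\<Sum>i\<le>B. real ((i + q - 1) choose i) * y ^ i) \<le> (1 / (1 - y)) ^ q"
proof -
  have geo: "(\<Sum>i\<le>m. y ^ i) \<le> 1 / (1 - y)" for m
  proof -
    have "(1 - y) * (\<Sum>i\<le>m. y ^ i) \<le> 1" using assms by (simp add: sum_gp_basic)
    then show ?thesis using assms by (simp add: pos_le_divide_eq mult.commute)
  qed
  show ?thesis using assms(3)
  proof (induction q arbitrary: B rule: nat_induct_at_least)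
    case base
    show ?case using geo[of B] by simp
  next
    case (Suc q)
    have "(i + Suc q - 1) choose i = (\<Sum>k\<le>i. (k + q - 1) choose k)" for i
      using sum_choose_lower[of "q - 1" i] Suc.hyps by (simp add: add.commute)
    then have "(\<Sum>i\<le>B. real ((i + Suc q - 1) choose i) * y ^ i)
        = (\<Sum>i\<le>B. \<Sum>k\<le>i. real ((k + q - 1) choose k) * y ^ k * y ^ (i - k))"
      by (simp add: sum_distrib_right mult.assoc power_add[symmetric] del: add_Suc_right)
    also have "\<dots> = (\<Sum>(i,k)\<in>Sigma {..B} (\<lambda>i. {..i}). real ((k + q - 1) choose k) * y ^ k * y ^ (i - k))"
      by (rule sum.Sigma) auto
    also have "\<dots> = (\<Sum>(k,r)\<in>Sigma {..B} (\<lambda>k. {..B-k}). real ((k + q - 1) choose k) * y ^ k * y ^ r)"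
      by (rule sum.reindex_bij_witness[of _ "\<lambda>(k,r). (k + r, k)" "\<lambda>(i,k). (k, i - k)"]) auto
    also have "\<dots> = (\<Sum>k\<le>B. \<Sum>r\<le>B-k. real ((k + q - 1) choose k) * y ^ k * y ^ r)"
      by (rule sum.Sigma[symmetric]) auto
    also have "\<dots> = (\<Sum>k\<le>B. real ((k + q - 1) choose k) * y ^ k * (\<Sum>r\<le>B-k. y ^ r))"
      by (simp add: sum_distrib_left)
    also have "\<dots> \<le> (\<Sum>k\<le>B. real ((k + q - 1) choose k) * y ^ k * (1 / (1 - y)))"
      using assms by (intro sum_mono mult_left_mono geo) auto
    also have "\<dots> = (\<Sum>k\<le>B. real ((k + q - 1) choose k) * y ^ k) * (1 / (1 - y))"
      by (rule sum_distrib_right[symmetric])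
    also have "\<dots> \<le> (1 / (1 - y)) ^ q * (1 / (1 - y))"
      using Suc.IH assms by (intro mult_right_mono) auto
    finally show ?case by (simp add: mult.commute)
  qed
qed

text \<open>The configurations embed into a finite box, over which the sum factorises level by
  level. The parameter t may be negative, which the Chernoff bound uses for large particle
  numbers.\<close>

lemma weight_sum_le:
  assumes q: "\<And>j. q j > 0" and S: "S \<subseteq> {n \<in> conf. energy n \<le> M}"
    and pos: "\<And>j. j \<ge> 1 \<Longrightarrow> s * real j + t > 0"
  shows "(\<Sum>n\<in>S. real (weight q n) * exp (- s * real (energy n) - t * real (cnt n)))
    \<le> exp (\<Sum>j=1..M. real (q j) * phi (s * real j + t))"
proof -
  define A where "A = {1..M}"
  define f where "f = (\<lambda>j i. real ((i + q j - 1) choose i) * exp (- (s * real j + t)) ^ i)"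
  have supp: "n j \<noteq> 0 \<Longrightarrow> j \<in> A" if "n \<in> S" for n j
    using that S conf_energy_bounds[of n M j] by (auto simp: A_def)
  have term_eq: "real (weight q n) * exp (- s * real (energy n) - t * real (cnt n)) = (\<Prod>j\<in>A. f j (n j))" if n: "n \<in> S" for n
  proof -
    have c: "cnt n = (\<Sum>j\<in>A. n j)" "energy n = (\<Sum>j\<in>A. j * n j)"
      "weight q n = (\<Prod>j\<in>A. (n j + q j - 1) choose n j)"
      by (rule conf_sums; use supp[OF n] in \<open>auto simp: A_def\<close>)+
    have "(\<Sum>j\<in>A. - (s * real j + t) * real (n j)) =
        (\<Sum>j\<in>A. (- s) * (real j * real (n j)) + (- t) * real (n j))"
      by (rule sum.cong) (auto simp: algebra_simps)
    also have "\<dots> = - s * real (energy n) - t * real (cnt n)"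
      unfolding c sum.distrib sum_distrib_left[symmetric] by simp
    finally have "- s * real (energy n) - t * real (cnt n) = (\<Sum>j\<in>A. - (s * real j + t) * real (n j))" by simp
    then have "exp (- s * real (energy n) - t * real (cnt n)) = (\<Prod>j\<in>A. exp (- (s * real j + t)) ^ n j)"
      by (simp add: exp_sum A_def exp_of_nat_mult[symmetric] mult.commute)
    then show ?thesis by (simp add: c f_def prod.distrib)
  qed
  have f0: "f j i \<ge> 0" for j i by (simp add: f_def)
  have inj: "inj_on (\<lambda>n. restrict n A) S"
  proof (rule inj_onI)
    fix n m assume nm: "n \<in> S" "m \<in> S" "restrict n A = restrict m A"
    show "n = m"
    proof
      fix j show "n j = m j"
        using nm supp[of n j] supp[of m j] by (metis restrict_apply)
    qed
  qed
  have "(\<Sum>n\<in>S. real (weight q n) * exp (- s * real (energy n) - t * real (cnt n))) = (\<Sum>n\<in>S. \<Prod>j\<in>A. f j (restrict n A j))"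
  proof (rule sum.cong[OF refl])
    fix n assume "n \<in> S"
    show "real (weight q n) * exp (- s * real (energy n) - t * real (cnt n)) = (\<Prod>j\<in>A. f j (restrict n A j))"
      unfolding term_eq[OF \<open>n \<in> S\<close>] by (rule prod.cong) auto
  qed
  also have "\<dots> = (\<Sum>p\<in>(\<lambda>n. restrict n A) ` S. \<Prod>j\<in>A. f j (p j))"
    by (simp add: sum.reindex[OF inj])
  also have "\<dots> \<le> (\<Sum>p\<in>PiE A (\<lambda>_. {..M}). \<Prod>j\<in>A. f j (p j))"
  proof (rule sum_mono2)
    show "finite (PiE A (\<lambda>_. {..M}))" by (rule finite_PiE) (auto simp: A_def)
    have "n j \<le> M" if "n \<in> S" for n j
      using that S conf_energy_bounds(3)[of n M j] by (cases "n j = 0") auto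
    then show "(\<lambda>n. restrict n A) ` S \<subseteq> PiE A (\<lambda>_. {..M})" by auto
  qed (auto intro: prod_nonneg f0)
  also have "\<dots> = (\<Prod>j\<in>A. \<Sum>i\<le>M. f j i)"
    by (rule prod_sum_PiE[symmetric]) (auto simp: A_def)
  also have "\<dots> \<le> (\<Prod>j\<in>A. exp (real (q j) * phi (s * real j + t)))"
  proof (intro prod_mono conjI sum_nonneg f0)
    fix j assume "j \<in> A"
    then have p: "s * real j + t > 0" using pos by (auto simp: A_def)
    have "(\<Sum>i\<le>M. f j i) \<le> (1 / (1 - exp (- (s * real j + t)))) ^ q j"
      unfolding f_def using p q[of j] by (intro negative_binomial_partial_sum) auto
    also have "\<dots> = exp (real (q j) * phi (s * real j + t))"
      using p by (simp add: phi_def exp_of_nat_mult exp_minus inverse_eq_divide power_one_over)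
    finally show "(\<Sum>i\<le>M. f j i) \<le> exp (real (q j) * phi (s * real j + t))" .
  qed
  also have "\<dots> = exp (\<Sum>j=1..M. real (q j) * phi (s * real j + t))"
    by (simp add: exp_sum A_def)
  finally show ?thesis .
qed

section \<open>The Bregman divergence of the one-level partition function\<close>


text \<open>The mean occupation of a mode of energy y, minus the derivative of \<open>phi\<close>;
  its variance \<open>rho\<close> is minus the derivative of \<open>psi\<close>.\<close>

definition psi :: "real \<Rightarrow> real" where
  "psi y = 1 / (exp y - 1)"

definition rho :: "real \<Rightarrow> real" where
  "rho y = psi y + psi y ^ 2"

text \<open>The remainder of the first-order Taylor expansion of the convex function
  \<open>phi\<close> at x, with displacement h.\<close>

definition breg :: "real \<Rightarrow> real \<Rightarrow> real" where
  "breg x h = phi (x + h) - phi x + h * psi x"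

lemma psi_pos: "y > 0 \<Longrightarrow> psi y > 0"
  by (simp add: psi_def)

lemma psi_antimono: "0 < x \<Longrightarrow> x \<le> y \<Longrightarrow> psi y \<le> psi x"
  unfolding psi_def by (intro divide_left_mono) (auto intro!: mult_pos_pos)

lemma rho_pos: "y > 0 \<Longrightarrow> rho y > 0"
  unfolding rho_def by (intro add_pos_pos zero_less_power psi_pos)

lemma rho_antimono: "0 < x \<Longrightarrow> x \<le> y \<Longrightarrow> rho y \<le> rho x"
  unfolding rho_def by (intro add_mono power_mono psi_antimono less_imp_le[OF psi_pos]) auto

lemma rho_eq: "y > 0 \<Longrightarrow> rho y = exp y / (exp y - 1) ^ 2"
proof -
  assume "y > 0"
  define t where "t = exp y - 1"
  have "t > 0" using \<open>y > 0\<close> by (simp add: t_def)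
  then have "1 / t + (1 / t)\<^sup>2 = (t + 1) / t\<^sup>2"
    by (simp add: field_simps power2_eq_square)
  then show ?thesis by (simp add: rho_def psi_def t_def)
qed

lemma rho_le:
  assumes "y > 0"
  shows "rho y \<le> 16 * exp (- y / 2) / y ^ 2"
proof -
  \<comment> \<open>With the fourth root e of exp y, the difference exp y - 1 has the factor e - 1
    >= y / 4 with a cofactor at least e^3. This is what leaves the decay exp (- y / 2).\<close>
  define e where "e = exp (y / 4)"
  have e: "e \<ge> 1 + y / 4" "e > 1" using assms exp_ge_add_one_self[of "y / 4"] by (auto simp: e_def)
  have e4: "exp y = e ^ 4" by (simp add: e_def exp_of_nat_mult[symmetric])
  have "y / 4 * e ^ 3 \<le> (e - 1) * (e ^ 3 + e ^ 2 + e + 1)"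
    using e assms by (intro mult_mono) auto
  also have "\<dots> = exp y - 1" unfolding e4 by (simp add: algebra_simps eval_nat_numeral)
  finally have "(y / 4 * e ^ 3) ^ 2 \<le> (exp y - 1) ^ 2"
    using assms e by (intro power_mono) auto
  then have "exp y / (exp y - 1) ^ 2 \<le> exp y / (y / 4 * e ^ 3) ^ 2"
    using assms e by (intro divide_left_mono) (auto intro!: mult_pos_pos)
  also have "\<dots> = 16 * (1 / e ^ 2) / y ^ 2"
    unfolding e4 using e assms by (simp add: power_mult_distrib power_divide field_simps eval_nat_numeral)
  also have "1 / e ^ 2 = exp (- y / 2)"
    by (simp add: e_def exp_of_nat_mult[symmetric] exp_minus inverse_eq_divide)
  finally show ?thesis using assms by (simp add: rho_eq)
qed

text \<open>\<open>rho y\<close> lies between exp (- y) / y^2 and exp y / y^2. The constant combines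
  the upper bound at y <= 2 with the lower bound at 4 y <= 8.\<close>

lemma rho_4_ge:
  assumes "0 < y" "y \<le> 2"
  shows "exp (- 10) / 16 * rho y \<le> rho (4 * y)"
proof -
  have "rho y \<le> exp 2 / y ^ 2"
  proof -
    have "y ^ 2 \<le> (exp y - 1) ^ 2" using assms exp_ge_add_one_self[of y] by (intro power_mono) linarith+
    then show ?thesis unfolding rho_eq[OF assms(1)] using assms by (intro frac_le) auto
  qed
  then have "exp (- 10) / 16 * rho y \<le> exp (- 10) / 16 * (exp 2 / y ^ 2)"
    by (intro mult_left_mono) auto
  also have "\<dots> = exp (- 8) / (4 * y) ^ 2" by (simp add: exp_add[symmetric] power_mult_distrib)
  also have "\<dots> \<le> exp (- (4 * y)) / (4 * y) ^ 2" using assms by (intro divide_right_mono) auto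
  also have "\<dots> \<le> rho (4 * y)"
  proof -
    define z where "z = 4 * y"
    have z: "z > 0" using assms by (simp add: z_def)
    have "1 - z \<le> exp (- z)" using exp_ge_add_one_self[of "- z"] by simp
    then have "exp z * (1 - exp (- z)) \<le> exp z * z" by (intro mult_left_mono) auto
    then have "exp z - 1 \<le> exp z * z" by (simp add: right_diff_distrib exp_add[symmetric])
    then have "(exp z - 1) ^ 2 \<le> (exp z * z) ^ 2" using z by (intro power_mono) auto
    then have "exp z / (exp z * z) ^ 2 \<le> exp z / (exp z - 1) ^ 2"
      using z by (intro divide_left_mono) (auto intro!: mult_pos_pos)
    then show ?thesis using z unfolding z_def[symmetric] rho_eq[OF z]
      by (simp add: power_mult_distrib exp_minus power2_eq_square field_simps)
  qed
  finally show ?thesis .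
qed

lemma DERIV_phi:
  assumes "y > 0"
  shows "(phi has_real_derivative - psi y) (at y)"
proof -
  have "((\<lambda>y. - ln (1 - exp (- y))) has_real_derivative - psi y) (at y)"
    using assms by (auto intro!: derivative_eq_intros simp: psi_def exp_minus field_simps)
  then show ?thesis by (simp add: phi_def[abs_def])
qed

lemma DERIV_psi:
  assumes "y > 0"
  shows "(psi has_real_derivative - rho y) (at y)"
proof -
  have "((\<lambda>y. 1 / (exp y - 1)) has_real_derivative - rho y) (at y)"
    using assms by (auto intro!: derivative_eq_intros simp: rho_eq power2_eq_square)
  then show ?thesis by (simp add: psi_def[abs_def])
qed

lemma DERIV_breg:
  assumes "x + h > 0"
  shows "(breg x has_real_derivative psi x - psi (x + h)) (at h)"
proof -
  have "((\<lambda>h. phi (x + h)) has_real_derivative - psi (x + h)) (at h)"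
    using DERIV_phi[OF assms] DERIV_shift[of phi "- psi (x + h)" h x] by (simp add: add.commute)
  then show ?thesis unfolding breg_def[abs_def]
    by (auto intro!: derivative_eq_intros)
qed

lemma breg_0: "breg x 0 = 0"
  by (simp add: breg_def)

lemma second_order_nonneg:
  fixes g g' g'' :: "real \<Rightarrow> real"
  assumes "0 \<le> h" "g 0 = 0" "g' 0 = 0"
    and "\<And>r. 0 \<le> r \<Longrightarrow> r \<le> h \<Longrightarrow> (g has_real_derivative g' r) (at r)"
    and "\<And>r. 0 \<le> r \<Longrightarrow> r \<le> h \<Longrightarrow> (g' has_real_derivative g'' r) (at r)"
    and "\<And>r. 0 \<le> r \<Longrightarrow> r \<le> h \<Longrightarrow> 0 \<le> g'' r"
  shows "0 \<le> g h"
proof -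
  have g': "0 \<le> g' r" if "0 \<le> r" "r \<le> h" for r
  proof -
    have "g' 0 \<le> g' r"
      by (rule DERIV_nonneg_imp_nondecreasing[OF that(1)]) (use assms(5,6) that in \<open>meson order_trans\<close>)
    then show ?thesis using assms(3) by simp
  qed
  have "g 0 \<le> g h"
    by (rule DERIV_nonneg_imp_nondecreasing[OF assms(1)]) (use assms(4) g' in blast)
  then show ?thesis using assms(2) by simp
qed

text \<open>Both sides vanish to first order at h = 0, so comparing second derivatives along the two
  rays is enough. Most inequalities below are instances; \<open>\<alpha> = - 1\<close> handles
  negative displacements, and the constant c handles comparison with multiples of h^2.\<close>

lemma breg_compare:
  assumes h: "0 \<le> h" and xy: "\<And>r. 0 \<le> r \<Longrightarrow> r \<le> h \<Longrightarrow> x + \<alpha> * r > 0" "\<And>r. 0 \<le> r \<Longrightarrow> r \<le> h \<Longrightarrow> y + \<beta> * r > 0"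
    and le: "\<And>r. 0 \<le> r \<Longrightarrow> r \<le> h \<Longrightarrow> b * \<beta>\<^sup>2 * rho (y + \<beta> * r) \<le> a * \<alpha>\<^sup>2 * rho (x + \<alpha> * r) + c"
  shows "b * breg y (\<beta> * h) \<le> a * breg x (\<alpha> * h) + c * h\<^sup>2 / 2"
proof -
  have d1: "((\<lambda>r. breg z (\<gamma> * r)) has_real_derivative \<gamma> * (psi z - psi (z + \<gamma> * r))) (at r)"
    if "z + \<gamma> * r > 0" for z \<gamma> r
    using DERIV_chain2[OF DERIV_breg[OF that] DERIV_cmult[OF DERIV_ident]] by (simp add: mult.commute)
  have d2: "((\<lambda>r. \<gamma> * (psi z - psi (z + \<gamma> * r))) has_real_derivative \<gamma>\<^sup>2 * rho (z + \<gamma> * r)) (at r)"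
    if "z + \<gamma> * r > 0" for z \<gamma> r
  proof -
    have "((\<lambda>r. psi (z + \<gamma> * r)) has_real_derivative - rho (z + \<gamma> * r) * \<gamma>) (at r)"
      by (rule DERIV_chain2[where f = psi and g = "\<lambda>r. z + \<gamma> * r", OF DERIV_psi[OF that]])
        (auto intro!: derivative_eq_intros)
    then show ?thesis by (auto intro!: derivative_eq_intros simp: power2_eq_square)
  qed
  have "0 \<le> (\<lambda>r. a * breg x (\<alpha> * r) + c * r\<^sup>2 / 2 - b * breg y (\<beta> * r)) h"
  proof (rule second_order_nonneg[OF h, where g' = "\<lambda>r. a * (\<alpha> * (psi x - psi (x + \<alpha> * r))) + c * r - b * (\<beta> * (psi y - psi (y + \<beta> * r)))"
      and g'' = "\<lambda>r. a * (\<alpha>\<^sup>2 * rho (x + \<alpha> * r)) + c - b * (\<beta>\<^sup>2 * rho (y + \<beta> * r))"])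
    fix r assume r: "0 \<le> r" "r \<le> h"
    show "((\<lambda>r. a * breg x (\<alpha> * r) + c * r\<^sup>2 / 2 - b * breg y (\<beta> * r)) has_real_derivative
        a * (\<alpha> * (psi x - psi (x + \<alpha> * r))) + c * r - b * (\<beta> * (psi y - psi (y + \<beta> * r)))) (at r)"
      by (rule DERIV_diff DERIV_add DERIV_cmult d1 xy r)+ (auto intro!: derivative_eq_intros DERIV_cmult d1 xy r)
    show "((\<lambda>r. a * (\<alpha> * (psi x - psi (x + \<alpha> * r))) + c * r - b * (\<beta> * (psi y - psi (y + \<beta> * r)))) has_real_derivative
        a * (\<alpha>\<^sup>2 * rho (x + \<alpha> * r)) + c - b * (\<beta>\<^sup>2 * rho (y + \<beta> * r))) (at r)"
      by (rule DERIV_diff DERIV_add DERIV_cmult d2 xy r)+ (auto intro!: derivative_eq_intros DERIV_cmult d2 xy r)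
    show "0 \<le> a * (\<alpha>\<^sup>2 * rho (x + \<alpha> * r)) + c - b * (\<beta>\<^sup>2 * rho (y + \<beta> * r))"
      using le[OF r] by (simp add: mult.assoc)
  qed (simp_all add: breg_0)
  then show ?thesis by simp
qed

lemma breg_nonneg:
  assumes "x > 0" "x + h > 0"
  shows "breg x h \<ge> 0"
proof -
  have p: "x + h * r > 0" if "0 \<le> r" "r \<le> 1" for r
  proof -
    have "0 < (1 - r) * x + r * (x + h)"
    proof (cases "r = 0")
      case False
      then have "0 < r * (x + h)" using that assms by simp
      moreover have "0 \<le> (1 - r) * x" using that assms by simp
      ultimately show ?thesis by linarith
    qed (use assms in simp)
    then show ?thesis by (simp add: algebra_simps)
  qed
  have "0 * breg x (h * 1) \<le> 1 * breg x (h * 1) + 0 * 1\<^sup>2 / 2"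
    by (rule breg_compare) (use p in \<open>auto intro!: mult_nonneg_nonneg less_imp_le[OF rho_pos]\<close>)
  then show ?thesis by simp
qed

lemma breg_double:
  assumes "x > 0" "h \<ge> 0"
  shows "breg x (2 * h) \<le> 4 * breg x h"
proof -
  have "1 * breg x (2 * h) \<le> 4 * breg x (1 * h) + 0 * h\<^sup>2 / 2"
    by (rule breg_compare) (use assms in \<open>auto intro!: rho_antimono add_pos_nonneg\<close>)
  then show ?thesis by simp
qed

text \<open>The curvature \<open>rho\<close> decreases, so it is larger to the left of x than to the
  right.\<close>

lemma breg_neg_ge:
  assumes "0 \<le> h" "h < x"
  shows "breg x h \<le> breg x (- h)"
proof -
  have "1 * breg x (1 * h) \<le> 1 * breg x ((-1) * h) + 0 * h\<^sup>2 / 2"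
    by (rule breg_compare) (use assms in \<open>auto intro!: rho_antimono add_pos_nonneg\<close>)
  then show ?thesis by simp
qed

lemma breg_mono:
  assumes "x > 0" "0 \<le> h" "h \<le> k"
  shows "breg x h \<le> breg x k"
proof (rule DERIV_nonneg_imp_nondecreasing[OF assms(3)])
  fix r assume "h \<le> r" "r \<le> k"
  then have "(breg x has_real_derivative psi x - psi (x + r)) (at r)" "psi (x + r) \<le> psi x"
    using assms by (auto intro!: DERIV_breg psi_antimono)
  then show "\<exists>y. (breg x has_real_derivative y) (at r) \<and> 0 \<le> y" by auto
qed

text \<open>This compares level 4 j with level j under the same displacement. Monotonicity of
  \<open>rho\<close> allows passing from 4 x + r to 4 (x + r), where \<open>rho_4_ge\<close>
  applies.\<close>

lemma breg_4_ge:
  assumes "0 < x" "x \<le> 1" "0 \<le> h" "h \<le> 1"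
  shows "exp (- 10) / 16 * breg x h \<le> breg (4 * x) h"
proof -
  have "(exp (- 10) / 16) * breg x (1 * h) \<le> 1 * breg (4 * x) (1 * h) + 0 * h\<^sup>2 / 2"
  proof (rule breg_compare)
    fix r assume r: "0 \<le> r" "r \<le> h"
    have "exp (- 10) / 16 * rho (x + r) \<le> rho (4 * (x + r))" using assms r by (intro rho_4_ge) auto
    also have "\<dots> \<le> rho (4 * x + r)" using assms r by (intro rho_antimono) auto
    finally show "exp (- 10) / 16 * 1\<^sup>2 * rho (x + 1 * r) \<le> 1 * 1\<^sup>2 * rho (4 * x + 1 * r) + 0" by simp
  qed (use assms in auto)
  then show ?thesis by simp
qed

lemma breg_le:
  assumes "x > 0" "h \<ge> 0"
  shows "breg x h \<le> rho x * h\<^sup>2 / 2"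
proof -
  have "1 * breg x (1 * h) \<le> 0 * breg x (1 * h) + rho x * h\<^sup>2 / 2"
    by (rule breg_compare) (use assms in \<open>auto intro!: rho_antimono add_pos_nonneg\<close>)
  then show ?thesis by simp
qed

lemma breg_neg_le:
  assumes "0 \<le> h" "h \<le> x / 2" "x > 0"
  shows "breg x (- h) \<le> rho (x / 2) * h\<^sup>2 / 2"
proof -
  have "1 * breg x ((-1) * h) \<le> 0 * breg x (1 * h) + rho (x / 2) * h\<^sup>2 / 2"
    by (rule breg_compare) (use assms in \<open>auto intro!: rho_antimono add_pos_nonneg\<close>)
  then show ?thesis by simp
qed

lemma breg_ge:
  assumes "0 < x" "x \<le> 1" "0 \<le> h" "h \<le> 1"
  shows "rho 2 * h\<^sup>2 / 2 \<le> breg x h"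
proof -
  have "0 * breg x (1 * h) \<le> 1 * breg x (1 * h) + (- rho 2) * h\<^sup>2 / 2"
    by (rule breg_compare) (use assms in \<open>auto intro!: rho_antimono add_pos_nonneg\<close>)
  then show ?thesis by simp
qed

section \<open>Exponential series for \<open>phi\<close> and \<open>psi\<close>\<close>

lemma phi_sums: "y > 0 \<Longrightarrow> (\<lambda>l. exp (- y * real l) / real l) sums phi y"
  unfolding phi_def by (rule inverse_exp_sums)

lemma psi_sums: "y > 0 \<Longrightarrow> (\<lambda>l. exp (- y * real (Suc l))) sums psi y"
  unfolding psi_def by (rule exp_tail_sums)

section \<open>Passing from levels to divisor sums\<close>


definition qgrowth :: "real \<Rightarrow> real \<Rightarrow> real \<Rightarrow> (nat \<Rightarrow> nat) \<Rightarrow> bool" where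
  "qgrowth c C d q \<longleftrightarrow> (\<forall>j\<ge>1. c * real j powr (d - 1) \<le> real (q j) \<and> real (q j) \<le> C * real j powr (d - 1))"

text \<open>The rearrangement of a Lambert series by n = j l. All terms being nonnegative,
  summability over the pairs follows from convergence of the series over n.\<close>

lemma divisor_has_sum:
  fixes f :: "nat \<Rightarrow> nat \<Rightarrow> real"
  assumes nn: "\<And>j l. j \<ge> 1 \<Longrightarrow> l \<ge> 1 \<Longrightarrow> f j l \<ge> 0"
    and S: "(\<lambda>n. \<Sum>j | j \<in> {1..n} \<and> j dvd n. f j (n div j)) sums S"
    and g: "\<And>j. j \<ge> 1 \<Longrightarrow> (f j has_sum g j) {1..}"
  shows "(g has_sum S) {1..}"
proof -
  define B where "B = (\<lambda>n::nat. {j. j \<in> {1..n} \<and> j dvd n})"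
  define F where "F = (\<lambda>(n, j). f j (n div j))"
  have dv: "j \<ge> 1" "n div j \<ge> 1" if "j \<in> B n" for n j
    using that by (auto simp: B_def div_greater_zero_iff Suc_le_eq)
  have finB: "finite (B n)" for n by (simp add: B_def)
  have S': "((\<lambda>n. \<Sum>j\<in>B n. f j (n div j)) has_sum S) UNIV"
    using S unfolding B_def by (rule sums_nonneg_imp_has_sum) (use dv nn in \<open>auto intro!: sum_nonneg simp: B_def\<close>)
  have fib: "((\<lambda>j. F (n, j)) has_sum (\<Sum>j\<in>B n. f j (n div j))) (B n)" for n
    using has_sum_finite[OF finB, of "\<lambda>j. F (n, j)"] by (simp add: F_def)
  have "F summable_on Sigma UNIV B"
    by (rule summable_on_SigmaI[OF fib]) (use S' dv nn in \<open>auto simp: F_def summable_on_def\<close>)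
  then have "(F has_sum S) (Sigma UNIV B)"
    by (intro has_sum_SigmaI[OF fib S'])
  moreover have "(F has_sum S) (Sigma UNIV B) \<longleftrightarrow> ((\<lambda>(j, l). f j l) has_sum S) (Sigma {1..} (\<lambda>j. {1..}))"
    by (rule has_sum_reindex_bij_witness[of _ "\<lambda>(j, l). (j * l, j)" "\<lambda>(n, j). (j, n div j)"])
      (use dv in \<open>auto simp: F_def B_def Suc_le_eq\<close>)
  ultimately have "((\<lambda>(j, l). f j l) has_sum S) (Sigma {1..} (\<lambda>j. {1..}))" by simp
  then show ?thesis by (rule has_sum_SigmaD) (use g in auto)
qed

lemma phi_has_sum: "y > 0 \<Longrightarrow> ((\<lambda>l. exp (- y * real l) / real l) has_sum phi y) {1..}"
  by (rule iffD1[OF has_sum_cong_neutral, OF _ _ _ sums_nonneg_imp_has_sum[OF phi_sums]])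
    (auto simp: not_le)

lemma psi_has_sum:
  assumes "y > 0"
  shows "((\<lambda>l. exp (- y * real l)) has_sum psi y) {1..}"
proof -
  have "((\<lambda>l. exp (- y * real (Suc l))) has_sum psi y) UNIV"
    by (rule sums_nonneg_imp_has_sum[OF psi_sums[OF assms]]) auto
  moreover have "((\<lambda>l. exp (- y * real (Suc l))) has_sum psi y) UNIV \<longleftrightarrow> ((\<lambda>l. exp (- y * real l)) has_sum psi y) {1..}"
    by (rule has_sum_reindex_bij_witness[of _ "\<lambda>l. l - 1" Suc]) auto
  ultimately show ?thesis by simp
qed

text \<open>The divisor j = n alone gives the lower bound. For the upper one, the sum of j^d over
  the divisors j of n is n^d times a part of the series for zeta (d), which converges as d > 1. The
  range of \<tau> reaches 2 because tilts up to 1 also occur doubled.\<close>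

lemma dsum_pgrowth:
  assumes "d > 1" "c1 > 0" "C1 > 0"
  shows "\<exists>c>0. \<exists>C>0. \<forall>q \<tau>. qgrowth c1 C1 d q \<longrightarrow> 0 \<le> \<tau> \<longrightarrow> \<tau> \<le> 2 \<longrightarrow> pgrowth c C d (dsum q \<tau>)"
proof -
  have sz: "summable (\<lambda>l. real l powr (- d))" using assms summable_real_powr_iff[of "- d"] by simp
  define Z where "Z = (\<Sum>l. real l powr (- d))"
  have Z1: "Z \<ge> 1" unfolding Z_def using sum_le_suminf[OF sz, of "{1}"] by simp
  have "pgrowth (c1 * exp (- 2)) (C1 * Z) d (dsum q \<tau>)"
    if q: "qgrowth c1 C1 d q" and \<tau>: "0 \<le> \<tau>" "\<tau> \<le> 2" for q \<tau>
    unfolding pgrowth_def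
  proof (intro allI conjI)
    fix n
    show "c1 * exp (- 2) * real n powr d \<le> dsum q \<tau> n"
    proof (cases "n = 0")
      case False
      then have n: "n \<ge> 1" by simp
      have "real n * real (q n) * exp (- \<tau> * real (n div n)) \<le> dsum q \<tau> n"
        unfolding dsum_def using n by (intro member_le_sum) auto
      moreover have "real n * (c1 * real n powr (d - 1)) * exp (- 2) \<le> real n * real (q n) * exp (- \<tau> * real (n div n))"
        using q n \<tau> assms by (intro mult_mono) (auto simp: qgrowth_def)
      moreover have "real n * (c1 * real n powr (d - 1)) * exp (- 2) = c1 * exp (- 2) * real n powr d"
        using n by (simp add: powr_diff)
      ultimately show ?thesis by simp
    qed (simp add: dsum_def)
    show "dsum q \<tau> n \<le> C1 * Z * real n powr d"
    proof -
      have "dsum q \<tau> n \<le> (\<Sum>j | j \<in> {1..n} \<and> j dvd n. C1 * real n powr d * real (n div j) powr (- d))"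
        unfolding dsum_def
      proof (rule sum_mono)
        fix j assume "j \<in> {j. j \<in> {1..n} \<and> j dvd n}"
        then have j: "j \<ge> 1" "j \<le> n" "j dvd n" by auto
        then obtain l where l: "n = j * l" by blast
        with j have l1: "l \<ge> 1" by (cases l) auto
        have "real j * real (q j) * exp (- \<tau> * real (n div j)) \<le> real j * (C1 * real j powr (d - 1)) * 1"
          using q j \<tau> assms by (intro mult_mono) (auto simp: qgrowth_def)
        also have "\<dots> = C1 * real j powr d" using j by (simp add: powr_diff)
        also have "\<dots> = C1 * real n powr d * real (n div j) powr (- d)"
          using j l1 by (simp add: l powr_mult powr_minus)
        finally show "real j * real (q j) * exp (- \<tau> * real (n div j)) \<le> C1 * real n powr d * real (n div j) powr (- d)" .
      qed
      also have "\<dots> = C1 * real n powr d * (\<Sum>j | j \<in> {1..n} \<and> j dvd n. real (n div j) powr (- d))"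
        by (simp add: sum_distrib_left)
      also have "(\<Sum>j | j \<in> {1..n} \<and> j dvd n. real (n div j) powr (- d)) = (\<Sum>l | l \<in> {1..n} \<and> l dvd n. real l powr (- d))"
      proof (rule sum.reindex_bij_witness[of _ "\<lambda>l. n div l" "\<lambda>j. n div j"])
        fix a assume a: "a \<in> {j. j \<in> {1..n} \<and> j dvd n}"
        then obtain l where l: "n = a * l" "a \<ge> 1" "n \<ge> 1" by auto
        then have "l \<ge> 1" by (cases l) auto
        then show "n div (n div a) = a" "n div a \<in> {l. l \<in> {1..n} \<and> l dvd n}" using l by auto
        then show "n div (n div a) = a" "n div a \<in> {j. j \<in> {1..n} \<and> j dvd n}" by auto
      qed auto
      also have "C1 * real n powr d * (\<Sum>l | l \<in> {1..n} \<and> l dvd n. real l powr (- d)) \<le> C1 * real n powr d * Z"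
        unfolding Z_def using assms by (intro mult_left_mono sum_le_suminf[OF sz]) auto
      finally show ?thesis by (simp add: mult_ac)
    qed
  qed
  then show ?thesis using assms Z1
    by (intro exI[of _ "c1 * exp (- 2)"] conjI exI[of _ "C1 * Z"] allI impI) auto
qed

text \<open>The growth of the divisor sums, supplied by \<open>dsum_pgrowth\<close>, is part of the
  context so that c and C are fixed before M and \<tau>; the constants obtained from them are then
  independent of both.\<close>

locale qseq =
  fixes q :: "nat \<Rightarrow> nat" and d c1 C1 c C :: real
  assumes d: "d > 1" and c1: "c1 > 0" and C1: "C1 > 0" and c: "c > 0" and C: "C > 0"
    and q: "qgrowth c1 C1 d q"
    and dsum: "\<And>\<tau>. 0 \<le> \<tau> \<Longrightarrow> \<tau> \<le> 2 \<Longrightarrow> pgrowth c C d (dsum q \<tau>)"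
    and qpos: "\<And>j. q j > 0"
begin

lemma q_le: "j \<ge> 1 \<Longrightarrow> real (q j) \<le> C1 * real j powr (d - 1)"
  and q_ge: "j \<ge> 1 \<Longrightarrow> c1 * real j powr (d - 1) \<le> real (q j)"
  using q by (auto simp: qgrowth_def)

text \<open>The bridge between two descriptions of the same function: the divisor sums feed the
  recursion, the sum over levels admits convexity estimates for each j separately.\<close>

lemma logZ_has_sum:
  assumes "s > 0" "0 \<le> \<tau>" "\<tau> \<le> 2"
  shows "((\<lambda>j. real (q j) * phi (s * real j + \<tau>)) has_sum logZ (dsum q \<tau>) s) {1..}"
proof (rule divisor_has_sum)
  let ?f = "\<lambda>j l. real (q j) * (exp (- (s * real j + \<tau>) * real l) / real l)"
  show "(?f j has_sum real (q j) * phi (s * real j + \<tau>)) {1..}" if "j \<ge> 1" for j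
    by (intro has_sum_cmult_right phi_has_sum) (use assms that in \<open>auto intro!: add_pos_nonneg\<close>)
  have eq: "(\<Sum>j | j \<in> {1..n} \<and> j dvd n. ?f j (n div j)) = dsum q \<tau> n / real n * exp (- s * real n)" for n
    unfolding dsum_def sum_divide_distrib sum_distrib_right
  proof (rule sum.cong[OF refl])
    fix j assume "j \<in> {j. j \<in> {1..n} \<and> j dvd n}"
    then obtain l where l: "n = j * l" "j \<ge> 1" "n \<ge> 1" by auto
    then have "l \<ge> 1" by (cases l) auto
    then show "?f j (n div j) = real j * real (q j) * exp (- \<tau> * real (n div j)) / real n * exp (- s * real n)"
      using l by (simp add: exp_add[symmetric] mult.assoc) (simp add: algebra_simps)
  qed
  show "(\<lambda>n. \<Sum>j | j \<in> {1..n} \<and> j dvd n. ?f j (n div j)) sums logZ (dsum q \<tau>) s"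
    unfolding eq by (rule logZ_sums[OF dsum[OF assms(2,3)]]) (use c d assms in auto)
qed simp

lemma mom0_has_sum:
  assumes "s > 0"
  shows "((\<lambda>j. real j * real (q j) * psi (s * real j)) has_sum mom (dsum q 0) 0 s) {1..}"
proof (rule divisor_has_sum)
  let ?f = "\<lambda>j l. real j * real (q j) * exp (- (s * real j) * real l)"
  show "(?f j has_sum real j * real (q j) * psi (s * real j)) {1..}" if "j \<ge> 1" for j
    by (intro has_sum_cmult_right psi_has_sum) (use assms that in auto)
  have eq: "(\<Sum>j | j \<in> {1..n} \<and> j dvd n. ?f j (n div j)) = real n ^ 0 * dsum q 0 n * exp (- s * real n)" for n
    unfolding dsum_def sum_distrib_right sum_distrib_left
    by (rule sum.cong[OF refl]) (auto simp: mult.assoc)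
  show "(\<lambda>n. \<Sum>j | j \<in> {1..n} \<and> j dvd n. ?f j (n div j)) sums mom (dsum q 0) 0 s"
    unfolding eq using c d assms by (intro mom_sums[OF dsum]) auto
qed simp

text \<open>The root in the theorem is the saddle point for M at \<tau> = 0, so its existence and
  uniqueness come from \<open>mom0_root\<close>.\<close>

lemma b_root:
  assumes "M > 0"
  shows "b_root q M > 0" "mom (dsum q 0) 0 (b_root q M) = real M"
proof -
  have eq: "(\<lambda>j. real j * real (q j) / (exp (b * real j) - 1)) = (\<lambda>j. real j * real (q j) * psi (b * real j))" for b
    by (simp add: psi_def)
  have iff: "b > 0 \<and> ((\<lambda>j. real j * real (q j) / (exp (b * real j) - 1)) has_sum real M) {1..} \<longleftrightarrow>
      b > 0 \<and> mom (dsum q 0) 0 b = real M" for b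
    unfolding eq using mom0_has_sum has_sum_unique by metis
  have "\<exists>!b. b > 0 \<and> mom (dsum q 0) 0 b = real M"
    by (rule mom0_root[OF dsum]) (use c C d assms in auto)
  then have "b_root q M > 0 \<and> mom (dsum q 0) 0 (b_root q M) = real M"
    unfolding b_root_def iff by (rule theI')
  then show "b_root q M > 0" "mom (dsum q 0) 0 (b_root q M) = real M" by auto
qed

lemma Nbar_has_sum:
  assumes "M > 0"
  shows "((\<lambda>j. real (q j) * psi (b_root q M * real j)) has_sum Nbar q M) {1..}"
proof -
  let ?b = "b_root q M"
  have eq: "(\<lambda>j. real (q j) / (exp (?b * real j) - 1)) = (\<lambda>j. real (q j) * psi (?b * real j))"
    by (simp add: psi_def)
  have "(\<lambda>j. real (q j) * psi (?b * real j)) summable_on {1..}"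
  proof (rule summable_on_comparison_test)
    show "(\<lambda>j. real j * real (q j) * psi (?b * real j)) summable_on {1..}"
      using mom0_has_sum[OF b_root(1)[OF assms]] by (auto simp: summable_on_def)
    fix j :: nat assume j: "j \<in> {1..}"
    then have p: "psi (?b * real j) > 0" using b_root[OF assms] by (intro psi_pos) auto
    then show "0 \<le> real (q j) * psi (?b * real j)" by simp
    have "1 * (real (q j) * psi (?b * real j)) \<le> real j * (real (q j) * psi (?b * real j))"
      using j p by (intro mult_right_mono) auto
    then show "real (q j) * psi (?b * real j) \<le> real j * real (q j) * psi (?b * real j)" by (simp add: mult.assoc)
  qed
  then show ?thesis unfolding Nbar_def eq by (rule has_sum_infsum)
qed

text \<open>The terms linear in the displacement add up to multiples of M and of Nbar, which are the
  sums of j q_j \<open>psi\<close> and of q_j \<open>psi\<close> at the root.\<close>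

lemma breg_has_sum:
  assumes "M > 0" "s > 0" "0 \<le> \<tau>" "\<tau> \<le> 2"
  shows "((\<lambda>j. real (q j) * breg (b_root q M * real j) ((s - b_root q M) * real j + \<tau>)) has_sum
    (logZ (dsum q \<tau>) s - logZ (dsum q 0) (b_root q M) + (s - b_root q M) * real M + \<tau> * Nbar q M)) {1..}"
proof -
  let ?b = "b_root q M"
  note b = b_root[OF assms(1)]
  have "((\<lambda>j. real (q j) * phi (s * real j + \<tau>) + (-1) * (real (q j) * phi (?b * real j + 0))
       + (s - ?b) * (real j * real (q j) * psi (?b * real j)) + \<tau> * (real (q j) * psi (?b * real j))) has_sum
    (logZ (dsum q \<tau>) s + (-1) * logZ (dsum q 0) ?b + (s - ?b) * mom (dsum q 0) 0 ?b + \<tau> * Nbar q M)) {1..}"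
    using assms b by (intro has_sum_add has_sum_cmult_right logZ_has_sum mom0_has_sum Nbar_has_sum) auto
  moreover have "real (q j) * phi (s * real j + \<tau>) + (-1) * (real (q j) * phi (?b * real j + 0))
       + (s - ?b) * (real j * real (q j) * psi (?b * real j)) + \<tau> * (real (q j) * psi (?b * real j))
    = real (q j) * breg (?b * real j) ((s - ?b) * real j + \<tau>)" for j
  proof -
    have "?b * real j + ((s - ?b) * real j + \<tau>) = s * real j + \<tau>" by (simp add: algebra_simps)
    then show ?thesis by (simp add: breg_def algebra_simps)
  qed
  ultimately show ?thesis using b by simp
qed

end

section \<open>Estimates at the saddle point\<close>


lemma nat_sums_imp_has_sum:
  fixes f :: "nat \<Rightarrow> real"
  assumes "summable f" "\<And>n. f n \<ge> 0" "f 0 = 0"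
  shows "(f has_sum suminf f) {1..}"
  by (rule iffD1[OF has_sum_cong_neutral, OF _ _ _ sums_nonneg_imp_has_sum[OF summable_sums[OF assms(1)] assms(2)]])
    (use assms(3) in \<open>auto simp: not_le\<close>)

lemma psi_ge_exp: "y > 0 \<Longrightarrow> exp (- y) \<le> psi y"
  unfolding psi_def exp_minus inverse_eq_divide by (intro divide_left_mono) auto

lemma phi_pos: "y > 0 \<Longrightarrow> phi y > 0"
  unfolding phi_def by (simp add: ln_less_zero_iff)

lemma breg_abs_le:
  assumes "\<bar>h\<bar> \<le> x / 2" "x > 0"
  shows "breg x h \<le> rho (x / 2) * h\<^sup>2 / 2"
proof (cases "h \<ge> 0")
  case True
  have "breg x h \<le> rho x * h\<^sup>2 / 2" using breg_le assms True by auto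
  also have "\<dots> \<le> rho (x / 2) * h\<^sup>2 / 2"
    using rho_antimono[of "x / 2" x] assms by (intro divide_right_mono mult_right_mono) auto
  finally show ?thesis .
next
  case False
  then show ?thesis using breg_neg_le[of "- h" x] assms by simp
qed

context qseq
begin

abbreviation "b \<equiv> b_root q"

text \<open>The saddle point functional at (s, \<open>\<tau>\<close>) minus its value at (b M, 0), where its gradient vanishes.
  Therefore it is a sum of Bregman divergences, see \<open>Dtot_has_sum\<close>.\<close>

definition Dtot :: "nat \<Rightarrow> real \<Rightarrow> real \<Rightarrow> real" where
  "Dtot M s \<tau> = logZ (dsum q \<tau>) s - logZ (dsum q 0) (b M) + (s - b M) * real M + \<tau> * Nbar q M"

text \<open>The levels to which \<open>breg_4_ge\<close> and \<open>breg_ge\<close> apply.\<close>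

definition J :: "nat \<Rightarrow> nat set" where
  "J M = {j. 1 \<le> j \<and> b M * real j \<le> 1}"

text \<open>A yardstick for the effect of the tilt: \<open>Dtot_le\<close> and
  \<open>Dtot_ge\<close> compare the full divergence with it. Its order as a function of \<tau>
  differs for d below and above 2; keeping the sum itself avoids the distinction.\<close>

definition D1 :: "nat \<Rightarrow> real \<Rightarrow> real" where
  "D1 M \<tau> = (\<Sum>j\<in>J M. real (q j) * breg (b M * real j) \<tau>)"

lemma finite_J: "M > 0 \<Longrightarrow> finite (J M)"
proof -
  assume "M > 0"
  then have b: "b M > 0" by (rule b_root)
  have "J M \<subseteq> {..nat \<lfloor>1 / b M\<rfloor>}"
    unfolding J_def using b by (auto simp: le_nat_iff le_floor_iff field_simps)
  then show ?thesis using finite_subset by blast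
qed

lemma M_bounds: "\<exists>l>0. \<exists>U>0. \<forall>M>0. real M \<le> U * b M powr (- d - 1) \<and> (b M \<le> 1 \<longrightarrow> l * b M powr (- d - 1) \<le> real M)"
proof -
  obtain l U where lU: "l > 0" "U > 0"
    "\<And>\<sigma> s. pgrowth c C d \<sigma> \<Longrightarrow> s > 0 \<Longrightarrow> mom \<sigma> 0 s \<le> U * s powr (- d - 1)"
    "\<And>\<sigma> s. pgrowth c C d \<sigma> \<Longrightarrow> s > 0 \<Longrightarrow> s \<le> 1 \<Longrightarrow> l * s powr (- d - 1) \<le> mom \<sigma> 0 s"
    using mom_bounds[of d c C 0] d c C by auto
  have p: "pgrowth c C d (dsum q 0)" by (rule dsum) auto
  have "real M \<le> U * b M powr (- d - 1)" "b M \<le> 1 \<Longrightarrow> l * b M powr (- d - 1) \<le> real M" if "M > 0" for M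
    using lU(3,4)[OF p b_root(1)[OF that]] unfolding b_root(2)[OF that] by auto
  then show ?thesis using lU(1,2) by blast
qed

lemma b_small:
  assumes "\<epsilon> > 0"
  shows "eventually (\<lambda>M. b M \<le> \<epsilon>) sequentially"
proof -
  obtain U where U: "U > 0" "\<And>M. M > 0 \<Longrightarrow> real M \<le> U * b M powr (- d - 1)"
    using M_bounds by auto
  show ?thesis
  proof (rule eventually_sequentiallyI)
    fix M assume M: "nat \<lceil>U * \<epsilon> powr (- d - 1)\<rceil> + 1 \<le> M"
    then have M0: "M > 0" by simp
    show "b M \<le> \<epsilon>"
    proof (rule ccontr)
      assume "\<not> b M \<le> \<epsilon>"
      then have "b M powr (- d - 1) \<le> \<epsilon> powr (- d - 1)" using assms d by (intro powr_mono2') auto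
      then have "real M \<le> U * \<epsilon> powr (- d - 1)" using U(2)[OF M0] U(1) by (smt (verit) mult_left_mono)
      then show False using M by linarith
    qed
  qed
qed

lemma Nbar_ge: "\<exists>l>0. \<forall>M>0. b M \<le> 1 \<longrightarrow> l * b M powr (- d) \<le> Nbar q M"
proof -
  obtain K where K: "\<And>u. u > 0 \<Longrightarrow> summable (\<lambda>n. real n powr (d - 1) * exp (- u * real n))"
    using powr_exp_sum[of "d - 1"] d by auto
  define l where "l = c1 * (exp (- 2) / 2 powr (d - 1))"
  have "l * b M powr (- d) \<le> Nbar q M" if M: "M > 0" "b M \<le> 1" for M
  proof -
    have b: "b M > 0" using b_root M by simp
    have "l * b M powr (- d) = c1 * (exp (- 2) / 2 powr (d - 1) * b M powr (- (d - 1) - 1))"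
      by (simp add: l_def)
    also have "\<dots> \<le> c1 * (\<Sum>n. real n powr (d - 1) * exp (- b M * real n))"
      using c1 d M b K by (intro mult_left_mono powr_exp_sum_ge) auto
    also have "\<dots> \<le> Nbar q M"
    proof (rule has_sum_mono[OF has_sum_cmult_right[OF nat_sums_imp_has_sum] Nbar_has_sum[OF M(1)]])
      show "summable (\<lambda>n. real n powr (d - 1) * exp (- b M * real n))" by (rule K[OF b])
      fix j :: nat assume j: "j \<in> {1..}"
      have "c1 * real j powr (d - 1) * exp (- (b M * real j)) \<le> real (q j) * psi (b M * real j)"
        using q_ge[of j] j b psi_ge_exp[of "b M * real j"] by (intro mult_mono) auto
      then show "c1 * (real j powr (d - 1) * exp (- b M * real j)) \<le> real (q j) * psi (b M * real j)" by simp
    qed auto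
    finally show ?thesis .
  qed
  moreover have "l > 0" using c1 by (simp add: l_def)
  ultimately show ?thesis by blast
qed

lemma D1_ge: "\<exists>k>0. \<forall>M>0. b M \<le> 1 \<longrightarrow> (\<forall>\<tau>. 0 \<le> \<tau> \<longrightarrow> \<tau> \<le> 1 \<longrightarrow> k * \<tau>\<^sup>2 * b M powr (- d) \<le> D1 M \<tau>)"
proof -
  define k where "k = c1 * 4 powr (- d) * (rho 2 / 2)"
  have k: "k > 0" using c1 rho_pos[of 2] by (simp add: k_def)
  have "k * \<tau>\<^sup>2 * b M powr (- d) \<le> D1 M \<tau>" if M: "M > 0" "b M \<le> 1" and \<tau>: "0 \<le> \<tau>" "\<tau> \<le> 1" for M \<tau>
  proof -
    define B where "B = b M"
    have B: "B > 0" "B \<le> 1" using b_root M by (auto simp: B_def)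
    define N where "N = nat \<lfloor>1 / B\<rfloor>"
    have iB: "1 / B \<ge> 1" using B by simp
    have N: "real N \<le> 1 / B" "1 / B < real N + 1" "N \<ge> 1"
      unfolding N_def using iB floor_correct[of "1 / B"] by linarith+
    then have "2 * real N \<ge> 1 / B" by linarith
    then have N2: "real N / 2 \<ge> 1 / (4 * B)" by simp
    \<comment> \<open>The upper half of the levels in \<open>J M\<close>: at least 1 / (4 B) of
      them, each with j >= 1 / (4 B).\<close>
    define A where "A = {N - N div 2..N}"
    have AJ: "A \<subseteq> J M"
    proof
      fix j assume j: "j \<in> A"
      then have "j \<ge> 1" using N(3) by (auto simp: A_def)
      moreover have "B * real j \<le> B * real N" using j B by (intro mult_left_mono) (auto simp: A_def)
      moreover have "B * real N \<le> 1" using N(1) B by (simp add: field_simps)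
      ultimately show "j \<in> J M" by (auto simp: J_def B_def)
    qed
    have Aj: "real j \<ge> 1 / (4 * B)" "j \<ge> 1" if "j \<in> A" for j
    proof -
      have "2 * j \<ge> N" using that by (auto simp: A_def)
      then have "real j \<ge> real N / 2" by linarith
      then show "real j \<ge> 1 / (4 * B)" using N2 by simp
      show "j \<ge> 1" using that N(3) by (auto simp: A_def)
    qed
    have cA: "real (card A) \<ge> 1 / (4 * B)"
    proof -
      have "card A = N div 2 + 1" by (auto simp: A_def)
      then have "2 * card A \<ge> N" by linarith
      then have "real (card A) \<ge> real N / 2" by linarith
      then show ?thesis using N2 by simp
    qed
    have "k * \<tau>\<^sup>2 * B powr (- d) = (1 / (4 * B)) * (c1 * (1 / (4 * B)) powr (d - 1) * (rho 2 * \<tau>\<^sup>2 / 2))"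
    proof -
      have "(1 / (4 * B)) * (1 / (4 * B)) powr (d - 1) = (1 / (4 * B)) powr d"
        using B by (simp add: powr_diff)
      also have "\<dots> = 4 powr (- d) * B powr (- d)"
        using B by (simp add: powr_divide powr_mult powr_minus field_simps)
      finally have X: "(1 / (4 * B)) * (1 / (4 * B)) powr (d - 1) = 4 powr (- d) * B powr (- d)" .
      have "(1 / (4 * B)) * (c1 * (1 / (4 * B)) powr (d - 1) * (rho 2 * \<tau>\<^sup>2 / 2))
        = ((1 / (4 * B)) * (1 / (4 * B)) powr (d - 1)) * (c1 * (rho 2 * \<tau>\<^sup>2 / 2))"
        by (simp only: mult_ac)
      then show ?thesis unfolding X by (simp add: k_def)
    qed
    also have "\<dots> \<le> real (card A) * (c1 * (1 / (4 * B)) powr (d - 1) * (rho 2 * \<tau>\<^sup>2 / 2))"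
      using cA c1 rho_pos[of 2] by (intro mult_right_mono) auto
    also have "\<dots> = (\<Sum>j\<in>A. c1 * (1 / (4 * B)) powr (d - 1) * (rho 2 * \<tau>\<^sup>2 / 2))" by simp
    also have "\<dots> \<le> (\<Sum>j\<in>A. real (q j) * breg (b M * real j) \<tau>)"
    proof (intro sum_mono mult_mono)
      fix j assume j: "j \<in> A"
      have "c1 * (1 / (4 * B)) powr (d - 1) \<le> c1 * real j powr (d - 1)"
        using Aj[OF j] B d c1 by (intro mult_left_mono powr_mono2) auto
      then show "c1 * (1 / (4 * B)) powr (d - 1) \<le> real (q j)" using q_ge[OF Aj(2)[OF j]] by linarith
      show "rho 2 * \<tau>\<^sup>2 / 2 \<le> breg (b M * real j) \<tau>"
        using j AJ \<tau> B Aj(2)[OF j] by (intro breg_ge) (auto simp: J_def B_def)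
    qed (use rho_pos[of 2] in auto)
    also have "\<dots> \<le> D1 M \<tau>" unfolding D1_def
      using finite_J[OF M(1)] AJ B \<tau> by (intro sum_mono2 mult_nonneg_nonneg breg_nonneg) (auto simp: J_def B_def add_pos_nonneg)
    finally show ?thesis by (simp add: B_def)
  qed
  then show ?thesis using k by blast
qed

lemma Dtot_has_sum:
  assumes "M > 0" "s > 0" "0 \<le> \<tau>" "\<tau> \<le> 2"
  shows "((\<lambda>j. real (q j) * breg (b M * real j) ((s - b M) * real j + \<tau>)) has_sum Dtot M s \<tau>) {1..}"
  unfolding Dtot_def by (rule breg_has_sum[OF assms])

text \<open>At s = b M every level is displaced by 2 \<tau>. On \<open>J M\<close> the doubling
  costs a factor 4; the other levels contribute at most a multiple of \<tau>^2 b^(- d), which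
  \<open>D1_ge\<close> absorbs.\<close>

lemma Dtot_le: "\<exists>K>0. \<forall>M>0. b M \<le> 1 \<longrightarrow> (\<forall>\<tau>. 0 \<le> \<tau> \<longrightarrow> \<tau> \<le> 1 \<longrightarrow> Dtot M (b M) (2 * \<tau>) \<le> K * D1 M \<tau>)"
proof -
  obtain k where k: "k > 0" "\<And>M \<tau>. M > 0 \<Longrightarrow> b M \<le> 1 \<Longrightarrow> 0 \<le> \<tau> \<Longrightarrow> \<tau> \<le> 1 \<Longrightarrow> k * \<tau>\<^sup>2 * b M powr (- d) \<le> D1 M \<tau>"
    using D1_ge by blast
  obtain P where P: "P > 0" "\<And>u. u > 0 \<Longrightarrow> summable (\<lambda>n. real n powr (d - 1) * exp (- u * real n))"
    "\<And>u. u > 0 \<Longrightarrow> (\<Sum>n. real n powr (d - 1) * exp (- u * real n)) \<le> P * u powr (- d)"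
    using powr_exp_sum[of "d - 1"] d by auto
  define K where "K = 4 + 32 * C1 * (P * 2 powr d / k)"
  have "Dtot M (b M) (2 * \<tau>) \<le> K * D1 M \<tau>" if M: "M > 0" "b M \<le> 1" and \<tau>: "0 \<le> \<tau>" "\<tau> \<le> 1" for M \<tau>
  proof -
    define B where "B = b M"
    have B: "B > 0" "B \<le> 1" using b_root M by (auto simp: B_def)
    let ?S = "\<Sum>n. real n powr (d - 1) * exp (- (B / 2) * real n)"
    have "Dtot M B (2 * \<tau>) \<le> 4 * D1 M \<tau> + 32 * C1 * \<tau>\<^sup>2 * ?S"
    proof (rule has_sum_mono)
      show "((\<lambda>j. real (q j) * breg (B * real j) ((B - B) * real j + 2 * \<tau>)) has_sum Dtot M B (2 * \<tau>)) {1..}"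
        using Dtot_has_sum[of M B "2 * \<tau>"] M B \<tau> by (simp add: B_def)
      have "((\<lambda>j. if j \<in> J M then real (q j) * breg (B * real j) \<tau> else 0) has_sum D1 M \<tau>) {1..}"
      proof -
        have "((\<lambda>j. real (q j) * breg (B * real j) \<tau>) has_sum D1 M \<tau>) (J M)"
          unfolding D1_def B_def by (rule has_sum_finite[OF finite_J[OF M(1)]])
        then show ?thesis
          by (rule iffD1[OF has_sum_cong_neutral, rotated 3]) (auto simp: J_def)
      qed
      then show "((\<lambda>j. 4 * (if j \<in> J M then real (q j) * breg (B * real j) \<tau> else 0)
          + 32 * C1 * \<tau>\<^sup>2 * (real j powr (d - 1) * exp (- (B / 2) * real j))) has_sum
          (4 * D1 M \<tau> + 32 * C1 * \<tau>\<^sup>2 * ?S)) {1..}"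
        using B by (intro has_sum_add has_sum_cmult_right nat_sums_imp_has_sum P) auto
      fix j :: nat assume j: "j \<in> {1..}"
      then have Bj: "B * real j > 0" using B by simp
      show "real (q j) * breg (B * real j) ((B - B) * real j + 2 * \<tau>) \<le>
          4 * (if j \<in> J M then real (q j) * breg (B * real j) \<tau> else 0)
          + 32 * C1 * \<tau>\<^sup>2 * (real j powr (d - 1) * exp (- (B / 2) * real j))"
      proof (cases "j \<in> J M")
        case True
        have "real (q j) * breg (B * real j) (2 * \<tau>) \<le> real (q j) * (4 * breg (B * real j) \<tau>)"
          using Bj \<tau> by (intro mult_left_mono breg_double) auto
        moreover have "0 \<le> 32 * C1 * \<tau>\<^sup>2 * (real j powr (d - 1) * exp (- (B / 2) * real j))" using C1 by simp
        ultimately show ?thesis using True by simp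
      next
        case False
        then have Bj1: "B * real j > 1" using j by (auto simp: J_def B_def)
        have "breg (B * real j) (2 * \<tau>) \<le> rho (B * real j) * (2 * \<tau>)\<^sup>2 / 2"
          using Bj \<tau> by (intro breg_le) auto
        also have "\<dots> \<le> (16 * exp (- (B * real j) / 2) / (B * real j)\<^sup>2) * (2 * \<tau>)\<^sup>2 / 2"
          using Bj by (intro divide_right_mono mult_right_mono rho_le) auto
        also have "\<dots> \<le> (16 * exp (- (B * real j) / 2) / 1) * (2 * \<tau>)\<^sup>2 / 2"
          using Bj1 Bj by (intro divide_right_mono mult_right_mono divide_left_mono) (auto simp: one_le_power zero_less_mult_iff)
        also have "\<dots> = 32 * \<tau>\<^sup>2 * exp (- (B / 2) * real j)" by (simp add: power_mult_distrib)
        finally have "real (q j) * breg (B * real j) (2 * \<tau>) \<le> (C1 * real j powr (d - 1)) * (32 * \<tau>\<^sup>2 * exp (- (B / 2) * real j))"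
          using q_le[of j] j C1 by (intro mult_mono' breg_nonneg) (use Bj \<tau> in auto)
        then show ?thesis using False by (simp add: mult_ac)
      qed
    qed
    also have "\<dots> \<le> 4 * D1 M \<tau> + 32 * C1 * \<tau>\<^sup>2 * (P * (B / 2) powr (- d))"
      using B C1 by (intro add_left_mono mult_left_mono P) auto
    also have "(B / 2) powr (- d) = 2 powr d * B powr (- d)"
      using B by (simp add: powr_divide powr_minus field_simps)
    also have "4 * D1 M \<tau> + 32 * C1 * \<tau>\<^sup>2 * (P * (2 powr d * B powr (- d))) =
        4 * D1 M \<tau> + 32 * C1 * (P * 2 powr d / k) * (k * \<tau>\<^sup>2 * B powr (- d))"
      using k(1) by (simp add: field_simps)
    also have "\<dots> \<le> 4 * D1 M \<tau> + 32 * C1 * (P * 2 powr d / k) * D1 M \<tau>"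
      using k M \<tau> C1 P(1) unfolding B_def by (intro add_left_mono mult_left_mono) auto
    also have "\<dots> = K * D1 M \<tau>" by (simp add: K_def algebra_simps)
    finally show ?thesis by (simp add: B_def)
  qed
  moreover have "K > 0" using C1 P(1) k(1) by (simp add: K_def add_pos_nonneg)
  ultimately show ?thesis by blast
qed

text \<open>The bound is uniform in s because s < b M cannot compensate \<open>\<tau>\<close> on level j and on level 4 j at the
  same time: one of the two shifts is at least \<open>\<tau> / 2\<close> or at most \<open>- \<tau>\<close>.\<close>

lemma Dtot_ge: "\<exists>k>0. \<forall>M>0. \<forall>s>0. \<forall>\<tau>. 0 \<le> \<tau> \<longrightarrow> \<tau> \<le> 1 \<longrightarrow> k * D1 M \<tau> \<le> Dtot M s \<tau>"
proof -
  \<comment> \<open>The entry 1 / 4 is the price of halving \<tau> on level j. The other one is that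
    of passing to level 4 j, both in \<open>q\<close> and in the divergence.\<close>
  define k' where "k' = min (1 / 4) (c1 / C1 * (exp (- 10) / 16))"
  have k': "k' > 0" "k' \<le> 1 / 4" "k' \<le> c1 / C1 * (exp (- 10) / 16)" using c1 C1 by (auto simp: k'_def)
  have "k' / 2 * D1 M \<tau> \<le> Dtot M s \<tau>" if M: "M > 0" and s: "s > 0" and \<tau>: "0 \<le> \<tau>" "\<tau> \<le> 1" for M s \<tau>
  proof -
    define B where "B = b M"
    have B: "B > 0" using b_root M by (auto simp: B_def)
    define t where "t = (\<lambda>j. real (q j) * breg (B * real j) ((s - B) * real j + \<tau>))"
    have ts: "(t has_sum Dtot M s \<tau>) {1..}"
      using Dtot_has_sum[OF M s] \<tau> by (simp add: B_def t_def)
    have t0: "t j \<ge> 0" if "j \<ge> 1" for j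
    proof -
      have "B * real j + ((s - B) * real j + \<tau>) = s * real j + \<tau>" by (simp add: algebra_simps)
      moreover have "0 < s * real j + \<tau>" using that s \<tau> by (intro add_pos_nonneg) auto
      ultimately have "breg (B * real j) ((s - B) * real j + \<tau>) \<ge> 0"
        using that B by (intro breg_nonneg) auto
      then show ?thesis unfolding t_def by simp
    qed
    have Jb: "j \<ge> 1" "B * real j > 0" "B * real j \<le> 1" if "j \<in> J M" for j
      using that B by (auto simp: J_def B_def)
    have fJ: "finite (J M)" by (rule finite_J[OF M])
    have le1: "sum t (J M) \<le> Dtot M s \<tau>"
      by (rule finite_sum_le_has_sum[OF ts fJ]) (use Jb t0 in auto)
    have le4: "(\<Sum>j\<in>J M. t (4 * j)) \<le> Dtot M s \<tau>"
    proof -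
      have "(\<Sum>j\<in>J M. t (4 * j)) = sum t ((\<lambda>j. 4 * j) ` J M)"
        by (subst sum.reindex) (auto simp: inj_on_def)
      also have "\<dots> \<le> Dtot M s \<tau>"
        by (rule finite_sum_le_has_sum[OF ts]) (use fJ Jb t0 in force)+
      finally show ?thesis .
    qed
    have main: "k' * (real (q j) * breg (B * real j) \<tau>) \<le> t j + t (4 * j)" if j: "j \<in> J M" for j
    proof -
      have g0: "0 \<le> real (q j) * breg (B * real j) \<tau>"
        using Jb[OF j] \<tau> by (intro mult_nonneg_nonneg breg_nonneg) auto
      have t4: "t (4 * j) \<ge> 0" "t j \<ge> 0" using t0 Jb[OF j] by auto
      consider "(B - s) * real j \<le> \<tau> / 2" | "(B - s) * real j > \<tau> / 2" by linarith
      then show ?thesis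
      proof cases
        case 1
        have "k' * (real (q j) * breg (B * real j) \<tau>) \<le> 1 / 4 * (real (q j) * breg (B * real j) (2 * (\<tau> / 2)))"
          using mult_right_mono[OF k'(2) g0] by simp
        also have "\<dots> \<le> 1 / 4 * (real (q j) * (4 * breg (B * real j) (\<tau> / 2)))"
          using Jb[OF j] \<tau> by (intro mult_left_mono breg_double) auto
        also have "\<dots> = real (q j) * breg (B * real j) (\<tau> / 2)" by simp
        also have "\<dots> \<le> t j"
        proof -
          have "\<tau> / 2 \<le> (s - B) * real j + \<tau>" using 1 by (simp add: algebra_simps)
          then show ?thesis unfolding t_def using Jb[OF j] \<tau> by (intro mult_left_mono breg_mono) auto
        qed
        finally show ?thesis using t4 by linarith
      next
        case 2
        define h where "h = 4 * ((B - s) * real j) - \<tau>"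
        have h\<tau>: "h \<ge> \<tau>" unfolding h_def using 2 by linarith
        have h: "h < 4 * (B * real j)"
        proof -
          have "0 < s * real j" using s Jb[OF j] by simp
          then show ?thesis unfolding h_def using \<tau> by (simp add: left_diff_distrib)
        qed
        have tj: "t (4 * j) = real (q (4 * j)) * breg (4 * (B * real j)) (- h)"
          unfolding t_def h_def by (simp add: algebra_simps)
        have c4: "c1 / C1 * real (q j) \<le> real (q (4 * j))"
        proof -
          have "c1 / C1 * real (q j) \<le> c1 / C1 * (C1 * real j powr (d - 1))"
            using c1 C1 Jb[OF j] by (intro mult_left_mono q_le) auto
          also have "\<dots> = c1 * real j powr (d - 1)" using C1 by simp
          also have "\<dots> \<le> c1 * real (4 * j) powr (d - 1)"
            using c1 d by (intro mult_left_mono powr_mono2) auto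
          also have "\<dots> \<le> real (q (4 * j))" using Jb[OF j] by (intro q_ge) auto
          finally show ?thesis .
        qed
        have "k' * (real (q j) * breg (B * real j) \<tau>) \<le> c1 / C1 * (exp (- 10) / 16) * (real (q j) * breg (B * real j) \<tau>)"
          using k' g0 by (intro mult_right_mono) auto
        also have "\<dots> = (c1 / C1 * real (q j)) * (exp (- 10) / 16 * breg (B * real j) \<tau>)" by simp
        also have "\<dots> \<le> real (q (4 * j)) * breg (4 * (B * real j)) \<tau>"
          using Jb[OF j] \<tau> c4 by (intro mult_mono breg_4_ge mult_nonneg_nonneg breg_nonneg) auto
        also have "\<dots> \<le> real (q (4 * j)) * breg (4 * (B * real j)) h"
          using Jb[OF j] \<tau> h\<tau> by (intro mult_left_mono breg_mono) auto
        also have "\<dots> \<le> real (q (4 * j)) * breg (4 * (B * real j)) (- h)"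
          using h h\<tau> \<tau> by (intro mult_left_mono breg_neg_ge) auto
        finally show ?thesis using tj t4 by linarith
      qed
    qed
    have "k' * D1 M \<tau> \<le> (\<Sum>j\<in>J M. t j + t (4 * j))"
      unfolding D1_def sum_distrib_left B_def[symmetric] by (rule sum_mono[OF main])
    \<comment> \<open>The sets of levels j and 4 j may overlap, so each sum is bounded by the total
      separately; hence the factor 2.\<close>
    also have "\<dots> \<le> 2 * Dtot M s \<tau>" using le1 le4 by (simp add: sum.distrib)
    finally show ?thesis by simp
  qed
  then show ?thesis using k' by (intro exI[of _ "k' / 2"]) auto
qed

text \<open>The order of an upper bound for the variance of the particle number at the root; its two
  regimes correspond to those of \<open>Delta\<close>.\<close>

definition Rfun :: "real \<Rightarrow> real" where
  "Rfun x = (if d > 2 then x powr (- d) else x powr (- 2) * (1 + ln (1 / x)))"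

text \<open>The argument b j / 2 leaves room for displacements up to half the distance to the
  singularity of \<open>phi\<close>. By \<open>rho_le\<close> the terms are at most of order b^(-2)
  j^(d - 3) with an exponential cutoff near 1 / b; for d <= 2 they are compared with the logarithmic
  series of \<open>phi\<close>.\<close>

lemma rho_sum: "\<exists>K>0. \<forall>M>0. b M \<le> 1 \<longrightarrow>
  (\<exists>R. ((\<lambda>j. real (q j) * rho (b M * real j / 2)) has_sum R) {1..} \<and> R \<le> K * Rfun (b M))"
proof -
  have term_le: "real (q j) * rho (B * real j / 2) \<le> 64 * C1 * B powr (- 2) * (real j powr (d - 3) * exp (- (B / 4) * real j))"
    if "j \<ge> 1" "B > 0" for j B
  proof -
    have "real (q j) * rho (B * real j / 2) \<le> (C1 * real j powr (d - 1)) * (16 * exp (- (B * real j / 2) / 2) / (B * real j / 2)\<^sup>2)"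
      using that C1 rho_pos[of "B * real j / 2"] by (intro mult_mono q_le rho_le) auto
    also have "\<dots> = 64 * C1 * B powr (- 2) * (real j powr (d - 3) * exp (- (B / 4) * real j))"
    proof -
      have "real j powr (d - 3) = real j powr (d - 1) / real j ^ 2"
        using that by (simp add: powr_diff power2_eq_square power3_eq_cube)
      moreover have "B powr (- 2) = 1 / B ^ 2" using that by (simp add: powr_minus inverse_eq_divide)
      ultimately show ?thesis by (simp add: power_mult_distrib power_divide)
    qed
    finally show ?thesis .
  qed
  have rho_nn: "0 \<le> real (q j) * rho (B * real j / 2)" if "j \<ge> 1" "B > 0" for j B
    using that by (intro mult_nonneg_nonneg less_imp_le[OF rho_pos]) auto
  have gen: "\<exists>R. ((\<lambda>j. real (q j) * rho (B * real j / 2)) has_sum R) {1..} \<and> R \<le> 64 * C1 * B powr (- 2) * T"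
    if B: "B > 0" and g: "(g has_sum T) {1..}"
      and le: "\<And>j. j \<ge> 1 \<Longrightarrow> real j powr (d - 3) * exp (- (B / 4) * real j) \<le> g j" for B g T
  proof -
    have G: "((\<lambda>j. 64 * C1 * B powr (- 2) * g j) has_sum (64 * C1 * B powr (- 2) * T)) {1..}"
      by (rule has_sum_cmult_right[OF g])
    have le': "real (q j) * rho (B * real j / 2) \<le> 64 * C1 * B powr (- 2) * g j" if "j \<ge> 1" for j
      by (rule order_trans[OF term_le[OF that B] mult_left_mono[OF le[OF that]]]) (use C1 in simp)
    have "(\<lambda>j. real (q j) * rho (B * real j / 2)) summable_on {1..}"
      by (rule summable_on_comparison_test[OF has_sum_imp_summable[OF G]]) (use le' rho_nn B in auto)
    then have H: "((\<lambda>j. real (q j) * rho (B * real j / 2)) has_sum infsum (\<lambda>j. real (q j) * rho (B * real j / 2)) {1..}) {1..}"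
      by (rule has_sum_infsum)
    have "infsum (\<lambda>j. real (q j) * rho (B * real j / 2)) {1..} \<le> 64 * C1 * B powr (- 2) * T"
      by (rule has_sum_mono[OF H G]) (use le' in auto)
    then show ?thesis using H by blast
  qed
  show ?thesis
  proof (cases "d > 2")
    case True
    obtain P where P: "P > 0" "\<And>u. u > 0 \<Longrightarrow> summable (\<lambda>n. real n powr (d - 3) * exp (- u * real n))"
      "\<And>u. u > 0 \<Longrightarrow> (\<Sum>n. real n powr (d - 3) * exp (- u * real n)) \<le> P * u powr (- (d - 3) - 1)"
      using powr_exp_sum[of "d - 3"] True by auto
    define K where "K = 64 * C1 * (P * 4 powr (d - 2))"
    have "\<exists>R. ((\<lambda>j. real (q j) * rho (b M * real j / 2)) has_sum R) {1..} \<and> R \<le> K * Rfun (b M)" if M: "M > 0" for M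
    proof -
      define B where "B = b M"
      have B: "B > 0" using b_root M by (simp add: B_def)
      obtain R where R: "((\<lambda>j. real (q j) * rho (B * real j / 2)) has_sum R) {1..}"
        "R \<le> 64 * C1 * B powr (- 2) * (\<Sum>n. real n powr (d - 3) * exp (- (B / 4) * real n))"
        using gen[OF B nat_sums_imp_has_sum[OF P(2)[of "B / 4"]]] B by auto
      note R(2)
      also have "64 * C1 * B powr (- 2) * (\<Sum>n. real n powr (d - 3) * exp (- (B / 4) * real n))
          \<le> 64 * C1 * B powr (- 2) * (P * (B / 4) powr (- (d - 3) - 1))"
        using C1 B P(3)[of "B / 4"] by (intro mult_left_mono) auto
      also have "\<dots> = K * Rfun B"
      proof -
        have "(B / 4) powr (- (d - 3) - 1) = B powr (2 - d) * 4 powr (d - 2)"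
          using B powr_minus[of 4 "d - 2"] by (simp add: powr_divide field_simps)
        moreover have "B powr (- 2) * B powr (2 - d) = B powr (- d)"
          by (simp add: powr_add[symmetric])
        ultimately show ?thesis using True by (simp add: K_def Rfun_def)
      qed
      finally show ?thesis using R(1) by (auto simp: B_def)
    qed
    moreover have "K > 0" using C1 P(1) by (simp add: K_def)
    ultimately show ?thesis by blast
  next
    case False
    define K where "K = 64 * C1 * 8"
    have "\<exists>R. ((\<lambda>j. real (q j) * rho (b M * real j / 2)) has_sum R) {1..} \<and> R \<le> K * Rfun (b M)" if M: "M > 0" "b M \<le> 1" for M
    proof -
      define B where "B = b M"
      have B: "B > 0" "B \<le> 1" using b_root M by (auto simp: B_def)
      have ex: "\<exists>R. ((\<lambda>j. real (q j) * rho (B * real j / 2)) has_sum R) {1..} \<and> R \<le> 64 * C1 * B powr (- 2) * phi (B / 4)"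
      proof (rule gen[OF B(1) phi_has_sum])
        fix j :: nat assume j: "j \<ge> 1"
        have "real j powr (d - 3) \<le> real j powr (- 1)" using j False by (intro powr_mono) auto
        also have "\<dots> = 1 / real j" using j by (simp add: powr_minus inverse_eq_divide)
        finally have "real j powr (d - 3) * exp (- (B / 4) * real j) \<le> 1 / real j * exp (- (B / 4) * real j)"
          by (rule mult_right_mono) simp
        then show "real j powr (d - 3) * exp (- (B / 4) * real j) \<le> exp (- (B / 4) * real j) / real j" by simp
      qed (use B in auto)
      have "phi (B / 4) \<le> 8 * (1 + ln (1 / B))"
      proof -
        define u where "u = B / 4"
        have u: "u > 0" "u \<le> 1" using B by (auto simp: u_def)
        have "1 + u \<le> exp u" by (rule exp_ge_add_one_self)
        then have "exp (- u) \<le> 1 / (1 + u)" using u by (simp add: exp_minus field_simps)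
        also have "\<dots> \<le> 1 - u / 2"
        proof -
          have "u * u \<le> 1 * u" using u by (intro mult_right_mono) auto
          then have "1 \<le> (1 - u / 2) * (1 + u)" by (simp add: algebra_simps)
          then show ?thesis using u by (simp add: divide_le_eq)
        qed
        finally have "u / 2 \<le> 1 - exp (- u)" by simp
        then have "ln (u / 2) \<le> ln (1 - exp (- u))" using u by (intro ln_mono) auto
        then have "phi u \<le> - ln (u / 2)" by (simp add: phi_def)
        also have "\<dots> = ln 8 + ln (1 / B)" using B by (simp add: u_def ln_div)
        also have "ln 8 \<le> (8::real) - 1" by (rule ln_le_minus_one) simp
        finally have "phi (B / 4) \<le> 8 - 1 + ln (1 / B)" by (simp add: u_def)
        moreover have "L \<le> 8 * (1 + L) - 7" if "L \<ge> 0" for L :: real using that by simp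
        moreover have "ln (1 / B) \<ge> 0" using B by (intro ln_ge_zero) auto
        ultimately show ?thesis by fastforce
      qed
      then have "64 * C1 * B powr (- 2) * phi (B / 4) \<le> 64 * C1 * B powr (- 2) * (8 * (1 + ln (1 / B)))"
        using C1 by (intro mult_left_mono) auto
      moreover obtain R where R: "((\<lambda>j. real (q j) * rho (B * real j / 2)) has_sum R) {1..}" "R \<le> 64 * C1 * B powr (- 2) * phi (B / 4)"
        using ex by blast
      ultimately have "R \<le> 64 * C1 * B powr (- 2) * (8 * (1 + ln (1 / B)))" by linarith
      moreover have "Rfun B = B powr (- 2) * (1 + ln (1 / B))" using False by (simp add: Rfun_def)
      ultimately have "R \<le> K * Rfun B" unfolding K_def by (simp only: mult_ac)
      then show ?thesis using R(1) by (auto simp: B_def)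
    qed
    moreover have "K > 0" using C1 by (simp add: K_def)
    ultimately show ?thesis by blast
  qed
qed

text \<open>As |h| <= b / 2, every level keeps b j + h >= b j / 2, where the curvature of
  \<open>phi\<close> is at most \<open>rho\<close> at b j / 2. The linear terms add up to the mean
  Nbar.\<close>

lemma chernoff:
  assumes M: "M > 0" and R: "((\<lambda>j. real (q j) * rho (b M * real j / 2)) has_sum R) {1..}"
    and h: "\<bar>h\<bar> \<le> b M / 2" and S: "S \<subseteq> {n \<in> conf. energy n \<le> M}"
  shows "(\<Sum>n\<in>S. real (weight q n) * exp (- b M * real (energy n) - h * real (cnt n)))
    \<le> exp (logZ (dsum q 0) (b M) - h * Nbar q M + R * h\<^sup>2 / 2)"
proof -
  define B where "B = b M"
  have B: "B > 0" using b_root M by (simp add: B_def)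
  have hj: "\<bar>h\<bar> \<le> B * real j / 2" if "j \<ge> 1" for j
  proof -
    have "B * 1 \<le> B * real j" using that B by (intro mult_left_mono) auto
    then show ?thesis using h by (simp add: B_def)
  qed
  have pos: "B * real j + h > 0" if "j \<ge> 1" for j
  proof -
    have "B * real j > 0" using that B by simp
    then show ?thesis using hj[OF that] by linarith
  qed
  define g where "g = (\<lambda>j. (h\<^sup>2 / 2) * (real (q j) * rho (B * real j / 2)) + real (q j) * phi (B * real j + 0)
      + (- h) * (real (q j) * psi (B * real j)))"
  have gs: "(g has_sum ((h\<^sup>2 / 2) * R + logZ (dsum q 0) B + (- h) * Nbar q M)) {1..}"
    unfolding g_def using R M B Nbar_has_sum[OF M]
    by (intro has_sum_add has_sum_cmult_right logZ_has_sum) (auto simp: B_def)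
  have le: "real (q j) * phi (B * real j + h) \<le> g j" if j: "j \<ge> 1" for j
  proof -
    have "breg (B * real j) h \<le> rho (B * real j / 2) * h\<^sup>2 / 2"
      using hj[OF j] B j by (intro breg_abs_le) auto
    then have "phi (B * real j + h) \<le> rho (B * real j / 2) * h\<^sup>2 / 2 + phi (B * real j) - h * psi (B * real j)"
      by (simp add: breg_def)
    then have "real (q j) * phi (B * real j + h) \<le> real (q j) * (rho (B * real j / 2) * h\<^sup>2 / 2 + phi (B * real j) - h * psi (B * real j))"
      by (intro mult_left_mono) auto
    then show ?thesis by (simp add: g_def algebra_simps)
  qed
  have g0: "g j \<ge> 0" if "j \<ge> 1" for j
    using le[OF that] phi_pos[OF pos[OF that]] by (meson less_imp_le mult_nonneg_nonneg of_nat_0_le_iff order_trans)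
  have "(\<Sum>n\<in>S. real (weight q n) * exp (- B * real (energy n) - h * real (cnt n)))
     \<le> exp (\<Sum>j=1..M. real (q j) * phi (B * real j + h))"
    by (rule weight_sum_le[OF qpos S]) (use pos in auto)
  also have "(\<Sum>j=1..M. real (q j) * phi (B * real j + h)) \<le> (\<Sum>j=1..M. g j)"
    by (rule sum_mono) (use le in auto)
  also have "\<dots> \<le> (h\<^sup>2 / 2) * R + logZ (dsum q 0) B + (- h) * Nbar q M"
    by (rule finite_sum_le_has_sum[OF gs]) (use g0 in auto)
  finally show ?thesis by (simp add: B_def algebra_simps)
qed

lemma weight_sum_le_logZ:
  assumes "M > 0" "0 \<le> \<tau>" "\<tau> \<le> 2" and S: "S \<subseteq> {n \<in> conf. energy n \<le> M}"
  shows "(\<Sum>n\<in>S. real (weight q n) * exp (- b M * real (energy n) - \<tau> * real (cnt n)))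
    \<le> exp (logZ (dsum q \<tau>) (b M))"
proof -
  have B: "b M > 0" using b_root assms by simp
  have pos: "b M * real j + \<tau> > 0" if "j \<ge> 1" for j using that B assms by (auto intro: add_pos_nonneg)
  have "(\<Sum>n\<in>S. real (weight q n) * exp (- b M * real (energy n) - \<tau> * real (cnt n)))
     \<le> exp (\<Sum>j=1..M. real (q j) * phi (b M * real j + \<tau>))"
    by (rule weight_sum_le[OF qpos S]) (use pos in auto)
  also have "(\<Sum>j=1..M. real (q j) * phi (b M * real j + \<tau>)) \<le> logZ (dsum q \<tau>) (b M)"
    by (rule finite_sum_le_has_sum[OF logZ_has_sum[OF B assms(2,3)]])
      (use pos in \<open>auto intro!: mult_nonneg_nonneg less_imp_le[OF phi_pos]\<close>)
  finally show ?thesis by simp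
qed

end

section \<open>Partitions with few parts\<close>


context qseq
begin

text \<open>This serves to find a tilt with a prescribed value of \<open>D1\<close> by the
  intermediate value theorem.\<close>

lemma D1_continuous:
  assumes "M > 0"
  shows "continuous_on {0..1} (D1 M)"
  unfolding D1_def
proof (intro continuous_on_sum continuous_on_mult continuous_on_const)
  fix j assume "j \<in> J M"
  then have "b M * real j > 0" using b_root assms by (auto simp: J_def)
  then show "continuous_on {0..1} (breg (b M * real j))"
    by (intro DERIV_continuous_on) (auto intro!: DERIV_breg[THEN has_field_derivative_at_within])
qed

lemma b_powr_ge: "\<exists>k>0. \<forall>M>0. k * real M powr (d / (d + 1)) \<le> b M powr (- d)"
proof -
  obtain U where U: "U > 0" "\<And>M. M > 0 \<Longrightarrow> real M \<le> U * b M powr (- d - 1)"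
    using M_bounds by auto
  have "(1 / U) powr (d / (d + 1)) * real M powr (d / (d + 1)) \<le> b M powr (- d)" if M: "M > 0" for M
  proof -
    have "1 / U * real M \<le> b M powr (- d - 1)" using U(2)[OF M] U(1) by (simp add: field_simps)
    then have "(1 / U * real M) powr (d / (d + 1)) \<le> (b M powr (- d - 1)) powr (d / (d + 1))"
      using U(1) d by (intro powr_mono2) auto
    also have "\<dots> = b M powr (- d)"
    proof -
      have "(- d - 1) * (d / (d + 1)) = - d" using d by (simp add: field_simps)
      then show ?thesis by (simp add: powr_powr)
    qed
    finally show ?thesis by (simp only: powr_mult)
  qed
  moreover have "(1 / U) powr (d / (d + 1)) > 0" using U by simp
  ultimately show ?thesis by blast
qed

text \<open>With y = exp (\<open>\<tau>\<close> (Nbar - K)), the terms of the tilted sum are split by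
  \<open>y \<le> 1 + exp (- \<Psi>) y\<^sup>2 + exp \<Psi>\<close>, where the last summand is needed only if K \<open>\<le>\<close> Nbar.  The first two
  summands contribute at most S each, the tilted sum itself is at least 3 S.\<close>

lemma partition_lower_bound:
  "\<exists>k. eventually (\<lambda>M. exp (logZ (dsum q 0) (b M) + b M * real M) * real M powr (- k)
     \<le> (\<Sum>n | n \<in> level M \<and> real (cnt n) \<le> Nbar q M. real (weight q n))) sequentially"
proof -
  have d0: "d > 0" using d by simp
  from recursion_lower_bound[OF d0 c C] obtain A \<kappa> where A: "A > 0" and \<kappa>: "\<kappa> \<ge> 0" and
    rec: "\<forall>\<sigma> w. pgrowth c C d \<sigma> \<longrightarrow> w 0 = 1 \<longrightarrow> (\<forall>x. w x \<ge> 0) \<longrightarrow>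
    (\<forall>x\<ge>1. real x * w x = (\<Sum>k=1..x. \<sigma> k * w (x - k))) \<longrightarrow>
    (\<forall>x\<ge>1. \<exists>s>0. A * real x powr (- \<kappa>) * exp (logZ \<sigma> s + s * real x) \<le> w x)"
    by blast
  have wl: "\<exists>s>0. A * real x powr (- \<kappa>) * exp (logZ (dsum q \<tau>) s + s * real x) \<le> wlev q \<tau> x"
    if "0 \<le> \<tau>" "\<tau> \<le> 2" "x \<ge> 1" for \<tau> x
    by (rule rec[rule_format, OF dsum wlev_0 wlev_nonneg wlev_recursion]) (use that qpos in auto)
  obtain k1 where k1: "k1 > 0" "\<And>M \<tau>. M > 0 \<Longrightarrow> b M \<le> 1 \<Longrightarrow> 0 \<le> \<tau> \<Longrightarrow> \<tau> \<le> 1 \<Longrightarrow> k1 * \<tau>\<^sup>2 * b M powr (- d) \<le> D1 M \<tau>"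
    using D1_ge by blast
  obtain K where K: "K > 0" "\<And>M \<tau>. M > 0 \<Longrightarrow> b M \<le> 1 \<Longrightarrow> 0 \<le> \<tau> \<Longrightarrow> \<tau> \<le> 1 \<Longrightarrow> Dtot M (b M) (2 * \<tau>) \<le> K * D1 M \<tau>"
    using Dtot_le by blast
  obtain k2 where k2: "k2 > 0" "\<And>M s \<tau>. M > 0 \<Longrightarrow> s > 0 \<Longrightarrow> 0 \<le> \<tau> \<Longrightarrow> \<tau> \<le> 1 \<Longrightarrow> k2 * D1 M \<tau> \<le> Dtot M s \<tau>"
    using Dtot_ge by blast
  obtain k3 where k3: "k3 > 0" "\<And>M. M > 0 \<Longrightarrow> k3 * real M powr (d / (d + 1)) \<le> b M powr (- d)"
    using b_powr_ge by blast
  \<comment> \<open>If \<open>D1\<close> equals \<open>B0\<close> ln M, the tilt gains at least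
    M^(\<kappa> + 1): the power \<kappa> makes up for the loss in the recursion bound, and the extra
    factor M eventually exceeds 3 / A.\<close>
  define B0 where "B0 = (\<kappa> + 1) / k2"
  have B0: "B0 > 0" using \<kappa> k2 by (simp add: B0_def)
  \<comment> \<open>At \<tau> = 1 the value of \<open>D1\<close> is at least of the order of a
    positive power of M, so \<open>B0\<close> ln M is attained for some \<tau> <= 1.\<close>
  have ev1: "eventually (\<lambda>M. B0 * ln (real M) \<le> k1 * k3 * real M powr (d / (d + 1))) sequentially"
  proof -
    define e where "e = d / (d + 1)"
    have "e > 0" using d by (simp add: e_def)
    moreover have "k1 * k3 > 0" using k1 k3 by simp
    ultimately show ?thesis unfolding e_def[symmetric] using B0 by real_asymp
  qed
  have ev2: "eventually (\<lambda>M. 3 \<le> A * real M) sequentially" using A by real_asymp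
  have "eventually (\<lambda>M. exp (logZ (dsum q 0) (b M) + b M * real M) * real M powr (- (K * B0))
     \<le> (\<Sum>n | n \<in> level M \<and> real (cnt n) \<le> Nbar q M. real (weight q n))) sequentially"
    using ev1 ev2 b_small[of 1, simplified] eventually_ge_at_top[of 1]
  proof eventually_elim
    case (elim M)
    then have M: "M > 0" "b M \<le> 1" "M \<ge> 1" by auto
    have lnM: "ln (real M) \<ge> 0" using M by simp
    have "\<exists>\<tau>. 0 \<le> \<tau> \<and> \<tau> \<le> 1 \<and> D1 M \<tau> = B0 * ln (real M)"
    proof (rule IVT'[of "D1 M" 0 "B0 * ln (real M)" 1])
      show "D1 M 0 \<le> B0 * ln (real M)" using B0 lnM by (simp add: D1_def breg_0)
      have "B0 * ln (real M) \<le> k1 * (k3 * real M powr (d / (d + 1)))" using elim(1) by simp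
      also have "\<dots> \<le> k1 * b M powr (- d)" using k1 k3(2)[OF M(1)] by (intro mult_left_mono) auto
      also have "\<dots> \<le> D1 M 1" using k1(2)[OF M(1,2), of 1] by simp
      finally show "B0 * ln (real M) \<le> D1 M 1" .
    qed (use D1_continuous[OF M(1)] in auto)
    then obtain \<tau> where \<tau>: "0 \<le> \<tau>" "\<tau> \<le> 1" and D1: "D1 M \<tau> = B0 * ln (real M)" by blast
    \<comment> \<open>Only the positivity of s is known here, which is why \<open>Dtot_ge\<close> is
      uniform in s.\<close>
    obtain s where s: "s > 0" and
      ws: "A * real M powr (- \<kappa>) * exp (logZ (dsum q \<tau>) s + s * real M) \<le> wlev q \<tau> M"
      using wl[of \<tau> M] \<tau> M by auto
    define S where "S = exp (logZ (dsum q 0) (b M) + b M * real M)"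
    \<comment> \<open>The weighted sum of y^2 is at most exp (\<Psi>) S, and \<open>Dtot_le\<close>
      gives \<Psi> <= K \<open>B0\<close> ln M, so exp (\<Psi>) is at most a power of M.\<close>
    define \<Psi> where "\<Psi> = Dtot M (b M) (2 * \<tau>)"
    define y where "y = (\<lambda>n. exp (\<tau> * (Nbar q M - real (cnt n))))"
    define T where "T = (\<Sum>n | n \<in> level M \<and> real (cnt n) \<le> Nbar q M. real (weight q n))"
    have en: "energy n = M" if "n \<in> level M" for n using that by (simp add: level_def)
    have sub: "level M \<subseteq> {n \<in> conf. energy n \<le> M}" by (auto simp: level_def)
    have "(\<kappa> + 1) * ln (real M) = k2 * D1 M \<tau>" using k2(1) by (simp add: D1 B0_def)
    also have "\<dots> \<le> Dtot M s \<tau>" by (rule k2(2)[OF M(1) s \<tau>])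
    finally have "exp ((\<kappa> + 1) * ln (real M)) \<le> exp (Dtot M s \<tau>)" by simp
    then have MD: "real M powr (\<kappa> + 1) \<le> exp (Dtot M s \<tau>)" using M by (simp add: powr_def)
    have "3 * S \<le> (A * real M) * S" using elim(2) by (intro mult_right_mono) (auto simp: S_def)
    also have "\<dots> = A * real M powr (- \<kappa>) * real M powr (\<kappa> + 1) * S"
      using M by (simp add: mult.assoc powr_add[symmetric])
    also have "\<dots> \<le> A * real M powr (- \<kappa>) * exp (Dtot M s \<tau>) * S"
      using A MD by (intro mult_left_mono mult_right_mono) (auto simp: S_def)
    also have "\<dots> = exp (\<tau> * Nbar q M) * (A * real M powr (- \<kappa>) * exp (logZ (dsum q \<tau>) s + s * real M))"
    proof -
      have "Dtot M s \<tau> + (logZ (dsum q 0) (b M) + b M * real M) = \<tau> * Nbar q M + (logZ (dsum q \<tau>) s + s * real M)"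
        by (simp add: Dtot_def algebra_simps)
      then have "exp (Dtot M s \<tau>) * S = exp (\<tau> * Nbar q M) * exp (logZ (dsum q \<tau>) s + s * real M)"
        unfolding S_def by (simp only: exp_add[symmetric])
      then show ?thesis by (simp add: mult_ac)
    qed
    also have "\<dots> \<le> exp (\<tau> * Nbar q M) * wlev q \<tau> M" using ws by (intro mult_left_mono) auto
    also have "\<dots> = (\<Sum>n\<in>level M. real (weight q n) * y n)"
      unfolding wlev_def sum_distrib_left
      by (rule sum.cong) (auto simp: y_def right_diff_distrib exp_diff exp_minus field_simps)
    also have "\<dots> \<le> (\<Sum>n\<in>level M. real (weight q n) * (1 + exp (- \<Psi>) * (y n)\<^sup>2 + (if real (cnt n) \<le> Nbar q M then exp \<Psi> else 0)))"
    proof (intro sum_mono mult_left_mono)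
      fix n assume "n \<in> level M"
      have y0: "y n > 0" by (simp add: y_def)
      show "y n \<le> 1 + exp (- \<Psi>) * (y n)\<^sup>2 + (if real (cnt n) \<le> Nbar q M then exp \<Psi> else 0)"
      proof (cases "real (cnt n) \<le> Nbar q M")
        case True
        have "y n \<le> exp (- \<Psi>) * (y n)\<^sup>2 + exp \<Psi>"
        proof (cases "y n \<le> exp \<Psi>")
          case False
          then have "exp \<Psi> * y n \<le> y n * y n" using y0 by (intro mult_right_mono) auto
          then have "exp (- \<Psi>) * (exp \<Psi> * y n) \<le> exp (- \<Psi>) * (y n * y n)" by (intro mult_left_mono) auto
          moreover have "exp (- \<Psi>) * (exp \<Psi> * y n) = y n" by (simp add: mult.assoc[symmetric] exp_add[symmetric])
          ultimately have "y n \<le> exp (- \<Psi>) * (y n)\<^sup>2" by (simp add: power2_eq_square)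
          then show ?thesis by (simp add: add_increasing2)
        qed (simp add: add_increasing)
        then show ?thesis using True by simp
      next
        case False
        then have "\<tau> * (Nbar q M - real (cnt n)) \<le> 0" using \<tau> by (intro mult_nonneg_nonpos) auto
        then have "y n \<le> 1" by (simp add: y_def)
        then show ?thesis using False by (simp add: add_increasing2)
      qed
    qed auto
    also have "\<dots> = (\<Sum>n\<in>level M. real (weight q n)) + exp (- \<Psi>) * (\<Sum>n\<in>level M. real (weight q n) * (y n)\<^sup>2) + exp \<Psi> * T"
    proof -
      have "T = (\<Sum>n\<in>level M. if real (cnt n) \<le> Nbar q M then real (weight q n) else 0)"
        unfolding T_def by (rule sum.inter_filter) (rule finite_level)
      then show ?thesis
        by (simp add: sum_distrib_left sum.distrib[symmetric]) (rule sum.cong; simp add: algebra_simps)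
    qed
    also have "(\<Sum>n\<in>level M. real (weight q n)) \<le> S"
    proof -
      have "(\<Sum>n\<in>level M. real (weight q n)) = exp (b M * real M) * (\<Sum>n\<in>level M. real (weight q n) * exp (- b M * real (energy n) - 0 * real (cnt n)))"
        unfolding sum_distrib_left by (rule sum.cong) (auto simp: en exp_minus)
      also have "\<dots> \<le> exp (b M * real M) * exp (logZ (dsum q 0) (b M))"
        by (intro mult_left_mono weight_sum_le_logZ M sub) auto
      also have "\<dots> = S" by (simp add: S_def exp_add)
      finally show ?thesis .
    qed
    also have "(\<Sum>n\<in>level M. real (weight q n) * (y n)\<^sup>2) \<le> exp \<Psi> * S"
    proof -
      have "(\<Sum>n\<in>level M. real (weight q n) * (y n)\<^sup>2) = exp (2 * \<tau> * Nbar q M + b M * real M) * (\<Sum>n\<in>level M. real (weight q n) * exp (- b M * real (energy n) - (2 * \<tau>) * real (cnt n)))"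
        unfolding sum_distrib_left
      proof (rule sum.cong[OF refl])
        fix n assume n: "n \<in> level M"
        have "(y n)\<^sup>2 = exp (2 * \<tau> * Nbar q M + b M * real M) * exp (- b M * real (energy n) - (2 * \<tau>) * real (cnt n))"
          unfolding y_def en[OF n] by (simp add: exp_add[symmetric] power2_eq_square algebra_simps)
        then show "real (weight q n) * (y n)\<^sup>2 = exp (2 * \<tau> * Nbar q M + b M * real M) * (real (weight q n) * exp (- b M * real (energy n) - (2 * \<tau>) * real (cnt n)))"
          by (simp only: mult_ac)
      qed
      also have "\<dots> \<le> exp (2 * \<tau> * Nbar q M + b M * real M) * exp (logZ (dsum q (2 * \<tau>)) (b M))"
        using \<tau> by (intro mult_left_mono weight_sum_le_logZ M sub) auto
      also have "\<dots> = exp \<Psi> * S"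
      proof -
        have "2 * \<tau> * Nbar q M + b M * real M + logZ (dsum q (2 * \<tau>)) (b M) = \<Psi> + (logZ (dsum q 0) (b M) + b M * real M)"
          by (simp add: \<Psi>_def Dtot_def)
        then show ?thesis unfolding S_def by (simp only: exp_add[symmetric])
      qed
      finally show ?thesis .
    qed
    finally have "3 * S \<le> S + exp (- \<Psi>) * (exp \<Psi> * S) + exp \<Psi> * T" by simp
    moreover have "exp (- \<Psi>) * (exp \<Psi> * S) = S" by (simp add: mult.assoc[symmetric] exp_add[symmetric])
    ultimately have "S \<le> exp \<Psi> * T" by simp
    then have "S * exp (- \<Psi>) \<le> exp \<Psi> * T * exp (- \<Psi>)" by (intro mult_right_mono) auto
    also have "\<dots> = T" by (simp add: exp_minus)
    finally have ST: "S * exp (- \<Psi>) \<le> T" .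
    have "\<Psi> \<le> K * (B0 * ln (real M))" using K(2)[OF M(1,2) \<tau>] by (simp add: \<Psi>_def D1)
    then have "exp (- (K * B0) * ln (real M)) \<le> exp (- \<Psi>)" by simp
    then have "real M powr (- (K * B0)) \<le> exp (- \<Psi>)" using M by (simp add: powr_def)
    then have "S * real M powr (- (K * B0)) \<le> S * exp (- \<Psi>)" by (intro mult_left_mono) (auto simp: S_def)
    then show ?case using ST unfolding S_def T_def by linarith
  qed
  then show ?thesis by blast
qed

end

section \<open>Splitting off the ground state\<close>


definition with_ground :: "nat \<Rightarrow> (nat \<Rightarrow> nat) \<Rightarrow> nat \<Rightarrow> nat" where
  "with_ground N m = m(0 := N - cnt m)"

text \<open>The total N being prescribed, a sequence is determined by its excited part, and N_0
  takes up the remaining particles.\<close>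

lemma Omega_eq: "Omega M N = with_ground N ` {m \<in> conf. energy m \<le> M \<and> cnt m \<le> N}"
proof (rule set_eqI, rule iffI)
  fix n assume "n \<in> Omega M N"
  then have f: "finite {j. n j \<noteq> 0}" and N: "(\<Sum>j | n j \<noteq> 0. n j) = N" and M: "(\<Sum>j | n j \<noteq> 0. j * n j) \<le> M"
    by (auto simp: Omega_def)
  define m where "m = n(0 := 0)"
  define A where "A = insert 0 {j. n j \<noteq> 0}"
  have A: "finite A" "0 \<in> A" using f by (auto simp: A_def)
  have mA: "cnt m = (\<Sum>j\<in>A. m j)" "energy m = (\<Sum>j\<in>A. j * m j)"
    by (rule conf_sums; use A in \<open>auto simp: A_def m_def split: if_splits\<close>)+
  have nA: "N = (\<Sum>j\<in>A. n j)" "(\<Sum>j | n j \<noteq> 0. j * n j) = (\<Sum>j\<in>A. j * n j)"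
    unfolding N[symmetric] by (rule sum.mono_neutral_left; use A in \<open>auto simp: A_def\<close>)+
  have c: "(\<Sum>j\<in>A - {0}. m j) = (\<Sum>j\<in>A - {0}. n j)" by (rule sum.cong) (auto simp: m_def)
  have cm: "N = n 0 + cnt m"
    unfolding nA(1) mA(1) sum.remove[OF A] c by (simp add: m_def)
  have "energy m = (\<Sum>j\<in>A. j * n j)"
    unfolding mA(2) by (rule sum.cong) (auto simp: m_def)
  then have "energy m \<le> M" using M nA(2) by simp
  moreover have "m \<in> conf"
  proof -
    have "{j. m j \<noteq> 0} \<subseteq> {j. n j \<noteq> 0}" by (auto simp: m_def split: if_splits)
    then have "finite {j. m j \<noteq> 0}" using f by (rule finite_subset)
    then show ?thesis by (simp add: conf_def m_def)
  qed
  moreover have "n = with_ground N m"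
    using cm by (auto simp: with_ground_def fun_eq_iff) (auto simp: m_def)
  ultimately show "n \<in> with_ground N ` {m \<in> conf. energy m \<le> M \<and> cnt m \<le> N}" using cm by auto
next
  fix n assume "n \<in> with_ground N ` {m \<in> conf. energy m \<le> M \<and> cnt m \<le> N}"
  then obtain m where m: "m \<in> conf" "energy m \<le> M" "cnt m \<le> N" and n: "n = with_ground N m" by auto
  define A where "A = insert 0 {j. m j \<noteq> 0}"
  have A: "finite A" "0 \<in> A" using m by (auto simp: A_def conf_def)
  have m0: "m 0 = 0" using m by (simp add: conf_def)
  have mA: "cnt m = (\<Sum>j\<in>A. m j)" "energy m = (\<Sum>j\<in>A. j * m j)"
    by (rule conf_sums; use A in \<open>auto simp: A_def\<close>)+
  have supp: "{j. n j \<noteq> 0} \<subseteq> A" by (auto simp: n with_ground_def A_def)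
  then have f: "finite {j. n j \<noteq> 0}" using A finite_subset by blast
  have nA: "(\<Sum>j | n j \<noteq> 0. n j) = (\<Sum>j\<in>A. n j)" "(\<Sum>j | n j \<noteq> 0. j * n j) = (\<Sum>j\<in>A. j * n j)"
    by (rule sum.mono_neutral_left; use A supp in auto)+
  have c: "(\<Sum>j\<in>A - {0}. n j) = (\<Sum>j\<in>A - {0}. m j)" by (rule sum.cong) (auto simp: n with_ground_def)
  have "cnt m = (\<Sum>j\<in>A - {0}. m j)" unfolding mA(1) sum.remove[OF A] m0 by simp
  then have "(\<Sum>j\<in>A. n j) = N" unfolding sum.remove[OF A] c using m(3) by (simp add: n with_ground_def)
  moreover have "(\<Sum>j\<in>A. j * n j) = energy m"
    unfolding mA(2) by (rule sum.cong) (auto simp: n with_ground_def)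
  ultimately show "n \<in> Omega M N" using m f unfolding Omega_def mem_Collect_eq nA by auto
qed

lemma inj_with_ground: "inj_on (with_ground N) conf"
proof (rule inj_onI, rule ext)
  fix m m' j assume h: "m \<in> conf" "m' \<in> conf" "with_ground N m = with_ground N m'"
  show "m j = m' j"
    using h(1,2) fun_cong[OF h(3), of j] by (cases "j = 0") (auto simp: conf_def with_ground_def)
qed

lemma finite_Omega: "finite (Omega M N)"
  unfolding Omega_eq by (intro finite_imageI finite_subset[OF _ finite_conf_energy[of M]]) auto

lemma weight_with_ground:
  assumes "m \<in> conf" "cnt m \<le> N"
  shows "weight q (with_ground N m) = ((N - cnt m + q 0 - 1) choose (N - cnt m)) * weight q m"
proof -
  define A where "A = insert 0 {j. m j \<noteq> 0}"
  have A: "finite A" "0 \<in> A" using assms by (auto simp: A_def conf_def)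
  have m0: "m 0 = 0" using assms by (simp add: conf_def)
  have w: "weight q (with_ground N m) = (\<Prod>j\<in>A. (with_ground N m j + q j - 1) choose (with_ground N m j))"
    "weight q m = (\<Prod>j\<in>A. (m j + q j - 1) choose (m j))"
    by (rule conf_sums; use A in \<open>auto simp: A_def with_ground_def split: if_splits\<close>)+
  have c: "(\<Prod>j\<in>A - {0}. (with_ground N m j + q j - 1) choose (with_ground N m j)) = (\<Prod>j\<in>A - {0}. (m j + q j - 1) choose (m j))"
    by (rule prod.cong) (auto simp: with_ground_def)
  show ?thesis unfolding w prod.remove[OF A] c m0 by (simp add: with_ground_def)
qed

section \<open>Probabilities as quotients of weight sums\<close>

lemma P_meas_measure:
  assumes "A \<subseteq> Omega M N"
  shows "measure (P_meas q M N) A = (\<Sum>n\<in>A. real (weight q n)) / (\<Sum>n\<in>Omega M N. real (weight q n))"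
proof -
  let ?W = "real (\<Sum>n'\<in>Omega M N. weight q n')"
  have "emeasure (P_meas q M N) A = (\<Sum>n\<in>A. ennreal (real (weight q n) / ?W))"
    unfolding P_meas_def by (rule emeasure_point_measure_finite[OF finite_Omega assms])
  also have "\<dots> = ennreal (\<Sum>n\<in>A. real (weight q n) / ?W)"
    by (rule sum_ennreal) (auto intro!: divide_nonneg_nonneg sum_nonneg)
  finally have "measure (P_meas q M N) A = (\<Sum>n\<in>A. real (weight q n) / ?W)"
    by (simp add: measure_def sum_nonneg divide_nonneg_nonneg)
  then show ?thesis by (simp add: sum_divide_distrib)
qed

lemma P_meas_le_1: "measure (P_meas q M N) (A \<inter> Omega M N) \<le> 1"
proof -
  have "(\<Sum>n\<in>A \<inter> Omega M N. real (weight q n)) \<le> (\<Sum>n\<in>Omega M N. real (weight q n))"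
    by (rule sum_mono2[OF finite_Omega]) auto
  then show ?thesis
    by (subst P_meas_measure) (auto simp: divide_le_eq_1 sum_nonneg not_less intro: order.antisym)
qed

text \<open>The quotient of the two binomial coefficients is the product of (N + i) / (N - k + i)
  for i from 1 to p, and each factor is at most 1 + k. The bound is free of N, as the constants of
  the theorem have to be.\<close>

lemma binomial_shift_le:
  assumes "k \<le> N"
  shows "(N + p) choose N \<le> (1 + k) ^ p * ((N - k + p) choose (N - k))"
proof (induction p)
  case (Suc p)
  have sym: "(n + p) choose n = (n + p) choose p" for n p :: nat
    using binomial_symmetric[of p "n + p"] by simp
  have absorb: "Suc p * ((n + Suc p) choose n) = Suc (n + p) * ((n + p) choose n)" for n
  proof -
    have "(n + Suc p) choose n = Suc (n + p) choose Suc p"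
      using sym[of n "Suc p"] by (simp only: add_Suc_right)
    then show ?thesis using Suc_times_binomial[of p "n + p"] sym[of n p] by (simp only:)
  qed
  have "Suc p * ((N + Suc p) choose N) = Suc (N + p) * ((N + p) choose N)"
    by (rule absorb)
  also have "\<dots> \<le> ((1 + k) * Suc (N - k + p)) * ((1 + k) ^ p * ((N - k + p) choose (N - k)))"
  proof (rule mult_le_mono[OF _ Suc.IH])
    have "k * 1 \<le> k * Suc (N - k + p)" by (intro mult_le_mono2) simp
    then show "Suc (N + p) \<le> (1 + k) * Suc (N - k + p)" using assms by simp
  qed
  also have "\<dots> = (1 + k) ^ Suc p * (Suc (N - k + p) * ((N - k + p) choose (N - k)))"
    by (simp only: power_Suc mult_ac)
  also have "Suc (N - k + p) * ((N - k + p) choose (N - k)) = Suc p * ((N - k + Suc p) choose (N - k))"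
    by (rule absorb[symmetric])
  also have "(1 + k) ^ Suc p * (Suc p * ((N - k + Suc p) choose (N - k))) = Suc p * ((1 + k) ^ Suc p * ((N - k + Suc p) choose (N - k)))"
    by (simp only: mult_ac)
  finally show ?case using Suc_mult_le_cancel1 by blast
qed simp

lemma binomial_mono_shift:
  assumes "k \<le> N"
  shows "(k + p) choose k \<le> ((N + p) choose (N::nat))"
proof -
  have sym: "(n + p) choose n = (n + p) choose p" for n :: nat
    using binomial_symmetric[of p "n + p"] by simp
  show ?thesis unfolding sym using assms by (intro binomial_right_mono) auto
qed

context qseq
begin

lemma Nbar_pos: "M > 0 \<Longrightarrow> Nbar q M > 0"
proof -
  assume M: "M > 0"
  have p: "psi (b M * real j) > 0" if "j \<ge> 1" for j using b_root M that by (intro psi_pos) auto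
  have "(\<Sum>j\<in>{1}. real (q j) * psi (b M * real j)) \<le> Nbar q M"
    by (rule finite_sum_le_has_sum[OF Nbar_has_sum[OF M]]) (use p in \<open>auto intro!: mult_nonneg_nonneg less_imp_le[OF p]\<close>)
  moreover have "0 < real (q 1) * psi (b M * real 1)" using p[of 1] qpos[of 1] by simp
  ultimately show ?thesis by simp
qed

text \<open>In the numerator the weight of the ground state is replaced by its largest value
  \<open>C0\<close>, that for N particles in the ground state. In the denominator, configurations
  with K <= Nbar have at least \<open>C0\<close> / (1 + Nbar)^(q 0 - 1). So \<open>C0\<close>
  cancels, and with it the dependence on N.\<close>

lemma prob_le:
  assumes M: "M > 0" and N: "real N > Nbar q M" and \<Delta>: "\<Delta> \<ge> 0"
    and R: "((\<lambda>j. real (q j) * rho (b M * real j / 2)) has_sum R) {1..}"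
    and t: "0 \<le> t" "t \<le> b M / 2"
    and low: "exp (logZ (dsum q 0) (b M) + b M * real M) * real M powr (- k)
     \<le> (\<Sum>n | n \<in> level M \<and> real (cnt n) \<le> Nbar q M. real (weight q n))"
  shows "measure (P_meas q M N) {n \<in> Omega M N. \<bar>real (n 0) - (real N - Nbar q M)\<bar> > \<Delta>}
    \<le> 2 * (1 + Nbar q M) ^ (q 0 - 1) * real M powr k * exp (R * t\<^sup>2 / 2 - t * \<Delta>)"
proof -
  define p where "p = q 0 - 1"
  have q0: "x + q 0 - 1 = x + p" for x using qpos[of 0] by (simp add: p_def)
  define X where "X = {m \<in> conf. energy m \<le> M \<and> cnt m \<le> N}"
  have finX: "finite X" unfolding X_def by (rule finite_subset[OF _ finite_conf_energy[of M]]) auto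
  have injX: "inj_on (with_ground N) X" by (rule inj_on_subset[OF inj_with_ground]) (auto simp: X_def)
  define Y where "Y = {m \<in> X. \<bar>real (cnt m) - Nbar q M\<bar> > \<Delta>}"
  define L where "L = {n. n \<in> level M \<and> real (cnt n) \<le> Nbar q M}"
  define S where "S = exp (logZ (dsum q 0) (b M) + b M * real M)"
  define W where "W = (\<Sum>n\<in>Omega M N. real (weight q n))"
  have M1: "real M powr (- k) > 0" using M by simp
  have wX: "weight q (with_ground N m) = ((N - cnt m + p) choose (N - cnt m)) * weight q m" if "m \<in> X" for m
    using weight_with_ground[of m N q, unfolded q0] that by (simp add: X_def)
  have bad: "{n \<in> Omega M N. \<bar>real (n 0) - (real N - Nbar q M)\<bar> > \<Delta>} = with_ground N ` Y"
  proof -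
    have e: "\<bar>real (with_ground N m 0) - (real N - Nbar q M)\<bar> = \<bar>real (cnt m) - Nbar q M\<bar>" if "m \<in> X" for m
      using that by (simp add: X_def with_ground_def of_nat_diff)
    show ?thesis unfolding Omega_eq X_def[symmetric] Y_def using e by auto
  qed
  have YX: "Y \<subseteq> X" by (auto simp: Y_def)
  define C0 where "C0 = real ((N + p) choose N)"
  have C0: "C0 > 0" by (simp add: C0_def)
  have num: "(\<Sum>n\<in>with_ground N ` Y. real (weight q n)) \<le> C0 * (2 * S * exp (R * t\<^sup>2 / 2 - t * \<Delta>))"
  proof -
    have "(\<Sum>n\<in>with_ground N ` Y. real (weight q n)) = (\<Sum>m\<in>Y. real (weight q (with_ground N m)))"
      by (subst sum.reindex) (auto intro: inj_on_subset[OF injX YX])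
    also have "\<dots> \<le> (\<Sum>m\<in>Y. C0 * real (weight q m))"
    proof (rule sum_mono)
      fix m assume "m \<in> Y"
      then have m: "m \<in> X" using YX by blast
      have "real ((N - cnt m + p) choose (N - cnt m)) \<le> C0"
        unfolding C0_def of_nat_le_iff by (rule binomial_mono_shift) simp
      then show "real (weight q (with_ground N m)) \<le> C0 * real (weight q m)"
        unfolding wX[OF m] of_nat_mult by (intro mult_right_mono) auto
    qed
    also have "\<dots> = C0 * (\<Sum>m\<in>Y. real (weight q m))" by (rule sum_distrib_left[symmetric])
    also have "(\<Sum>m\<in>Y. real (weight q m)) \<le> 2 * S * exp (R * t\<^sup>2 / 2 - t * \<Delta>)"
    proof -
      define e1 where "e1 = (\<lambda>h m. real (weight q m) * exp (- b M * real (energy m) - h * real (cnt m)))"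
      have "(\<Sum>m\<in>Y. real (weight q m)) \<le> (\<Sum>m\<in>Y. exp (b M * real M - t * \<Delta>) * (exp (t * Nbar q M) * e1 t m + exp (- t * Nbar q M) * e1 (- t) m))"
      proof (rule sum_mono)
        fix m assume mY: "m \<in> Y"
        then have E: "energy m \<le> M" and D: "\<bar>real (cnt m) - Nbar q M\<bar> > \<Delta>" by (auto simp: Y_def X_def)
        define z where "z = real (cnt m) - Nbar q M"
        \<comment> \<open>The bad configurations only satisfy E <= M; since b is positive, the
          factor exp (b (M - E)) may be inserted at no cost.\<close>
        have "b M * real (energy m) \<le> b M * real M" using E b_root[OF M] by (intro mult_left_mono) auto
        then have A: "exp (b M * real M - b M * real (energy m)) \<ge> 1" by simp
        \<comment> \<open>Both deviations are treated at once: one of the two exponentials is at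
          least exp (t \<Delta>).\<close>
        have B: "1 \<le> exp (- t * \<Delta>) * (exp (- t * z) + exp (t * z))"
        proof -
          consider "z \<ge> \<Delta>" | "- z \<ge> \<Delta>" using D unfolding z_def by linarith
          then show ?thesis
          proof cases
            case 1
            then have "t * \<Delta> \<le> t * z" using t by (intro mult_left_mono) auto
            then have "1 \<le> exp (- t * \<Delta>) * exp (t * z)" by (simp add: exp_add[symmetric])
            then show ?thesis by (simp add: distrib_left add_increasing)
          next
            case 2
            then have "t * \<Delta> \<le> t * (- z)" using t by (intro mult_left_mono) auto
            then have "1 \<le> exp (- t * \<Delta>) * exp (- t * z)" by (simp add: exp_add[symmetric])
            then show ?thesis by (simp add: distrib_left add_increasing2)
          qed
        qed
        have "1 * 1 \<le> exp (b M * real M - b M * real (energy m)) * (exp (- t * \<Delta>) * (exp (- t * z) + exp (t * z)))"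
          using A B by (intro mult_mono) auto
        then have "real (weight q m) * 1 \<le> real (weight q m) * (exp (b M * real M - b M * real (energy m)) * (exp (- t * \<Delta>) * (exp (- t * z) + exp (t * z))))"
          by (intro mult_left_mono) auto
        also have "\<dots> = exp (b M * real M - t * \<Delta>) * (exp (t * Nbar q M) * e1 t m + exp (- t * Nbar q M) * e1 (- t) m)"
          unfolding e1_def z_def
          by (simp add: distrib_left exp_add[symmetric] mult_ac) (simp add: algebra_simps exp_add[symmetric])
        finally show "real (weight q m) \<le> exp (b M * real M - t * \<Delta>) * (exp (t * Nbar q M) * e1 t m + exp (- t * Nbar q M) * e1 (- t) m)" by simp
      qed
      also have "\<dots> = exp (b M * real M - t * \<Delta>) * (exp (t * Nbar q M) * (\<Sum>m\<in>Y. e1 t m) + exp (- t * Nbar q M) * (\<Sum>m\<in>Y. e1 (- t) m))"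
        by (simp add: sum_distrib_left sum.distrib distrib_left)
      also have "\<dots> \<le> exp (b M * real M - t * \<Delta>) * (exp (t * Nbar q M) * exp (logZ (dsum q 0) (b M) - t * Nbar q M + R * t\<^sup>2 / 2)
          + exp (- t * Nbar q M) * exp (logZ (dsum q 0) (b M) - (- t) * Nbar q M + R * (- t)\<^sup>2 / 2))"
        unfolding e1_def using t
        by (intro mult_left_mono add_mono chernoff[OF M R]) (auto simp: Y_def X_def)
      also have "\<dots> = 2 * S * exp (R * t\<^sup>2 / 2 - t * \<Delta>)"
        unfolding S_def by (simp add: distrib_left exp_add[symmetric] mult_ac)
      finally show ?thesis .
    qed
    finally show ?thesis using C0 by (simp add: mult_left_mono)
  qed
  have den: "C0 * (S * real M powr (- k)) \<le> (1 + Nbar q M) ^ p * W"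
  proof -
    \<comment> \<open>Here N > Nbar enters: at most Nbar excited particles always fit.\<close>
    have LX: "L \<subseteq> X" using N by (auto simp: L_def X_def level_def)
    have "C0 * (S * real M powr (- k)) \<le> C0 * (\<Sum>m\<in>L. real (weight q m))"
      using low C0 unfolding S_def L_def by (intro mult_left_mono) auto
    also have "\<dots> = (\<Sum>m\<in>L. C0 * real (weight q m))" by (rule sum_distrib_left)
    also have "\<dots> \<le> (\<Sum>m\<in>L. (1 + Nbar q M) ^ p * real (weight q (with_ground N m)))"
    proof (rule sum_mono)
      fix m assume m: "m \<in> L"
      then have mX: "m \<in> X" using LX by blast
      have "C0 \<le> real ((1 + cnt m) ^ p * ((N - cnt m + p) choose (N - cnt m)))"
        unfolding C0_def of_nat_le_iff by (rule binomial_shift_le) (use mX in \<open>simp add: X_def\<close>)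
      also have "\<dots> = (1 + real (cnt m)) ^ p * real ((N - cnt m + p) choose (N - cnt m))" by simp
      also have "\<dots> \<le> (1 + Nbar q M) ^ p * real ((N - cnt m + p) choose (N - cnt m))"
        using m by (intro mult_right_mono power_mono) (auto simp: L_def)
      finally have "C0 * real (weight q m) \<le> (1 + Nbar q M) ^ p * real ((N - cnt m + p) choose (N - cnt m)) * real (weight q m)"
        by (rule mult_right_mono) simp
      then show "C0 * real (weight q m) \<le> (1 + Nbar q M) ^ p * real (weight q (with_ground N m))"
        unfolding wX[OF mX] by (simp add: mult.assoc)
    qed
    also have "\<dots> = (1 + Nbar q M) ^ p * (\<Sum>m\<in>L. real (weight q (with_ground N m)))" by (rule sum_distrib_left[symmetric])
    also have "\<dots> \<le> (1 + Nbar q M) ^ p * W"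
    proof (rule mult_left_mono)
      have "(\<Sum>m\<in>L. real (weight q (with_ground N m))) \<le> (\<Sum>m\<in>X. real (weight q (with_ground N m)))"
        by (rule sum_mono2[OF finX LX]) simp
      also have "\<dots> = W" unfolding W_def Omega_eq X_def[symmetric] by (simp add: sum.reindex[OF injX])
      finally show "(\<Sum>m\<in>L. real (weight q (with_ground N m))) \<le> W" .
    qed (use Nbar_pos[OF M] in simp)
    finally show ?thesis .
  qed
  have S0: "S > 0" by (simp add: S_def)
  have N0: "(1 + Nbar q M) ^ p > 0" using Nbar_pos[OF M] by simp
  have "0 < C0 * (S * real M powr (- k))" using C0 S0 M1 by simp
  then have W0: "W > 0" using den N0 by (smt (verit) zero_less_mult_pos)
  have "measure (P_meas q M N) (with_ground N ` Y) = (\<Sum>n\<in>with_ground N ` Y. real (weight q n)) / W"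
    unfolding W_def by (rule P_meas_measure) (auto simp: Omega_eq Y_def X_def)
  also have "\<dots> \<le> (C0 * (2 * S * exp (R * t\<^sup>2 / 2 - t * \<Delta>))) / W"
    using num W0 by (intro divide_right_mono) auto
  also have "\<dots> \<le> 2 * (1 + Nbar q M) ^ p * real M powr k * exp (R * t\<^sup>2 / 2 - t * \<Delta>)"
  proof -
    define e where "e = exp (R * t\<^sup>2 / 2 - t * \<Delta>)"
    have kk: "real M powr (- k) * real M powr k = 1" using M by (simp add: powr_add[symmetric])
    have "C0 * (2 * S * e) = 2 * real M powr k * e * (C0 * (S * real M powr (- k)))"
      using kk by (simp add: mult_ac)
    also have "\<dots> \<le> 2 * real M powr k * e * ((1 + Nbar q M) ^ p * W)"
      using den by (intro mult_left_mono) (auto simp: e_def)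
    finally show ?thesis using W0 unfolding e_def[symmetric] by (simp add: pos_divide_le_eq mult_ac)
  qed
  finally show ?thesis unfolding bad p_def .
qed

end

section \<open>Concentration\<close>


context qseq
begin

lemma Nbar_at_top: "filterlim (\<lambda>M. Nbar q M) at_top sequentially"
proof -
  obtain l where l: "l > 0" "\<And>M. M > 0 \<Longrightarrow> b M \<le> 1 \<Longrightarrow> l * b M powr (- d) \<le> Nbar q M"
    using Nbar_ge by blast
  obtain k where k: "k > 0" "\<And>M. M > 0 \<Longrightarrow> k * real M powr (d / (d + 1)) \<le> b M powr (- d)"
    using b_powr_ge by blast
  define e where "e = d / (d + 1)"
  have "e > 0" using d by (simp add: e_def)
  then have "filterlim (\<lambda>M::nat. l * (k * real M powr e)) at_top sequentially"
    using l(1) k(1) by real_asymp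
  then show ?thesis
  proof (rule filterlim_at_top_mono)
    show "eventually (\<lambda>M. l * (k * real M powr e) \<le> Nbar q M) sequentially"
      using b_small[of 1, simplified] eventually_ge_at_top[of 1]
    proof eventually_elim
      case (elim M)
      then have "l * (k * real M powr e) \<le> l * b M powr (- d)"
        using k(2)[of M] l(1) unfolding e_def by (intro mult_left_mono) auto
      then show ?case using l(2)[of M] elim by simp
    qed
  qed
qed

text \<open>M is at most of order Nbar^((d + 1) / d), with an exponent below 2; the slack up to 3
  swallows the constants.\<close>

lemma ln_M_le: "eventually (\<lambda>M. ln (real M) \<le> 3 * ln (Nbar q M)) sequentially"
proof -
  obtain l where l: "l > 0" "\<And>M. M > 0 \<Longrightarrow> b M \<le> 1 \<Longrightarrow> l * b M powr (- d) \<le> Nbar q M"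
    using Nbar_ge by blast
  obtain U where U: "U > 0" "\<And>M. M > 0 \<Longrightarrow> real M \<le> U * b M powr (- d - 1)"
    using M_bounds by auto
  define e where "e = (d + 1) / d"
  have e: "e > 0" "e < 3" using d by (auto simp: e_def field_simps)
  have "eventually (\<lambda>x. U * (x / l) powr e \<le> x powr 3) at_top"
    using e l(1) U(1) by real_asymp
  then have "eventually (\<lambda>M. U * (Nbar q M / l) powr e \<le> Nbar q M powr 3) sequentially"
    by (rule eventually_compose_filterlim[OF _ Nbar_at_top])
  then show ?thesis using b_small[of 1, simplified] eventually_ge_at_top[of 1]
  proof eventually_elim
    case (elim M)
    then have M: "M > 0" by simp
    have "b M powr (- d) \<le> Nbar q M / l" using l(2)[OF M elim(2)] l(1) by (simp add: field_simps)
    then have "(b M powr (- d)) powr e \<le> (Nbar q M / l) powr e" using e by (intro powr_mono2) auto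
    moreover have "(b M powr (- d)) powr e = b M powr (- d - 1)"
    proof -
      have "(- d) * e = - d - 1" using d by (simp add: e_def field_simps)
      then show ?thesis by (simp add: powr_powr)
    qed
    ultimately have "U * b M powr (- d - 1) \<le> U * (Nbar q M / l) powr e" using U(1) by (intro mult_left_mono) auto
    then have "real M \<le> Nbar q M powr 3" using U(2)[OF M] elim(1) by linarith
    then have "ln (real M) \<le> ln (Nbar q M powr 3)" using M by (intro ln_mono) auto
    then show ?case using Nbar_pos[OF M] by (simp add: ln_realpow)
  qed
qed

lemma chernoff_parameters:
  assumes chi: "\<And>x. x \<ge> 0 \<Longrightarrow> chi x > 0"
  shows "\<exists>C2. \<exists>c2>0. eventually (\<lambda>M. \<exists>t R. ((\<lambda>j. real (q j) * rho (b M * real j / 2)) has_sum R) {1..} \<and>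
    0 \<le> t \<and> t \<le> b M / 2 \<and> R * t\<^sup>2 / 2 \<le> C2 * ln (Nbar q M) \<and>
    c2 * chi (Nbar q M) * ln (Nbar q M) \<le> t * Delta d chi (Nbar q M)) sequentially"
proof -
  obtain l where l: "l > 0" "\<And>M. M > 0 \<Longrightarrow> b M \<le> 1 \<Longrightarrow> l * b M powr (- d) \<le> Nbar q M"
    using Nbar_ge by blast
  obtain K where K: "K > 0" "\<And>M. M > 0 \<Longrightarrow> b M \<le> 1 \<Longrightarrow>
    \<exists>R. ((\<lambda>j. real (q j) * rho (b M * real j / 2)) has_sum R) {1..} \<and> R \<le> K * Rfun (b M)"
    using rho_sum by blast
  have evx: "eventually (\<lambda>M. Nbar q M \<ge> 1) sequentially"
    using Nbar_at_top by (simp add: filterlim_at_top)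
  show ?thesis
  proof (cases "d > 2")
    case True
    define e where "e = 2 / d"
    have e: "0 < e" "e < 1" using True by (auto simp: e_def)
    have "eventually (\<lambda>x. ln x / x \<le> (l / x) powr e / 4) at_top"
      using e l(1) by real_asymp
    then have "eventually (\<lambda>M. ln (Nbar q M) / Nbar q M \<le> (l / Nbar q M) powr e / 4) sequentially"
      by (rule eventually_compose_filterlim[OF _ Nbar_at_top])
    then have "eventually (\<lambda>M. \<exists>t R. ((\<lambda>j. real (q j) * rho (b M * real j / 2)) has_sum R) {1..} \<and>
      0 \<le> t \<and> t \<le> b M / 2 \<and> R * t\<^sup>2 / 2 \<le> (K / (2 * l)) * ln (Nbar q M) \<and>
      1 * chi (Nbar q M) * ln (Nbar q M) \<le> t * Delta d chi (Nbar q M)) sequentially"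
      using b_small[of 1, simplified] eventually_ge_at_top[of 1] evx
    proof eventually_elim
      case (elim M)
      then have M: "M > 0" by simp
      have B: "b M > 0" using b_root M by simp
      define x where "x = Nbar q M"
      have x: "x \<ge> 1" using elim by (simp add: x_def)
      have lnx: "ln x \<ge> 0" using x by simp
      have lx: "l * b M powr (- d) \<le> x" using l(2)[OF M elim(2)] by (simp add: x_def)
      define t where "t = sqrt (ln x / x)"
      have t2: "t\<^sup>2 = ln x / x" using x lnx by (simp add: t_def)
      have t0: "t \<ge> 0" using x lnx by (simp add: t_def)
      obtain R where R: "((\<lambda>j. real (q j) * rho (b M * real j / 2)) has_sum R) {1..}" "R \<le> K * Rfun (b M)"
        using K(2)[OF M elim(2)] by blast
      have "t\<^sup>2 \<le> (b M / 2)\<^sup>2"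
      proof -
        have "l / x \<le> b M powr d" using lx x B by (simp add: powr_minus field_simps)
        then have "(l / x) powr e \<le> (b M powr d) powr e" using e l(1) x by (intro powr_mono2) auto
        also have "\<dots> = (b M)\<^sup>2" using True B by (simp add: powr_powr e_def)
        finally have "(l / x) powr e / 4 \<le> (b M / 2)\<^sup>2" by (simp add: power_divide)
        then show ?thesis using elim(1) unfolding t2 x_def by linarith
      qed
      then have tb: "t \<le> b M / 2" using B by (intro power2_le_imp_le[of t]) auto
      have "R * t\<^sup>2 / 2 \<le> K / (2 * l) * ln x"
      proof -
        have "R * t\<^sup>2 \<le> (K * (x / l)) * t\<^sup>2"
        proof (rule mult_right_mono)
          have "b M powr (- d) \<le> x / l" using lx l(1) by (simp add: field_simps)
          then have "K * Rfun (b M) \<le> K * (x / l)" using K(1) True by (intro mult_left_mono) (auto simp: Rfun_def)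
          then show "R \<le> K * (x / l)" using R(2) by simp
        qed simp
        also have "\<dots> = K / l * ln x" using x by (simp add: t2)
        finally show ?thesis by simp
      qed
      moreover have "1 * chi x * ln x \<le> t * Delta d chi x"
      proof -
        have "t * sqrt (x * ln x) = sqrt (ln x / x * (x * ln x))" by (simp only: t_def real_sqrt_mult)
        also have "ln x / x * (x * ln x) = (ln x)\<^sup>2" using x by (simp add: power2_eq_square)
        finally have "t * sqrt (x * ln x) = ln x" using lnx by simp
        then have "t * Delta d chi x = ln x * chi x" using True x by (simp add: Delta_def mult.assoc[symmetric])
        then show ?thesis by simp
      qed
      ultimately show ?case using R(1) t0 tb unfolding x_def by blast
    qed
    then show ?thesis by (intro exI[of _ "K / (2 * l)"] exI[of _ "1::real"]) auto
  next
    case False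
    have "eventually (\<lambda>x. 1 + ln (x / l) \<le> 3 * ln x) at_top"
      using l(1) by real_asymp
    then have "eventually (\<lambda>M. 1 + ln (Nbar q M / l) \<le> 3 * ln (Nbar q M)) sequentially"
      by (rule eventually_compose_filterlim[OF _ Nbar_at_top])
    then have "eventually (\<lambda>M. \<exists>t R. ((\<lambda>j. real (q j) * rho (b M * real j / 2)) has_sum R) {1..} \<and>
      0 \<le> t \<and> t \<le> b M / 2 \<and> R * t\<^sup>2 / 2 \<le> (3 * K / 8) * ln (Nbar q M) \<and>
      (l powr (1 / d) / 2) * chi (Nbar q M) * ln (Nbar q M) \<le> t * Delta d chi (Nbar q M)) sequentially"
      using b_small[of 1, simplified] eventually_ge_at_top[of 1] evx
    proof eventually_elim
      case (elim M)
      then have M: "M > 0" by simp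
      have B: "b M > 0" using b_root M by simp
      define x where "x = Nbar q M"
      have x: "x \<ge> 1" using elim by (simp add: x_def)
      have lnx: "ln x \<ge> 0" using x by simp
      have lx: "l * b M powr (- d) \<le> x" using l(2)[OF M elim(2)] by (simp add: x_def)
      obtain R where R: "((\<lambda>j. real (q j) * rho (b M * real j / 2)) has_sum R) {1..}" "R \<le> K * Rfun (b M)"
        using K(2)[OF M elim(2)] by blast
      have "R * (b M / 2)\<^sup>2 / 2 \<le> 3 * K / 8 * ln x"
      proof -
        have "1 / b M \<le> b M powr (- d)"
        proof -
          have "b M powr d \<le> b M powr 1" using d B elim(2) by (intro powr_mono') auto
          then show ?thesis using B by (simp add: powr_minus field_simps)
        qed
        also have "\<dots> \<le> x / l" using lx l(1) by (simp add: field_simps)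
        finally have "ln (1 / b M) \<le> ln (x / l)" using B by (intro ln_mono) auto
        then have L: "1 + ln (1 / b M) \<le> 3 * ln x" using elim(1) by (simp add: x_def)
        have "R * (b M)\<^sup>2 \<le> (K * (b M powr (- 2) * (1 + ln (1 / b M)))) * (b M)\<^sup>2"
          using R(2) False by (intro mult_right_mono) (auto simp: Rfun_def)
        also have "\<dots> = K * (1 + ln (1 / b M)) * (b M powr (- 2) * (b M)\<^sup>2)" by (simp only: mult_ac)
        also have "b M powr (- 2) * (b M)\<^sup>2 = 1" using B by (simp add: powr_minus)
        also have "K * (1 + ln (1 / b M)) * 1 \<le> K * (3 * ln x)" using L K(1) by simp
        finally show ?thesis by (simp add: power_divide)
      qed
      moreover have "l powr (1 / d) / 2 * chi x * ln x \<le> b M / 2 * Delta d chi x"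
      proof -
        have "(l * b M powr (- d)) powr (1 / d) \<le> x powr (1 / d)" using lx l(1) d by (intro powr_mono2) auto
        moreover have "(l * b M powr (- d)) powr (1 / d) = l powr (1 / d) * b M powr (- 1)"
        proof -
          have "(- d) * (1 / d) = - 1" using d by simp
          then show ?thesis by (simp add: powr_mult powr_powr)
        qed
        ultimately have "b M * (l powr (1 / d) * b M powr (- 1)) \<le> b M * x powr (1 / d)"
          using B by (intro mult_left_mono) auto
        then have "l powr (1 / d) \<le> b M * x powr (1 / d)" using B by (simp add: powr_minus field_simps)
        then have "l powr (1 / d) * (chi x * ln x / 2) \<le> b M * x powr (1 / d) * (chi x * ln x / 2)"
          using lnx chi[of x] x by (intro mult_right_mono) auto
        then show ?thesis using False by (simp add: Delta_def mult_ac)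
      qed
      ultimately show ?case using R(1) B unfolding x_def by (intro exI[of _ "b M / 2"] exI[of _ R]) auto
    qed
    moreover have "l powr (1 / d) / 2 > 0" using l(1) by simp
    ultimately show ?thesis by blast
  qed
qed

lemma concentration_eventually:
  assumes chi: "\<And>x. x \<ge> 0 \<Longrightarrow> chi x > 0" and chi_lim: "filterlim chi at_top at_top"
  shows "eventually (\<lambda>M. \<forall>N. real N > Nbar q M \<longrightarrow>
    measure (P_meas q M N) {n \<in> Omega M N. \<bar>real (n 0) - (real N - Nbar q M)\<bar> > Delta d chi (Nbar q M)}
      \<le> 2 * Nbar q M powi (- int m)) sequentially"
proof -
  obtain k where k: "eventually (\<lambda>M. exp (logZ (dsum q 0) (b M) + b M * real M) * real M powr (- k)
     \<le> (\<Sum>n | n \<in> level M \<and> real (cnt n) \<le> Nbar q M. real (weight q n))) sequentially"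
    using partition_lower_bound by blast
  obtain C2 c2 where c2: "c2 > 0" and par: "eventually (\<lambda>M. \<exists>t R. ((\<lambda>j. real (q j) * rho (b M * real j / 2)) has_sum R) {1..} \<and>
    0 \<le> t \<and> t \<le> b M / 2 \<and> R * t\<^sup>2 / 2 \<le> C2 * ln (Nbar q M) \<and>
    c2 * chi (Nbar q M) * ln (Nbar q M) \<le> t * Delta d chi (Nbar q M)) sequentially"
    using chernoff_parameters[where chi = chi, OF chi] by blast
  define p where "p = q 0 - 1"
  \<comment> \<open>The exponents of Nbar to be beaten: (1 + Nbar)^p is at most Nbar^(2 p) once Nbar
    >= 2, M^k is treated by \<open>ln_M_le\<close>, \<open>C2\<close> stems from the quadratic term,
    and m is demanded by the claim.\<close>
  define E where "E = 2 * real p + 3 * \<bar>k\<bar> + C2 + real m"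
  have "eventually (\<lambda>x. chi x \<ge> E / c2) at_top" using chi_lim by (simp add: filterlim_at_top)
  then have evE: "eventually (\<lambda>M. chi (Nbar q M) \<ge> E / c2) sequentially"
    by (rule eventually_compose_filterlim[OF _ Nbar_at_top])
  have evx: "eventually (\<lambda>M. Nbar q M \<ge> 2) sequentially"
    using Nbar_at_top by (simp add: filterlim_at_top)
  show ?thesis using k par evE evx ln_M_le eventually_ge_at_top[of 1]
  proof eventually_elim
    case (elim M)
    then have M: "M > 0" by simp
    define x where "x = Nbar q M"
    have x: "x \<ge> 2" using elim by (simp add: x_def)
    have lnx: "ln x \<ge> 0" using x by simp
    obtain t R where R: "((\<lambda>j. real (q j) * rho (b M * real j / 2)) has_sum R) {1..}"
      and t: "0 \<le> t" "t \<le> b M / 2" and Rt: "R * t\<^sup>2 / 2 \<le> C2 * ln x"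
      and t\<Delta>: "c2 * chi x * ln x \<le> t * Delta d chi x"
      using elim(2) unfolding x_def by blast
    have \<Delta>0: "Delta d chi x \<ge> 0"
      unfolding Delta_def using x lnx chi[of x] by (auto intro!: mult_nonneg_nonneg)
    show ?case
    proof (intro allI impI)
      fix N assume N: "real N > Nbar q M"
      have "measure (P_meas q M N) {n \<in> Omega M N. \<bar>real (n 0) - (real N - Nbar q M)\<bar> > Delta d chi x}
        \<le> 2 * (1 + Nbar q M) ^ p * real M powr k * exp (R * t\<^sup>2 / 2 - t * Delta d chi x)"
        unfolding p_def by (rule prob_le[OF M N \<Delta>0 R t elim(1)])
      also have "\<dots> \<le> 2 * exp (2 * real p * ln x) * exp (3 * \<bar>k\<bar> * ln x) * exp (C2 * ln x - E * ln x)"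
      proof (intro mult_mono)
        have "1 + x \<le> x ^ 2"
        proof -
          have "2 * x \<le> x * x" using x by (intro mult_right_mono) auto
          then show ?thesis unfolding power2_eq_square using x by linarith
        qed
        then have "(1 + x) ^ p \<le> (x ^ 2) ^ p" using x by (intro power_mono) auto
        also have "\<dots> = x ^ (2 * p)" by (rule power_mult[symmetric])
        also have "\<dots> = x powr real (2 * p)" using x by (intro powr_realpow[symmetric]) auto
        also have "\<dots> = exp (2 * real p * ln x)" using x by (simp add: powr_def)
        finally show "(1 + Nbar q M) ^ p \<le> exp (2 * real p * ln x)" by (simp add: x_def)
        have "k * ln (real M) \<le> \<bar>k\<bar> * ln (real M)" using M by (intro mult_right_mono) auto
        also have "\<dots> \<le> \<bar>k\<bar> * (3 * ln x)" using elim(5) by (intro mult_left_mono) (auto simp: x_def)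
        finally show "real M powr k \<le> exp (3 * \<bar>k\<bar> * ln x)" using M by (simp add: powr_def mult_ac)
        have "E \<le> c2 * chi x" using elim(3) c2 by (simp add: x_def field_simps)
        then have "E * ln x \<le> c2 * chi x * ln x" using lnx by (intro mult_right_mono)
        then show "exp (R * t\<^sup>2 / 2 - t * Delta d chi x) \<le> exp (C2 * ln x - E * ln x)"
          using Rt t\<Delta> by simp
      qed (use x in \<open>auto simp: x_def\<close>)
      also have "\<dots> = 2 * exp (2 * real p * ln x + 3 * \<bar>k\<bar> * ln x + (C2 * ln x - E * ln x))"
        by (simp only: exp_add mult.assoc)
      also have "2 * real p * ln x + 3 * \<bar>k\<bar> * ln x + (C2 * ln x - E * ln x) = - real m * ln x"
        by (simp add: E_def algebra_simps)
      also have "exp (- real m * ln x) = x powi (- int m)"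
        using x by (simp add: power_int_minus exp_minus exp_of_nat_mult)
      finally show "measure (P_meas q M N) {n \<in> Omega M N. \<bar>real (n 0) - (real N - Nbar q M)\<bar> > Delta d chi (Nbar q M)}
        \<le> 2 * Nbar q M powi (- int m)" by (simp add: x_def)
    qed
  qed
qed

lemma concentration:
  assumes chi: "\<And>x. x \<ge> 0 \<Longrightarrow> chi x > 0" and chi_lim: "filterlim chi at_top at_top"
  shows "\<exists>C. \<forall>M N. M > 0 \<longrightarrow> real N > Nbar q M \<longrightarrow>
    measure (P_meas q M N) {n \<in> Omega M N. \<bar>real (n 0) - (real N - Nbar q M)\<bar> > Delta d chi (Nbar q M)}
      \<le> C * Nbar q M powi (- int m)"
proof -
  obtain M0 where M0: "\<And>M N. M \<ge> M0 \<Longrightarrow> real N > Nbar q M \<Longrightarrow>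
    measure (P_meas q M N) {n \<in> Omega M N. \<bar>real (n 0) - (real N - Nbar q M)\<bar> > Delta d chi (Nbar q M)}
      \<le> 2 * Nbar q M powi (- int m)"
    using concentration_eventually[where chi = chi, OF assms] unfolding eventually_sequentially by blast
  \<comment> \<open>For the finitely many M below \<open>M0\<close> the probability is at most 1 =
    Nbar^m Nbar^(- m). The absolute value keeps the summand for M = 0 nonnegative, where no root
    exists and \<open>Nbar\<close> is unspecified.\<close>
  define C where "C = 2 + (\<Sum>M<M0. \<bar>Nbar q M\<bar> ^ m)"
  show ?thesis
  proof (intro exI[of _ C] allI impI)
    fix M N :: nat assume M: "M > 0" and N: "real N > Nbar q M"
    have x: "Nbar q M > 0" by (rule Nbar_pos[OF M])
    then have pm: "Nbar q M powi (- int m) > 0" by simp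
    let ?A = "{n \<in> Omega M N. \<bar>real (n 0) - (real N - Nbar q M)\<bar> > Delta d chi (Nbar q M)}"
    show "measure (P_meas q M N) ?A \<le> C * Nbar q M powi (- int m)"
    proof (cases "M \<ge> M0")
      case True
      have "2 \<le> C" by (simp add: C_def sum_nonneg)
      then have "2 * Nbar q M powi (- int m) \<le> C * Nbar q M powi (- int m)"
        using pm by (intro mult_right_mono) auto
      then show ?thesis using M0[OF True N] by linarith
    next
      case False
      have e: "?A \<inter> Omega M N = ?A" by auto
      have "measure (P_meas q M N) ?A \<le> 1"
        using P_meas_le_1[of q M N ?A] unfolding e .
      also have "1 = Nbar q M ^ m * Nbar q M powi (- int m)" using x by (simp add: power_int_minus)
      also have "\<dots> \<le> C * Nbar q M powi (- int m)"
      proof (rule mult_right_mono)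
        have "\<bar>Nbar q M\<bar> ^ m \<le> (\<Sum>M<M0. \<bar>Nbar q M\<bar> ^ m)"
          using False by (intro member_le_sum) auto
        then show "Nbar q M ^ m \<le> C" using x by (simp add: C_def)
      qed (use pm in simp)
      finally show ?thesis .
    qed
  qed
qed

end

text \<open>Beyond some j0 the quotient of q (j) by j^(d - 1) is within 1 / 2 of Q >= 1; before
  that, the minimum and maximum of finitely many positive quotients suffice.\<close>

lemma qgrowth_of_asymptotics:
  assumes Q: "Q \<ge> 1" and qpos: "\<And>j. q j > 0"
    and asym: "(\<lambda>j. real (q j) - Q * real j powr (d - 1)) \<in> o(\<lambda>j. real j powr (d - 1))"
  shows "\<exists>c>0. \<exists>C>0. qgrowth c C d q"
proof -
  define r where "r = (\<lambda>j. real (q j) / real j powr (d - 1))"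
  have "eventually (\<lambda>j. norm (real (q j) - Q * real j powr (d - 1)) \<le> 1 / 2 * norm (real j powr (d - 1))) at_top"
    using landau_o.smallD[OF asym, of "1 / 2"] by simp
  then obtain j0 where j0: "\<And>j. j \<ge> j0 \<Longrightarrow> \<bar>real (q j) - Q * real j powr (d - 1)\<bar> \<le> 1 / 2 * real j powr (d - 1)"
    by (auto simp: eventually_sequentially)
  define I where "I = {1..j0}"
  define c where "c = Min (insert (1 / 2) (r ` I))"
  define C where "C = Max (insert (Q + 1) (r ` I))"
  have fin: "finite (insert (1 / 2) (r ` I))" "finite (insert (Q + 1) (r ` I))" by (auto simp: I_def)
  have rpos: "r j > 0" if "j \<ge> 1" for j using qpos[of j] that by (simp add: r_def)
  have c0: "c > 0" unfolding c_def using fin rpos by (auto simp: I_def)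
  have C0: "C > 0" unfolding C_def using Q Max_ge[OF fin(2) insertI1] by linarith
  have "c \<le> r j \<and> r j \<le> C" if j: "j \<ge> 1" for j
  proof (cases "j \<le> j0")
    case True
    then have "r j \<in> r ` I" using j by (simp add: I_def)
    then show ?thesis unfolding c_def C_def using fin by (auto intro: Min_le Max_ge)
  next
    case False
    have P: "real j powr (d - 1) > 0" using j by simp
    have "\<bar>real (q j) - Q * real j powr (d - 1)\<bar> \<le> 1 / 2 * real j powr (d - 1)" using j0 False by simp
    then have "(Q - 1 / 2) * real j powr (d - 1) \<le> real (q j)" "real (q j) \<le> (Q + 1 / 2) * real j powr (d - 1)"
      unfolding left_diff_distrib distrib_right by linarith+
    then have "Q - 1 / 2 \<le> r j" "r j \<le> Q + 1 / 2" using P by (auto simp: r_def field_simps)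
    moreover have "c \<le> 1 / 2" unfolding c_def by (rule Min_le[OF fin(1) insertI1])
    moreover have "Q + 1 \<le> C" unfolding C_def by (rule Max_ge[OF fin(2) insertI1])
    ultimately show ?thesis using Q by linarith
  qed
  then have "qgrowth c C d q" unfolding qgrowth_def r_def by (auto simp: field_simps)
  then show ?thesis using c0 C0 by blast
qed

theorem theorem1:
  fixes d Q :: real and q :: "nat \<Rightarrow> nat" and chi :: "real \<Rightarrow> real"
  assumes "d > 1" and "Q \<ge> 1"
    and "\<And>j. q j > 0"
    and "(\<lambda>j. real (q j) - Q * real j powr (d - 1)) \<in> o(\<lambda>j. real j powr (d - 1))"
    and "\<And>x. x \<ge> 0 \<Longrightarrow> chi x > 0"
    and "filterlim chi at_top at_top"
  shows "\<exists>C :: nat \<Rightarrow> real. \<forall>M N :: nat. M > 0 \<longrightarrow> N > 0 \<longrightarrow> real N > Nbar q M \<longrightarrow>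
    (\<forall>m\<ge>1. measure (P_meas q M N)
        {n \<in> Omega M N. \<bar>real (n 0) - (real N - Nbar q M)\<bar> > Delta d chi (Nbar q M)}
      \<le> C m * Nbar q M powi (- int m))"
proof -
  obtain c1 C1 where c1: "c1 > 0" "C1 > 0" and qg: "qgrowth c1 C1 d q"
    using qgrowth_of_asymptotics[of Q q d] assms(2,3,4) by blast
  obtain c C where c: "c > 0" "C > 0"
    and ds: "\<And>\<tau>. 0 \<le> \<tau> \<Longrightarrow> \<tau> \<le> 2 \<Longrightarrow> pgrowth c C d (dsum q \<tau>)"
    using dsum_pgrowth[OF assms(1) c1] qg by blast
  interpret qseq q d c1 C1 c C
    by (rule qseq.intro[OF assms(1) c1 c qg ds assms(3)])
  have "\<exists>C. \<forall>m. \<forall>M N. M > 0 \<longrightarrow> real N > Nbar q M \<longrightarrow>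
    measure (P_meas q M N) {n \<in> Omega M N. \<bar>real (n 0) - (real N - Nbar q M)\<bar> > Delta d chi (Nbar q M)}
      \<le> C m * Nbar q M powi (- int m)"
    by (rule choice, rule allI, rule concentration[where chi = chi, OF assms(5,6)])
  then show ?thesis by blast
qed

end
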